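(* Let $k$ be a field of characteristic zero containing a primitive third root of unity $\zeta_3$. Let $S\subset\mathbb{P}^4$ be the quartic del Pezzo surface over $k$ given by $$S=\{x_1^2+\zeta_3x_2^2+\zeta_3^2x_3^2+x_4^2=x_1^2+\zeta_3^2x_2^2+\zeta_3x_3^2+x_5^2=0\},$$ with the action of the group $G=C_3\rtimes C_4$ generated by $$(x_1,\ldots,x_5)\mapsto(x_2,x_3,x_1,\zeta_3x_4,\zeta_3^2x_5),\qquad (x_1,\ldots,x_5)\mapsto(x_1,x_3,x_2,-x_5,x_4).$$ Then the $G$-action on $S$ is stably linearizable.
   Context: $C_m$ denotes the cyclic group of order $m$. A generically free regular action of a finite group $G$ on a variety $X$ over $k$ is called stably linearizable if, for some integer $r\geq 0$, $X\times\mathbb{P}^r$ (with the trivial $G$-action on $\mathbb{P}^r$) is $G$-equivariantly birational over $k$ to the projectivization of a linear $G$-representation over $k$. *)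

theory Defs
  imports
    "HOL-Algebra.Algebraic_Closure_Type"
    "HOL-Algebra.Group_Action"
    "HOL-Algebra.Elementary_Groups"
    "HOL-Library.Poly_Mapping"
    "Jordan_Normal_Form.Matrix"
begin

text \<open>
  Varieties over a field \<open>k\<close> of characteristic zero are represented by their sets of geometric
  points, i.e. points over the algebraic closure of \<open>k\<close>; closed and open subsets, morphisms and
  rational maps are those given by polynomials with coefficients in \<open>k\<close>.

  All varieties live in a product of projective spaces.  A list \<open>[n\<^sub>0, ..., n\<^sub>s]\<close> of dimensions
  stands for \<open>P^{n\<^sub>0} \<times> ... \<times> P^{n\<^sub>s}\<close>; a point is the list of its components.
\<close>

section \<open>Products of projective spaces\<close>

text \<open>A point of projective space is the set of all its homogeneous coordinate vectors.\<close>

definition proj_point :: "'a::field vec \<Rightarrow> 'a vec set" where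
  "proj_point v = {c \<cdot>\<^sub>v v | c. c \<noteq> 0}"

definition proj_space :: "nat \<Rightarrow> 'a::field vec set set" where
  "proj_space n = {proj_point v | v. v \<in> carrier_vec (Suc n) \<and> v \<noteq> 0\<^sub>v (Suc n)}"

type_synonym 'k mpoint = "'k alg_closure vec set list"

definition multiproj :: "nat list \<Rightarrow> 'k::field mpoint set" where
  "multiproj ns = {p. list_all2 (\<lambda>x n. x \<in> proj_space n) p ns}"

definition coords :: "'a vec set list \<Rightarrow> (nat \<Rightarrow> 'a vec) set" where
  "coords p = {x. \<forall>j<length p. x j \<in> p ! j}"


section \<open>Multihomogeneous polynomials\<close>

text \<open>The variable \<open>(j, i)\<close> is the \<open>i\<close>-th homogeneous coordinate on the \<open>j\<close>-th factor.\<close>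

type_synonym 'k mpol = "(nat \<times> nat \<Rightarrow>\<^sub>0 nat) \<Rightarrow>\<^sub>0 'k"

definition mvar :: "nat \<Rightarrow> nat \<Rightarrow> 'k::comm_ring_1 mpol" where
  "mvar j i = Poly_Mapping.single (Poly_Mapping.single (j, i) 1) 1"

definition mconst :: "'k::comm_ring_1 \<Rightarrow> 'k mpol" where
  "mconst c = Poly_Mapping.single 0 c"

definition multihom :: "nat list \<Rightarrow> (nat \<Rightarrow> nat) \<Rightarrow> 'k::field mpol \<Rightarrow> bool" where
  "multihom ns d f \<longleftrightarrow>
     (\<forall>m \<in> Poly_Mapping.keys f.
        Poly_Mapping.keys m \<subseteq> (SIGMA j:{..<length ns}. {..ns ! j}) \<and>
        (\<forall>j<length ns. (\<Sum>i\<le>ns ! j. Poly_Mapping.lookup m (j, i)) = d j))"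

definition meval :: "'k::field mpol \<Rightarrow> (nat \<Rightarrow> 'k alg_closure vec) \<Rightarrow> 'k alg_closure" where
  "meval f x =
     (\<Sum>m\<in>Poly_Mapping.keys f. to_ac (Poly_Mapping.lookup f m) *
        (\<Prod>(j, i)\<in>Poly_Mapping.keys m. (x j $ i) ^ Poly_Mapping.lookup m (j, i)))"

definition vanishes_at :: "'k::field mpol \<Rightarrow> 'k mpoint \<Rightarrow> bool" where
  "vanishes_at f p \<longleftrightarrow> (\<forall>x\<in>coords p. meval f x = 0)"


section \<open>Zariski topology over the ground field\<close>

definition zero_locus :: "nat list \<Rightarrow> 'k::field mpol set \<Rightarrow> 'k mpoint set" where
  "zero_locus ns F = {p \<in> multiproj ns. \<forall>f\<in>F. vanishes_at f p}"

definition zariski_closed :: "nat list \<Rightarrow> 'k::field mpoint set \<Rightarrow> bool" where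
  "zariski_closed ns Z \<longleftrightarrow> (\<exists>F. (\<forall>f\<in>F. \<exists>d. multihom ns d f) \<and> Z = zero_locus ns F)"

definition dense_open :: "nat list \<Rightarrow> 'k::field mpoint set \<Rightarrow> 'k mpoint set \<Rightarrow> bool" where
  "dense_open ns V U \<longleftrightarrow>
     (\<exists>Z. zariski_closed ns Z \<and> U = V - Z) \<and>
     (\<forall>Z. zariski_closed ns Z \<and> U \<subseteq> Z \<longrightarrow> V \<subseteq> Z)"


section \<open>Morphisms and group actions\<close>

text \<open>
  Morphisms over \<open>k\<close>: locally, each component is given by a tuple of multihomogeneous
  polynomials over \<open>k\<close> of one common multidegree, wherever these do not all vanish.
\<close>

definition regular_map ::
  "nat list \<Rightarrow> 'k::field mpoint set \<Rightarrow> nat list \<Rightarrow> 'k mpoint set \<Rightarrow> ('k mpoint \<Rightarrow> 'k mpoint) \<Rightarrow> bool"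
where
  "regular_map ns U ms W \<phi> \<longleftrightarrow>
     \<phi> \<in> U \<rightarrow> W \<and>
     (\<forall>p\<in>U. \<forall>j<length ms. \<exists>d F.
        (\<forall>i\<le>ms ! j. multihom ns d (F i)) \<and>
        (\<exists>i\<le>ms ! j. \<not> vanishes_at (F i) p) \<and>
        (\<forall>q\<in>U. (\<exists>i\<le>ms ! j. \<not> vanishes_at (F i) q) \<longrightarrow>
           (\<forall>x\<in>coords q. \<phi> q ! j = proj_point (vec (Suc (ms ! j)) (\<lambda>i. meval (F i) x)))))"

definition regular_action ::
  "('g, 'b) monoid_scheme \<Rightarrow> nat list \<Rightarrow> 'k::field mpoint set \<Rightarrow>
   ('g \<Rightarrow> 'k mpoint \<Rightarrow> 'k mpoint) \<Rightarrow> bool"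
where
  "regular_action G ns V a \<longleftrightarrow>
     group_action G V a \<and> (\<forall>g\<in>carrier G. regular_map ns V ns V (a g))"

definition generically_free ::
  "('g, 'b) monoid_scheme \<Rightarrow> nat list \<Rightarrow> 'k::field mpoint set \<Rightarrow>
   ('g \<Rightarrow> 'k mpoint \<Rightarrow> 'k mpoint) \<Rightarrow> bool"
where
  "generically_free G ns V a \<longleftrightarrow>
     (\<exists>U. dense_open ns V U \<and> (\<forall>p\<in>U. stabilizer G a p = {\<one>\<^bsub>G\<^esub>}))"

text \<open>
  A birational map is an isomorphism between dense open subsets.  The equation below is the
  equality of rational maps \<open>\<phi> \<circ> a g = b g \<circ> \<phi>\<close>, tested on the dense open set where \<open>\<phi>\<close> and
  \<open>\<phi> \<circ> a g\<close> are both defined through \<open>U\<close>.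
\<close>

definition equivariantly_birational ::
  "('g, 'b) monoid_scheme \<Rightarrow>
   nat list \<Rightarrow> 'k::field mpoint set \<Rightarrow> ('g \<Rightarrow> 'k mpoint \<Rightarrow> 'k mpoint) \<Rightarrow>
   nat list \<Rightarrow> 'k mpoint set \<Rightarrow> ('g \<Rightarrow> 'k mpoint \<Rightarrow> 'k mpoint) \<Rightarrow> bool"
where
  "equivariantly_birational G ns V a ms Y b \<longleftrightarrow>
     (\<exists>U W \<phi> \<psi>. dense_open ns V U \<and> dense_open ms Y W \<and>
        regular_map ns U ms W \<phi> \<and> regular_map ms W ns U \<psi> \<and>
        (\<forall>p\<in>U. \<psi> (\<phi> p) = p) \<and> (\<forall>q\<in>W. \<phi> (\<psi> q) = q) \<and>
        (\<forall>g\<in>carrier G. \<forall>p\<in>U. a g p \<in> U \<longrightarrow> \<phi> (a g p) = b g (\<phi> p)))"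


section \<open>Stable linearizability\<close>

definition times_proj :: "'k::field mpoint set \<Rightarrow> nat \<Rightarrow> 'k mpoint set" where
  "times_proj V r = {p @ [y] | p y. p \<in> V \<and> y \<in> proj_space r}"

definition times_proj_action ::
  "('g \<Rightarrow> 'k::field mpoint \<Rightarrow> 'k mpoint) \<Rightarrow> 'g \<Rightarrow> 'k mpoint \<Rightarrow> 'k mpoint"
where
  "times_proj_action a g p = a g (butlast p) @ [last p]"

definition GL :: "nat \<Rightarrow> 'k::field mat monoid" where
  "GL n = units_of (ring_mat TYPE('k) n ())"

definition proj_rep_action ::
  "('g \<Rightarrow> 'k::field mat) \<Rightarrow> 'g \<Rightarrow> 'k mpoint \<Rightarrow> 'k mpoint"
where
  "proj_rep_action \<rho> g p = map ((`) (\<lambda>v. map_mat to_ac (\<rho> g) *\<^sub>v v)) p"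

definition stably_linearizable ::
  "('g, 'b) monoid_scheme \<Rightarrow> nat list \<Rightarrow> 'k::field mpoint set \<Rightarrow>
   ('g \<Rightarrow> 'k mpoint \<Rightarrow> 'k mpoint) \<Rightarrow> bool"
where
  "stably_linearizable G ns V a \<longleftrightarrow>
     finite (carrier G) \<and> regular_action G ns V a \<and> generically_free G ns V a \<and>
     (\<exists>r N. \<exists>\<rho> \<in> hom G (GL (Suc N) :: 'k mat monoid).
        equivariantly_birational G
          (ns @ [r]) (times_proj V r) (times_proj_action a)
          [N] (multiproj [N]) (proj_rep_action \<rho>))"


section \<open>The group and the surface\<close>

definition semidirect_product ::
  "('h \<Rightarrow> 'n \<Rightarrow> 'n) \<Rightarrow> 'n monoid \<Rightarrow> 'h monoid \<Rightarrow> ('n \<times> 'h) monoid"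
where
  "semidirect_product \<theta> K H =
     \<lparr>carrier = carrier K \<times> carrier H,
      monoid.mult = (\<lambda>(a, b) (c, d). (a \<otimes>\<^bsub>K\<^esub> \<theta> b c, b \<otimes>\<^bsub>H\<^esub> d)),
      one = (\<one>\<^bsub>K\<^esub>, \<one>\<^bsub>H\<^esub>)\<rparr>"

text \<open>The generator of \<open>C\<^sub>4\<close> acts on \<open>C\<^sub>3\<close> by inversion, the only nontrivial possibility.\<close>

definition C3_C4 :: "(int \<times> int) monoid" where
  "C3_C4 =
     semidirect_product
       (\<lambda>b c. if even b then c else inv\<^bsub>integer_mod_group 3\<^esub> c)
       (integer_mod_group 3) (integer_mod_group 4)"

definition quadric1 :: "'k::field \<Rightarrow> 'k mpol" where
  "quadric1 z =
     mvar 0 0 ^ 2 + mconst z * mvar 0 1 ^ 2 + mconst (z ^ 2) * mvar 0 2 ^ 2 + mvar 0 3 ^ 2"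

definition quadric2 :: "'k::field \<Rightarrow> 'k mpol" where
  "quadric2 z =
     mvar 0 0 ^ 2 + mconst (z ^ 2) * mvar 0 1 ^ 2 + mconst z * mvar 0 2 ^ 2 + mvar 0 4 ^ 2"

definition dP4 :: "'k::field \<Rightarrow> 'k mpoint set" where
  "dP4 z = zero_locus [4] {quadric1 z, quadric2 z}"

definition lin_sigma :: "'k::field \<Rightarrow> 'k alg_closure vec \<Rightarrow> 'k alg_closure vec" where
  "lin_sigma z v = vec_of_list [v $ 1, v $ 2, v $ 0, to_ac z * v $ 3, to_ac (z ^ 2) * v $ 4]"

definition lin_tau :: "'k::field alg_closure vec \<Rightarrow> 'k alg_closure vec" where
  "lin_tau v = vec_of_list [v $ 0, v $ 2, v $ 1, - (v $ 4), v $ 3]"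

text \<open>
  \<open>(a, b) = (1, 0)\<^sup>a (0, 1)\<^sup>b\<close> acts as \<open>\<sigma>\<^sup>a \<circ> \<tau>\<^sup>b\<close>, so that the generators of \<open>C\<^sub>3\<close> and \<open>C\<^sub>4\<close> act by
  \<open>\<sigma>\<close> and \<open>\<tau>\<close>.
\<close>

definition dP4_action :: "'k::field \<Rightarrow> int \<times> int \<Rightarrow> 'k mpoint \<Rightarrow> 'k mpoint" where
  "dP4_action z = (\<lambda>(a, b). \<lambda>p\<in>dP4 z.
     map ((`) ((lin_sigma z ^^ nat a) \<circ> (lin_tau ^^ nat b))) p)"

end

theory Submission
  imports Defs "HOL-Library.Nat_Bijection"
begin

text \<open>
  Take \<open>r = 2\<close>.  In coordinates \<open>b\<^sub>0, b\<^sub>1, b\<^sub>2, b\<^sub>3\<close> permuted cyclically by \<open>\<tau>\<close> and scaled by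
  \<open>\<zeta>, \<zeta>\<^sup>2, \<zeta>, \<zeta>\<^sup>2\<close> under \<open>\<sigma>\<close>, the surface is \<open>b\<^sub>0 b\<^sub>2 = b\<^sub>1 + b\<^sub>3\<close>, \<open>b\<^sub>1 b\<^sub>3 = b\<^sub>0 + b\<^sub>2\<close>.  Together with the
  two coordinates of \<open>P\<^sup>2\<close>, a point gives functions \<open>A\<^sub>0, ..., A\<^sub>3\<close> of a cube root of unity \<open>w\<close> such
  that \<open>A\<^sub>j(w) A\<^sub>j\<^sub>+\<^sub>1(w\<^sup>2) = \<kappa> (1 + w b\<^sub>j)\<close>, with \<open>\<kappa>\<close> invariant.  Expand \<open>A\<^sub>j\<close> in \<open>1, w, w\<^sup>2\<close> and
  normalise it to \<open>1 + u\<^sub>j w + r\<^sub>j w\<^sup>2\<close>: the group acts on the \<open>u\<^sub>j\<close> by the same linear formulas as on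
  the \<open>b\<^sub>j\<close>, so that \<open>[1 : u\<^sub>0 : u\<^sub>1 : u\<^sub>2 : u\<^sub>3]\<close> is an equivariant map to a projectivized representation.
  It is birational: the absence of a \<open>w\<^sup>2\<close> term in the product is the cyclic linear system
  \<open>r\<^sub>j + u\<^sub>j r\<^sub>j\<^sub>+\<^sub>1 + u\<^sub>j\<^sub>+\<^sub>1 = 0\<close>, which gives the \<open>r\<^sub>j\<close>; the other two terms give the \<open>b\<^sub>j\<close>; and dividing
  \<open>A\<^sub>0\<close> by its part that depends on the \<open>b\<^sub>j\<close> only leaves the coordinates of \<open>P\<^sup>2\<close>.
\<close>

subsection \<open>Functions on the cube roots of unity\<close>

text \<open>The two surface equations together say that
  \<open>(1 + w b0)(1 + w b2) = (1 + w^2 b1)(1 + w^2 b3)\<close> for each cube root of unity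
  \<open>w\<close>. This is the compatibility condition for a cycle of four unknowns with prescribed
  products of neighbours: \<open>(A0 A1)(A2 A3) = (A1 A2)(A3 A0)\<close>. Over a fixed point of the
  surface a solution is determined by \<open>A0\<close>, three values up to a scalar, whence the two
  extra dimensions. The arguments \<open>w\<close> and \<open>w^2\<close> alternate because sigma
  scales \<open>b0\<close>, \<open>b2\<close> by a root of unity and \<open>b1\<close>,
  \<open>b3\<close> by its square. The obstacle is equivariance: tau has to carry each
  \<open>A_j\<close> to the next one, so \<open>A0\<close> cannot be picked at will. A norm over the
  three cube roots is invariant, and its factors can be shared out between \<open>A0\<close> and
  \<open>A1\<close> so that only \<open>1 + w b0\<close> is left over; this is the origin of
  \<open>kappa\<close>. Solutions are then varied by the factor
  \<open>(1 - w^2 r2) / (1 - w r1)\<close>, up to a scalar, whose analogue in the neighbour is its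
  inverse.\<close>

definition norm_factor :: "'a::field \<Rightarrow> 'a \<Rightarrow> 'a \<Rightarrow> 'a" where
  "norm_factor t0 t1 w = (1 + w * t0 + w^2 * t1) * (4 + w * t0 + w^2 * t1)"

text \<open>\<open>A0\<close> receives the factor of the norm at \<open>w * z\<close> and its
  neighbour the one at \<open>w * z^2\<close>. The factor at \<open>w\<close> is assembled from the
  remaining factors of both, and \<open>1 + w * b0\<close> is left over.\<close>

definition base_sect :: "'a::field \<Rightarrow> 'a \<Rightarrow> 'a \<Rightarrow> 'a \<Rightarrow> 'a \<Rightarrow> 'a \<Rightarrow> 'a" where
  "base_sect z b0 b1 b2 b3 w =
     (1 + w * b0) * (2 + w * b2 + w^2 * b3) * norm_factor (b0 + b2) (b1 + b3) (w * z)"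

text \<open>
  This is \<open>A\<^sub>0\<close>, and \<open>A\<^sub>j\<close> is obtained by rotating the \<open>b\<^sub>i\<close> and, for odd \<open>j\<close>, swapping \<open>r1\<close> and \<open>r2\<close>.
  The \<open>1\<close> and \<open>4\<close> in \<open>norm_factor\<close> and the \<open>2\<close> in \<open>base_sect\<close> are chosen so that \<open>norm_factor\<close> splits on
  the surface and the product of two neighbours is, up to an invariant factor, \<open>1 + w b\<^sub>0\<close>.
\<close>

definition sect :: "'a::field \<Rightarrow> 'a \<Rightarrow> 'a \<Rightarrow> 'a \<Rightarrow> 'a \<Rightarrow> 'a \<Rightarrow> 'a \<Rightarrow> 'a \<Rightarrow> 'a" where
  "sect z b0 b1 b2 b3 r1 r2 w =
     base_sect z b0 b1 b2 b3 w * ((1 - w^2 * r2) * (1 + w * r1 + w^2 * r1^2))"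

definition kappa :: "'a::field \<Rightarrow> 'a \<Rightarrow> 'a \<Rightarrow> 'a \<Rightarrow> 'a \<Rightarrow> 'a" where
  "kappa z t0 t1 r1 r2 =
     norm_factor t0 t1 1 * norm_factor t0 t1 z * norm_factor t0 t1 (z^2) * ((1 - r1^3) * (1 - r2^3))"

text \<open>The coefficient of \<open>w\<^sup>m\<close> in a function of the cube roots of unity \<open>w = 1, z, z\<^sup>2\<close>.\<close>

definition coef :: "'a::field \<Rightarrow> nat \<Rightarrow> ('a \<Rightarrow> 'a) \<Rightarrow> 'a" where
  "coef z m h = (h 1 + z^(2*m) * h z + z^m * h (z^2)) / 3"

text \<open>Substituting once round the cyclic system of the overview leads back to
  \<open>r0\<close> with coefficient \<open>u0 * u1 * u2 * u3\<close>, which explains the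
  denominator.\<close>

definition solve_r :: "'a::field \<Rightarrow> 'a \<Rightarrow> 'a \<Rightarrow> 'a \<Rightarrow> 'a" where
  "solve_r u0 u1 u2 u3 =
     (- u1 + u0 * u2 - u0 * u1 * u3 + u0^2 * u1 * u2) / (1 - u0 * u1 * u2 * u3)"

lemma solve_r_eq:
  assumes "u0 * u1 * u2 * u3 \<noteq> (1::'a::field)"
  shows "solve_r u0 u1 u2 u3 + u0 * solve_r u1 u2 u3 u0 + u1 = 0"
proof -
  define d where "d = 1 - u0 * u1 * u2 * u3"
  define n0 where "n0 = - u1 + u0 * u2 - u0 * u1 * u3 + u0^2 * u1 * u2"
  define n1 where "n1 = - u2 + u1 * u3 - u1 * u2 * u0 + u1^2 * u2 * u3"
  have d: "d \<noteq> 0" using assms by (auto simp: d_def)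
  have "solve_r u0 u1 u2 u3 = n0 / d" "solve_r u1 u2 u3 u0 = n1 / d"
    unfolding solve_r_def n0_def n1_def d_def by (simp_all add: mult_ac)
  moreover have "n0 + u0 * n1 + u1 * d = 0"
    unfolding n0_def n1_def d_def by Groebner_Basis.algebra
  ultimately have "d * (solve_r u0 u1 u2 u3 + u0 * solve_r u1 u2 u3 u0 + u1) = 0"
    using d by (simp add: distrib_left mult.left_commute mult.commute[of d u1])
  then show ?thesis using d by simp
qed

lemma solve_r_unique:
  assumes "r0 + u0 * r1 + u1 = (0::'a::field)" "r1 + u1 * r2 + u2 = 0"
    "r2 + u2 * r3 + u3 = 0" "r3 + u3 * r0 + u0 = 0"
    and "u0 * u1 * u2 * u3 \<noteq> 1"
  shows "r0 = solve_r u0 u1 u2 u3"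
proof -
  have "r3 = - u3 * r0 - u0" "r2 = - u2 * r3 - u3" "r1 = - u1 * r2 - u2" "r0 = - u0 * r1 - u1"
    using assms by Groebner_Basis.algebra+
  then have "r0 * (1 - u0 * u1 * u2 * u3) = - u1 + u0 * u2 - u0 * u1 * u3 + u0^2 * u1 * u2"
    by Groebner_Basis.algebra
  moreover have "1 - u0 * u1 * u2 * u3 \<noteq> 0" using assms(5) by auto
  ultimately show ?thesis unfolding solve_r_def by (simp add: eq_divide_eq)
qed

locale cube_root =
  fixes z :: "'a::field_char_0"
  assumes z2: "z^2 + z + 1 = 0"
begin

lemma z3: "z^3 = 1"
  using z2 by Groebner_Basis.algebra

lemma z_powers: "z^4 = z" "(z^2)^2 = z" "z * z^2 = 1" "z^2 * z = 1" "(z^2)^3 = 1" "z^6 = 1"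
proof -
  show 4: "z^4 = z" using z3 by (simp add: eval_nat_numeral)
  then show "(z^2)^2 = z" by (simp flip: power_mult)
  show "z * z^2 = 1" "z^2 * z = 1" using z3 by (simp_all add: eval_nat_numeral mult_ac)
  show 6: "z^6 = 1" using z3 power_mult[of z 3 2] by simp
  then show "(z^2)^3 = 1" by (simp flip: power_mult)
qed

lemma cube_root_cases:
  assumes "w^3 = 1" obtains "w = 1" | "w = z" | "w = z^2"
proof -
  have "w^3 - 1 = 0" using assms by simp
  with z2 have "(w - 1) * ((w - z) * (w - z^2)) = 0" by Groebner_Basis.algebra
  then show ?thesis using that by auto
qed

lemma z_neq: "z \<noteq> 1" "z^2 \<noteq> 1" "z^2 \<noteq> z" "z \<noteq> 0"
proof -
  have three: "(3::'a) \<noteq> 0" by simp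
  show "z \<noteq> 1" using z2 three by auto
  then show "z^2 \<noteq> 1" using z_powers(2) by force
  show "z \<noteq> 0" using z3 by auto
  then show "z^2 \<noteq> z" using \<open>z \<noteq> 1\<close> by (simp add: power2_eq_square)
qed

text \<open>A Vandermonde system, invertible because 3 is. Identities that hold at every cube root
  of unity may thus be compared coefficient by coefficient.\<close>

lemma coefs_unique:
  fixes a0 a1 a2 b0 b1 b2 :: 'a
  assumes "\<And>w. w^3 = 1 \<Longrightarrow> a0 + w * a1 + w^2 * a2 = b0 + w * b1 + w^2 * b2"
  shows "a0 = b0" "a1 = b1" "a2 = b2"
proof -
  have three: "(3::'a) \<noteq> 0" by simp
  have e: "a0 + a1 + a2 = b0 + b1 + b2" "a0 + z * a1 + z^2 * a2 = b0 + z * b1 + z^2 * b2"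
    "a0 + z^2 * a1 + z * a2 = b0 + z^2 * b1 + z * b2"
    using assms[of 1] assms[of z] assms[of "z^2"] by (simp_all add: z3 z_powers)
  have "3 * (a0 - b0) = 0" "3 * (a1 - b1) = 0" "3 * (a2 - b2) = 0"
    using e z2 by Groebner_Basis.algebra+
  then show "a0 = b0" "a1 = b1" "a2 = b2" using three by auto
qed

text \<open>Fourier inversion on the group of cube roots of unity.\<close>

lemma coef_expand:
  assumes "w^3 = 1"
  shows "h w = coef z 0 h + w * coef z 1 h + w^2 * coef z 2 h"
proof -
  have "3 * h w = (h 1 + h z + h (z^2)) + w * (h 1 + z^2 * h z + z * h (z^2)) +
    w^2 * (h 1 + z^4 * h z + z^2 * h (z^2))"
    using assms
  proof (cases rule: cube_root_cases)
    case 1 show ?thesis unfolding 1 using z2 z_powers(1) by simp Groebner_Basis.algebra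
  next
    case 2 show ?thesis unfolding 2 using z2 by Groebner_Basis.algebra
  next
    case 3 show ?thesis unfolding 3 using z2 by Groebner_Basis.algebra
  qed
  also have "\<dots> = 3 * (coef z 0 h + w * coef z 1 h + w^2 * coef z 2 h)"
    unfolding coef_def by (simp add: distrib_left add_divide_distrib)
  finally show ?thesis by (simp only: mult_cancel_left) simp
qed

lemma coef_eqI:
  assumes "\<And>w. w^3 = 1 \<Longrightarrow> h w = a0 + w * a1 + w^2 * a2"
  shows "coef z 0 h = a0" "coef z 1 h = a1" "coef z 2 h = a2"
proof -
  have "\<And>w::'a. w^3 = 1 \<Longrightarrow>
      coef z 0 h + w * coef z 1 h + w^2 * coef z 2 h = a0 + w * a1 + w^2 * a2"
    using assms coef_expand[where h = h] by force
  from coefs_unique[OF this] show "coef z 0 h = a0" "coef z 1 h = a1" "coef z 2 h = a2" by auto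
qed

lemma coef_cong:
  assumes "\<And>w. w^3 = 1 \<Longrightarrow> h w = h' w"
  shows "coef z m h = coef z m h'"
  unfolding coef_def using assms[of 1] assms[of z] assms[of "z^2"] by (simp add: z3 z_powers)

text \<open>Multiplication by \<open>w\<close> permutes the three cube roots, so the norm does not
  depend on the starting point.\<close>

lemma norm_factor_prod:
  assumes "w^3 = 1"
  shows "norm_factor t0 t1 w * (norm_factor t0 t1 (w * z) * norm_factor t0 t1 (w * z^2)) =
    norm_factor t0 t1 1 * norm_factor t0 t1 z * norm_factor t0 t1 (z^2)"
  using assms
proof (cases rule: cube_root_cases)
  case 2
  have "z * z = z^2" "z * z^2 = 1" using z_powers by (simp_all add: power2_eq_square)
  then show ?thesis unfolding 2 by (simp add: mult_ac)
next
  case 3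
  have "z^2 * z = 1" "z^2 * z^2 = z" using z2 by Groebner_Basis.algebra+
  then show ?thesis unfolding 3 by (simp add: mult_ac)
qed simp

text \<open>\<open>w^2 * z\<close> and \<open>w * z^2\<close> are inverse to each other, and
  inverting a cube root exchanges its first and second power.\<close>

lemma norm_factor_swap:
  assumes "w^3 = 1"
  shows "norm_factor t1 t0 (w^2 * z) = norm_factor t0 t1 (w * z^2)"
proof -
  have w: "w^3 - 1 = 0" using assms by simp
  have "w^2 * z * t1 = (w * z^2)^2 * t1" "(w^2 * z)^2 * t0 = w * z^2 * t0"
    using w z2 by Groebner_Basis.algebra+
  then show ?thesis unfolding norm_factor_def by (simp only: add_ac)
qed

text \<open>On the surface the first factor of \<open>norm_factor\<close> is
  \<open>(1 + w^2 * b1) * (1 + w^2 * b3)\<close>. Let \<open>c = w^2 * b3\<close>,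
  \<open>t0 = b0 + b2\<close>, \<open>t1 = b1 + b3\<close>, and write \<open>m\<close>,
  \<open>l\<close> for the constants 4 and 2. What remains is \<open>(1 + c) * (m + w * t0 + w^2 *
  t1) = (l + c + w * b2) * (l + c + w * b0)\<close>. Comparing the terms in \<open>1\<close>,
  \<open>c\<close> and \<open>w * t0\<close> gives \<open>m = l^2\<close>, \<open>m = 2 * l\<close>
  and \<open>2 = l\<close>.\<close>

lemma norm_factor_split:
  assumes "w^3 = 1" "b0 * b2 = b1 + b3" "b1 * b3 = b0 + b2"
  shows "norm_factor (b0 + b2) (b1 + b3) w =
    (1 + w^2 * b1) * (2 + w * b2 + w^2 * b3) * (2 + w^2 * b3 + w * b0)"
  unfolding norm_factor_def using assms by Groebner_Basis.algebra

lemma base_sect_mult: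
  assumes "w^3 = 1" "b0 * b2 = b1 + b3" "b1 * b3 = b0 + b2"
  shows "base_sect z b0 b1 b2 b3 w * base_sect z b1 b2 b3 b0 (w^2) =
    norm_factor (b0 + b2) (b1 + b3) 1 * norm_factor (b0 + b2) (b1 + b3) z *
    norm_factor (b0 + b2) (b1 + b3) (z^2) * (1 + w * b0)"
proof -
  have w: "w^3 - 1 = 0" using assms(1) by simp
  have w4: "(w^2)^2 = w" using w by Groebner_Basis.algebra
  have "base_sect z b0 b1 b2 b3 w * base_sect z b1 b2 b3 b0 (w^2) =
    (1 + w * b0) * (((1 + w^2 * b1) * (2 + w * b2 + w^2 * b3) * (2 + w^2 * b3 + w * b0)) *
     (norm_factor (b0 + b2) (b1 + b3) (w * z) * norm_factor (b1 + b3) (b0 + b2) (w^2 * z)))"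
    unfolding base_sect_def w4 by (simp only: mult_ac add.commute[of b2 b0])
  also have "\<dots> = (1 + w * b0) * (norm_factor (b0 + b2) (b1 + b3) w *
     (norm_factor (b0 + b2) (b1 + b3) (w * z) * norm_factor (b0 + b2) (b1 + b3) (w * z^2)))"
    using assms by (simp only: norm_factor_split norm_factor_swap)
  finally show ?thesis using assms(1) by (simp only: norm_factor_prod) (simp only: mult_ac)
qed

lemma sect_mult:
  assumes "w^3 = 1" "b0 * b2 = b1 + b3" "b1 * b3 = b0 + b2"
  shows "sect z b0 b1 b2 b3 r1 r2 w * sect z b1 b2 b3 b0 r2 r1 (w^2) =
    kappa z (b0 + b2) (b1 + b3) r1 r2 * (1 + w * b0)"
proof -
  have w: "w^3 - 1 = 0" using assms(1) by simp
  have w4: "(w^2)^2 = w" using w by Groebner_Basis.algebra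
  \<comment> \<open>Each quadratic factor is a geometric sum, and the linear factor that completes
    it to a difference of cubes sits in the neighbouring section.\<close>
  have 1: "(1 - w * r1) * (1 + w * r1 + w^2 * r1^2) = 1 - r1^3"
     "(1 - w^2 * r2) * (1 + w^2 * r2 + w * r2^2) = 1 - r2^3"
    using w by Groebner_Basis.algebra+
  have "sect z b0 b1 b2 b3 r1 r2 w * sect z b1 b2 b3 b0 r2 r1 (w^2) =
    (base_sect z b0 b1 b2 b3 w * base_sect z b1 b2 b3 b0 (w^2)) *
    (((1 - w * r1) * (1 + w * r1 + w^2 * r1^2)) * ((1 - w^2 * r2) * (1 + w^2 * r2 + w * r2^2)))"
    unfolding sect_def w4 by (simp only: mult_ac)
  then show ?thesis unfolding base_sect_mult[OF assms] 1 kappa_def by (simp only: mult_ac)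
qed

text \<open>Tau exchanges \<open>t0\<close> with \<open>t1\<close> and \<open>r1\<close> with
  \<open>r2\<close>. Together with \<open>kappa_rotate\<close> this is the invariance of
  \<open>kappa\<close> under the group.\<close>

lemma kappa_swap: "kappa z t1 t0 r2 r1 = kappa z t0 t1 r1 r2"
proof -
  have "norm_factor t1 t0 1 = norm_factor t0 t1 1"
    "norm_factor t1 t0 z = norm_factor t0 t1 (z^2)"
    "norm_factor t1 t0 (z^2) = norm_factor t0 t1 z"
    unfolding norm_factor_def by (simp_all add: z_powers add_ac)
  then show ?thesis unfolding kappa_def by (simp only: mult_ac)
qed

lemma kappa_rotate: "kappa z (z * t0) (z^2 * t1) (z * r1) (z^2 * r2) = kappa z t0 t1 r1 r2"
proof -
  have 1: "norm_factor (z * t0) (z^2 * t1) 1 = norm_factor t0 t1 z"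
    "norm_factor (z * t0) (z^2 * t1) z = norm_factor t0 t1 (z^2)"
    "norm_factor (z * t0) (z^2 * t1) (z^2) = norm_factor t0 t1 1"
    unfolding norm_factor_def using z2
    by (simp_all only: mult_1_left power_one) Groebner_Basis.algebra+
  have 2: "(z * r1)^3 = r1^3" "(z^2 * r2)^3 = r2^3"
    by (simp_all add: power_mult_distrib z3 z_powers)
  show ?thesis unfolding kappa_def 1 2 by (simp only: mult_ac)
qed

text \<open>On the surface \<open>1 + w * b0\<close> divides \<open>norm_factor\<close> at
  \<open>w\<close>, hence the norm inside \<open>kappa\<close>. The claim on
  \<open>base_sect\<close> then follows from its product with the neighbour.\<close>

lemma base_factors_nonzero:
  assumes "kappa z (b0 + b2) (b1 + b3) r1 r2 \<noteq> 0" "w^3 = 1" "b0 * b2 = b1 + b3" "b1 * b3 = b0 + b2"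
  shows "1 + w * b0 \<noteq> 0" "base_sect z b0 b1 b2 b3 w \<noteq> 0" "r1^3 \<noteq> 1" "r2^3 \<noteq> 1"
proof -
  have N: "norm_factor (b0 + b2) (b1 + b3) 1 * norm_factor (b0 + b2) (b1 + b3) z *
      norm_factor (b0 + b2) (b1 + b3) (z^2) \<noteq> 0"
    and r: "r1^3 \<noteq> 1" "r2^3 \<noteq> 1"
    using assms(1) unfolding kappa_def by auto
  show "r1^3 \<noteq> 1" "r2^3 \<noteq> 1" by fact+
  have "1 + w * (b0 + b2) + w^2 * (b1 + b3) = (1 + w * b0) * (1 + w * b2)"
    using assms(2-4) by Groebner_Basis.algebra
  moreover have "norm_factor (b0 + b2) (b1 + b3) w \<noteq> 0"
    using N norm_factor_prod[OF assms(2), of "b0 + b2" "b1 + b3"] by auto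
  ultimately show "1 + w * b0 \<noteq> 0" unfolding norm_factor_def by auto
  then show "base_sect z b0 b1 b2 b3 w \<noteq> 0"
    using N base_sect_mult[OF assms(2-4)] by auto
qed

text \<open>This is \<open>u0\<close> of the overview. The other \<open>u_j\<close> arise by
  rotating the \<open>b_i\<close> and, for odd \<open>j\<close>, swapping \<open>r1\<close> and
  \<open>r2\<close>.\<close>

definition fib_coord :: "'a \<Rightarrow> 'a \<Rightarrow> 'a \<Rightarrow> 'a \<Rightarrow> 'a \<Rightarrow> 'a \<Rightarrow> 'a" where
  "fib_coord b0 b1 b2 b3 r1 r2 =
     coef z 1 (sect z b0 b1 b2 b3 r1 r2) / coef z 0 (sect z b0 b1 b2 b3 r1 r2)"

text \<open>Comparison of coefficients in \<open>sect_mult\<close>, the second section being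
  expanded in powers of \<open>w^2\<close>. The right-hand side has no \<open>w^2\<close> term; this
  is the third relation, from which the cyclic linear system comes.\<close>

lemma sect_coef_relations:
  fixes b0 b1 b2 b3 r1 r2
  defines "a \<equiv> \<lambda>m. coef z m (sect z b0 b1 b2 b3 r1 r2)"
    and "a' \<equiv> \<lambda>m. coef z m (sect z b1 b2 b3 b0 r2 r1)"
    and "k \<equiv> kappa z (b0 + b2) (b1 + b3) r1 r2"
  assumes "b0 * b2 = b1 + b3" "b1 * b3 = b0 + b2"
  shows "a 0 * a' 0 + a 1 * a' 1 + a 2 * a' 2 = k"
    "a 1 * a' 0 + a 2 * a' 1 + a 0 * a' 2 = k * b0"
    "a 2 * a' 0 + a 0 * a' 1 + a 1 * a' 2 = 0"
proof -
  have "(a 0 * a' 0 + a 1 * a' 1 + a 2 * a' 2) + w * (a 1 * a' 0 + a 2 * a' 1 + a 0 * a' 2) +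
      w^2 * (a 2 * a' 0 + a 0 * a' 1 + a 1 * a' 2) = k + w * (k * b0) + w^2 * 0"
    if w: "w^3 = 1" for w
  proof -
    have w2: "(w^2)^3 = 1" using w by Groebner_Basis.algebra
    have "sect z b0 b1 b2 b3 r1 r2 w = a 0 + w * a 1 + w^2 * a 2"
      unfolding a_def using coef_expand[OF w] .
    moreover have "sect z b1 b2 b3 b0 r2 r1 (w^2) = a' 0 + w^2 * a' 1 + (w^2)^2 * a' 2"
      unfolding a'_def using coef_expand[OF w2] .
    ultimately show ?thesis
      using sect_mult[OF w assms(4,5), of r1 r2] w unfolding k_def[symmetric]
      by Groebner_Basis.algebra
  qed
  from coefs_unique[OF this] show "a 0 * a' 0 + a 1 * a' 1 + a 2 * a' 2 = k"
    "a 1 * a' 0 + a 2 * a' 1 + a 0 * a' 2 = k * b0"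
    "a 2 * a' 0 + a 0 * a' 1 + a 1 * a' 2 = 0" by auto
qed

text \<open>The constant term of the product of two normalised neighbours, which replaces
  \<open>kappa\<close> after normalisation. The numerator of \<open>surf_coord\<close> is the
  coefficient of \<open>w\<close> in the same product.\<close>

definition pair_norm :: "'a \<Rightarrow> 'a \<Rightarrow> 'a \<Rightarrow> 'a \<Rightarrow> 'a" where
  "pair_norm u0 u1 u2 u3 = 1 + u0 * u1 + solve_r u0 u1 u2 u3 * solve_r u1 u2 u3 u0"

definition surf_coord :: "'a \<Rightarrow> 'a \<Rightarrow> 'a \<Rightarrow> 'a \<Rightarrow> 'a" where
  "surf_coord u0 u1 u2 u3 =
     (u0 + solve_r u0 u1 u2 u3 * u1 + solve_r u1 u2 u3 u0) / pair_norm u0 u1 u2 u3"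

text \<open>The third relation of \<open>sect_coef_relations\<close>, divided by the two leading
  coefficients, is one equation of the cyclic system. Rotation supplies the other three, and the
  solution is unique.\<close>

lemma fib_coord_solve_r:
  fixes b0 b1 b2 b3 r1 r2
  defines "u0 \<equiv> fib_coord b0 b1 b2 b3 r1 r2" and "u1 \<equiv> fib_coord b1 b2 b3 b0 r2 r1"
    and "u2 \<equiv> fib_coord b2 b3 b0 b1 r1 r2" and "u3 \<equiv> fib_coord b3 b0 b1 b2 r2 r1"
  assumes rel: "b0 * b2 = b1 + b3" "b1 * b3 = b0 + b2"
    and nz: "coef z 0 (sect z b0 b1 b2 b3 r1 r2) \<noteq> 0" "coef z 0 (sect z b1 b2 b3 b0 r2 r1) \<noteq> 0"
      "coef z 0 (sect z b2 b3 b0 b1 r1 r2) \<noteq> 0" "coef z 0 (sect z b3 b0 b1 b2 r2 r1) \<noteq> 0"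
    and D: "u0 * u1 * u2 * u3 \<noteq> 1"
  shows "coef z 2 (sect z b0 b1 b2 b3 r1 r2) =
    solve_r u0 u1 u2 u3 * coef z 0 (sect z b0 b1 b2 b3 r1 r2)"
proof -
  have rel': "b1 * b3 = b2 + b0" "b2 * b0 = b1 + b3" "b2 * b0 = b3 + b1" "b3 * b1 = b2 + b0"
    "b3 * b1 = b0 + b2" "b0 * b2 = b3 + b1" using rel by (simp_all add: ac_simps)
  let ?q = "\<lambda>b0 b1 b2 b3 r1 r2. coef z 2 (sect z b0 b1 b2 b3 r1 r2) / coef z 0 (sect z b0 b1 b2 b3 r1 r2)"
  have step: "?q b0 b1 b2 b3 r1 r2 + fib_coord b0 b1 b2 b3 r1 r2 * ?q b1 b2 b3 b0 r2 r1 +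
      fib_coord b1 b2 b3 b0 r2 r1 = 0"
    if "b0 * b2 = b1 + b3" "b1 * b3 = b0 + b2"
      "coef z 0 (sect z b0 b1 b2 b3 r1 r2) \<noteq> 0" "coef z 0 (sect z b1 b2 b3 b0 r2 r1) \<noteq> 0"
    for b0 b1 b2 b3 r1 r2
    using sect_coef_relations(3)[OF that(1,2), of r1 r2] that(3,4) unfolding fib_coord_def
    by (simp add: field_simps)
  have "?q b0 b1 b2 b3 r1 r2 = solve_r u0 u1 u2 u3"
    unfolding u0_def u1_def u2_def u3_def
    by (rule solve_r_unique[OF step step step step D[unfolded u0_def u1_def u2_def u3_def]])
      (use rel rel' nz in auto)
  then show ?thesis using nz(1) by (simp add: field_simps)
qed

text \<open>The first two relations of \<open>sect_coef_relations\<close>, divided by the product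
  \<open>c\<close> of the leading coefficients, have right-hand sides in ratio \<open>b0\<close>,
  since \<open>kappa\<close> cancels.\<close>

lemma surf_coord_fib_coord:
  fixes b0 b1 b2 b3 r1 r2
  defines "u0 \<equiv> fib_coord b0 b1 b2 b3 r1 r2" and "u1 \<equiv> fib_coord b1 b2 b3 b0 r2 r1"
    and "u2 \<equiv> fib_coord b2 b3 b0 b1 r1 r2" and "u3 \<equiv> fib_coord b3 b0 b1 b2 r2 r1"
  assumes rel: "b0 * b2 = b1 + b3" "b1 * b3 = b0 + b2"
    and nz: "coef z 0 (sect z b0 b1 b2 b3 r1 r2) \<noteq> 0" "coef z 0 (sect z b1 b2 b3 b0 r2 r1) \<noteq> 0"
      "coef z 0 (sect z b2 b3 b0 b1 r1 r2) \<noteq> 0" "coef z 0 (sect z b3 b0 b1 b2 r2 r1) \<noteq> 0"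
    and D: "u0 * u1 * u2 * u3 \<noteq> 1"
    and k: "kappa z (b0 + b2) (b1 + b3) r1 r2 \<noteq> 0"
  shows "pair_norm u0 u1 u2 u3 \<noteq> 0" "surf_coord u0 u1 u2 u3 = b0"
proof -
  define a where "a = (\<lambda>m. coef z m (sect z b0 b1 b2 b3 r1 r2))"
  define a' where "a' = (\<lambda>m. coef z m (sect z b1 b2 b3 b0 r2 r1))"
  define c where "c = a 0 * a' 0"
  have D': "u1 * u2 * u3 * u0 \<noteq> 1" using D by (simp add: mult_ac)
  have rel': "b1 * b3 = b2 + b0" "b2 * b0 = b1 + b3" using rel by (simp_all add: ac_simps)
  have c: "c \<noteq> 0" using nz by (simp add: c_def a_def a'_def)
  have e: "a 1 = u0 * a 0" "a' 1 = u1 * a' 0"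
    "a 2 = solve_r u0 u1 u2 u3 * a 0" "a' 2 = solve_r u1 u2 u3 u0 * a' 0"
    using nz fib_coord_solve_r[OF rel nz] D fib_coord_solve_r[OF rel' nz(2,3,4,1)] D'
    unfolding a_def a'_def u0_def u1_def u2_def u3_def by (simp_all add: fib_coord_def)
  have 1: "c * pair_norm u0 u1 u2 u3 = kappa z (b0 + b2) (b1 + b3) r1 r2"
    using sect_coef_relations(1)[OF rel, of r1 r2]
    unfolding a_def[THEN fun_cong, symmetric] a'_def[THEN fun_cong, symmetric] e
    unfolding c_def pair_norm_def by (simp add: algebra_simps)
  have 2: "c * (u0 + solve_r u0 u1 u2 u3 * u1 + solve_r u1 u2 u3 u0) =
      kappa z (b0 + b2) (b1 + b3) r1 r2 * b0"
    using sect_coef_relations(2)[OF rel, of r1 r2]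
    unfolding a_def[THEN fun_cong, symmetric] a'_def[THEN fun_cong, symmetric] e
    unfolding c_def by (simp add: algebra_simps)
  show 3: "pair_norm u0 u1 u2 u3 \<noteq> 0" using 1 k by auto
  from 1 2 have "c * (u0 + solve_r u0 u1 u2 u3 * u1 + solve_r u1 u2 u3 u0) =
      c * (pair_norm u0 u1 u2 u3 * b0)" by (simp add: mult_ac)
  with c have "u0 + solve_r u0 u1 u2 u3 * u1 + solve_r u1 u2 u3 u0 = pair_norm u0 u1 u2 u3 * b0"
    by simp
  with 3 show "surf_coord u0 u1 u2 u3 = b0" unfolding surf_coord_def by simp
qed

definition fib_quot :: "'a \<Rightarrow> 'a \<Rightarrow> 'a \<Rightarrow> 'a \<Rightarrow> 'a \<Rightarrow> 'a \<Rightarrow> 'a \<Rightarrow> 'a" where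
  "fib_quot b0 b1 b2 b3 u r w = (1 + w * u + w^2 * r) / base_sect z b0 b1 b2 b3 w"

definition rho1 :: "('a \<Rightarrow> 'a) \<Rightarrow> 'a" where
  "rho1 y = coef z 1 y / coef z 0 y"

definition rho2 :: "('a \<Rightarrow> 'a) \<Rightarrow> 'a" where
  "rho2 y = ((coef z 1 y)^2 - coef z 0 y * coef z 2 y) / ((coef z 0 y)^2 - coef z 1 y * coef z 2 y)"

text \<open>Up to \<open>c\<close>, the coefficients of \<open>y\<close> are
  \<open>1 - r1 * r2\<close>, \<open>r1 * (1 - r1 * r2)\<close> and \<open>r1^2 - r2\<close>. So
  \<open>r1\<close> is a quotient of the first two, and the two quadratic expressions in
  \<open>rho2\<close> share the factor \<open>c * d * (1 - r1^3)\<close>.\<close>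

lemma rho_fib_quot:
  assumes y: "\<And>w. w^3 = 1 \<Longrightarrow> y w = c * ((1 - w^2 * r2) * (1 + w * r1 + w^2 * r1^2))"
    and "c \<noteq> 0" "r1 * r2 \<noteq> 1" "r1^3 \<noteq> 1"
  shows "coef z 0 y \<noteq> 0" "(coef z 0 y)^2 - coef z 1 y * coef z 2 y \<noteq> 0" "rho1 y = r1" "rho2 y = r2"
proof -
  define d where "d = c * (1 - r1 * r2)"
  have d: "d \<noteq> 0" using assms by (simp add: d_def)
  have "y w = d + w * (r1 * d) + w^2 * (c * (r1^2 - r2))" if w: "w^3 = 1" for w
    unfolding y[OF w] d_def using w by Groebner_Basis.algebra
  from coef_eqI[OF this]
  have e: "coef z 0 y = d" "coef z 1 y = r1 * d" "coef z 2 y = c * (r1^2 - r2)" by auto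
  show "coef z 0 y \<noteq> 0" "rho1 y = r1" unfolding rho1_def e using d by simp_all
  have 1: "(coef z 0 y)^2 - coef z 1 y * coef z 2 y = c * d * (1 - r1^3)"
    unfolding e d_def by Groebner_Basis.algebra
  show 2: "(coef z 0 y)^2 - coef z 1 y * coef z 2 y \<noteq> 0"
    unfolding 1 using assms d by simp
  have "(coef z 1 y)^2 - coef z 0 y * coef z 2 y = c * d * (1 - r1^3) * r2"
    unfolding e d_def by Groebner_Basis.algebra
  then show "rho2 y = r2" using 2 unfolding rho2_def 1 by simp
qed

text \<open>Multiplying \<open>y\<close> by \<open>1 - w * rho1 y\<close> kills the term in
  \<open>w\<close> and leaves \<open>m * (1 - w^2 * rho2 y)\<close>. The geometric sum in
  \<open>w * rho1 y\<close> turns the multiplier into the constant \<open>1 - (rho1 y)^3\<close>.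
  Hence every generic \<open>y\<close> has the shape of a fibre factor up to a scalar.\<close>

lemma fib_quot_sect:
  assumes "coef z 0 y \<noteq> 0" "(coef z 0 y)^2 - coef z 1 y * coef z 2 y \<noteq> 0" "(rho1 y)^3 \<noteq> 1"
  obtains c where "c \<noteq> 0"
    "\<And>w. w^3 = 1 \<Longrightarrow> (1 - w^2 * rho2 y) * (1 + w * rho1 y + w^2 * (rho1 y)^2) = c * y w"
proof -
  define y0 y1 y2 where "y0 = coef z 0 y" and "y1 = coef z 1 y" and "y2 = coef z 2 y"
  define m where "m = y0 - y2 * rho1 y"
  have r1: "y1 = y0 * rho1 y" using assms(1) by (simp add: rho1_def y0_def y1_def)
  have m: "y0 * m = y0^2 - y1 * y2" unfolding m_def r1 by Groebner_Basis.algebra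
  then have m0: "m \<noteq> 0" using assms(2) by (auto simp: y0_def y1_def y2_def)
  have y0: "y0 \<noteq> 0" using assms(1) by (simp add: y0_def)
  have "rho2 y * (y0 * m) = y1^2 - y0 * y2"
    unfolding m using assms(2) by (simp add: rho2_def y0_def y1_def y2_def)
  then have "y0 * (m * rho2 y) = y0 * (y1 * rho1 y - y2)"
    using r1 by Groebner_Basis.algebra
  then have r2: "m * rho2 y = y1 * rho1 y - y2" using y0 by simp
  have "(1 - w^2 * rho2 y) * (1 + w * rho1 y + w^2 * (rho1 y)^2) = (1 - (rho1 y)^3) / m * y w"
    if w: "w^3 = 1" for w
  proof -
    have yw: "y w = y0 + w * y1 + w^2 * y2"
      unfolding y0_def y1_def y2_def by (rule coef_expand[OF w])
    have "m * ((1 - w^2 * rho2 y) * (1 + w * rho1 y + w^2 * (rho1 y)^2)) = (1 - (rho1 y)^3) * y w"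
      using r1 r2 w unfolding yw m_def by Groebner_Basis.algebra
    then show ?thesis using m0 by (simp add: field_simps)
  qed
  moreover have "(1 - (rho1 y)^3) / m \<noteq> 0" using m0 assms(3) by simp
  ultimately show thesis using that by blast
qed

text \<open>The coefficient of \<open>w^2\<close> on the left is the expression that
  \<open>solve_r_eq\<close> shows to vanish.\<close>

lemma pair_product:
  assumes w: "w^3 = 1" and D: "u0 * u1 * u2 * u3 \<noteq> 1" and N: "pair_norm u0 u1 u2 u3 \<noteq> 0"
  shows "(1 + w * u0 + w^2 * solve_r u0 u1 u2 u3) * (1 + w^2 * u1 + w * solve_r u1 u2 u3 u0) =
    pair_norm u0 u1 u2 u3 * (1 + w * surf_coord u0 u1 u2 u3)"
proof -
  have "pair_norm u0 u1 u2 u3 * surf_coord u0 u1 u2 u3 =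
      u0 + solve_r u0 u1 u2 u3 * u1 + solve_r u1 u2 u3 u0"
    using N by (simp add: surf_coord_def)
  then show ?thesis using w solve_r_eq[OF D] pair_norm_def[of u0 u1 u2 u3]
    by Groebner_Basis.algebra
qed

text \<open>The product of all four normalised factors is computed in two pairings,
  \<open>(A0 A1)(A2 A3)\<close> and \<open>(A1 A2)(A3 A0)\<close>. The constant terms give
  \<open>n0 * n2 = n1 * n3\<close>; after cancelling it, the other two coefficients are the surface
  equations.\<close>

lemma surf_coord_relation:
  fixes u0 u1 u2 u3
  assumes D: "u0 * u1 * u2 * u3 \<noteq> 1"
    and N: "pair_norm u0 u1 u2 u3 \<noteq> 0" "pair_norm u1 u2 u3 u0 \<noteq> 0"
      "pair_norm u2 u3 u0 u1 \<noteq> 0" "pair_norm u3 u0 u1 u2 \<noteq> 0"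
  defines "b0 \<equiv> surf_coord u0 u1 u2 u3" and "b1 \<equiv> surf_coord u1 u2 u3 u0"
    and "b2 \<equiv> surf_coord u2 u3 u0 u1" and "b3 \<equiv> surf_coord u3 u0 u1 u2"
  shows "b0 * b2 = b1 + b3" "b1 * b3 = b0 + b2"
proof -
  define n0 n1 n2 n3 where "n0 = pair_norm u0 u1 u2 u3" and "n1 = pair_norm u1 u2 u3 u0"
    and "n2 = pair_norm u2 u3 u0 u1" and "n3 = pair_norm u3 u0 u1 u2"
  have D': "u1 * u2 * u3 * u0 \<noteq> 1" "u2 * u3 * u0 * u1 \<noteq> 1" "u3 * u0 * u1 * u2 \<noteq> 1"
    using D by (simp_all add: mult_ac)
  have "(n0 * n2) + w * (n0 * n2 * (b0 + b2)) + w^2 * (n0 * n2 * (b0 * b2)) =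
      (n1 * n3) + w * (n1 * n3 * (b1 * b3)) + w^2 * (n1 * n3 * (b1 + b3))"
    if w: "w^3 = 1" for w
  proof -
    define A0 where "A0 = 1 + w * u0 + w^2 * solve_r u0 u1 u2 u3"
    define A1 where "A1 = 1 + w^2 * u1 + w * solve_r u1 u2 u3 u0"
    define A2 where "A2 = 1 + w * u2 + w^2 * solve_r u2 u3 u0 u1"
    define A3 where "A3 = 1 + w^2 * u3 + w * solve_r u3 u0 u1 u2"
    have w2: "(w^2)^3 = 1" and w4: "(w^2)^2 = w" using w by Groebner_Basis.algebra+
    have "A0 * A1 = n0 * (1 + w * b0)" "A1 * A2 = n1 * (1 + w^2 * b1)"
      "A2 * A3 = n2 * (1 + w * b2)" "A3 * A0 = n3 * (1 + w^2 * b3)"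
      using pair_product[OF w D N(1)] pair_product[OF w2 D'(1) N(2)]
        pair_product[OF w D'(2) N(3)] pair_product[OF w2 D'(3) N(4)]
      unfolding w4 A0_def A1_def A2_def A3_def n0_def n1_def n2_def n3_def b0_def b1_def b2_def b3_def
      by auto
    then have "(n0 * (1 + w * b0)) * (n2 * (1 + w * b2)) = (n1 * (1 + w^2 * b1)) * (n3 * (1 + w^2 * b3))"
      by (metis mult.assoc mult.commute)
    then show ?thesis using w by Groebner_Basis.algebra
  qed
  from coefs_unique[OF this]
  have "n0 * n2 = n1 * n3" "n0 * n2 * (b0 + b2) = n1 * n3 * (b1 * b3)"
    "n0 * n2 * (b0 * b2) = n1 * n3 * (b1 + b3)" by auto
  moreover have "n1 * n3 \<noteq> 0" using N by (simp add: n1_def n3_def)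
  ultimately show "b0 * b2 = b1 + b3" "b1 * b3 = b0 + b2" by auto
qed

lemma fib_coord_eqI:
  assumes "\<And>w. w^3 = 1 \<Longrightarrow> sect z b0 b1 b2 b3 r1 r2 w = c * (1 + w * u + w^2 * r)" "c \<noteq> 0"
  shows "coef z 0 (sect z b0 b1 b2 b3 r1 r2) \<noteq> 0" "fib_coord b0 b1 b2 b3 r1 r2 = u"
proof -
  have "sect z b0 b1 b2 b3 r1 r2 w = c + w * (c * u) + w^2 * (c * r)" if "w^3 = 1" for w
    unfolding assms(1)[OF that] by (simp add: algebra_simps)
  from coef_eqI[OF this] assms(2)
  show "coef z 0 (sect z b0 b1 b2 b3 r1 r2) \<noteq> 0" "fib_coord b0 b1 b2 b3 r1 r2 = u"
    unfolding fib_coord_def by auto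
qed

text \<open>The product with the neighbour is, up to a nonzero constant, the same for the section
  and for the normalised factor. Proportionality to normalised factors therefore passes along the
  cycle.\<close>

lemma sect_proportional_step:
  assumes D: "u0 * u1 * u2 * u3 \<noteq> 1" and N: "pair_norm u0 u1 u2 u3 \<noteq> 0"
    and rel: "b0 * b2 = b1 + b3" "b1 * b3 = b0 + b2" and b0: "b0 = surf_coord u0 u1 u2 u3"
    and k: "kappa z (b0 + b2) (b1 + b3) r1 r2 \<noteq> 0"
    and A: "\<And>w. w^3 = 1 \<Longrightarrow>
      sect z b0 b1 b2 b3 r1 r2 w = c * (1 + w * u0 + w^2 * solve_r u0 u1 u2 u3)" "c \<noteq> 0"
  obtains c' where "c' \<noteq> 0" "\<And>w. w^3 = 1 \<Longrightarrow>
      sect z b1 b2 b3 b0 r2 r1 w = c' * (1 + w * u1 + w^2 * solve_r u1 u2 u3 u0)"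
proof -
  let ?k = "kappa z (b0 + b2) (b1 + b3) r1 r2" and ?n = "pair_norm u0 u1 u2 u3"
  have "sect z b1 b2 b3 b0 r2 r1 w = ?k / (c * ?n) * (1 + w * u1 + w^2 * solve_r u1 u2 u3 u0)"
    if w: "w^3 = 1" for w
  proof -
    let ?S = "sect z b1 b2 b3 b0 r2 r1 w" and ?A = "1 + w^2 * u0 + w * solve_r u0 u1 u2 u3"
      and ?B = "1 + w * u1 + w^2 * solve_r u1 u2 u3 u0"
    have w2: "(w^2)^3 = 1" and w4: "(w^2)^2 = w" using w by Groebner_Basis.algebra+
    have 1: "c * ?A * ?S = ?k * (1 + w^2 * b0)"
      using sect_mult[OF w2 rel, of r1 r2] unfolding A(1)[OF w2] w4 .
    have 2: "?A * ?B = ?n * (1 + w^2 * b0)"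
      using pair_product[OF w2 D N] unfolding w4 b0 .
    have "?A \<noteq> 0" using 1 k base_factors_nonzero(1)[OF k w2 rel] by auto
    moreover have "?A * (c * ?n * ?S) = ?A * (?k * ?B)"
      using 1 2 by Groebner_Basis.algebra
    ultimately have "c * ?n * ?S = ?k * ?B" by simp
    then show ?thesis using A(2) N by (simp add: field_simps)
  qed
  moreover have "?k / (c * ?n) \<noteq> 0" using k A(2) N by simp
  ultimately show thesis using that by blast
qed

end

subsection \<open>Evaluation of multihomogeneous polynomials\<close>

definition mon_eval :: "(nat \<times> nat \<Rightarrow>\<^sub>0 nat) \<Rightarrow> (nat \<Rightarrow> 'a::field vec) \<Rightarrow> 'a" where
  "mon_eval m x = (\<Prod>(j, i)\<in>Poly_Mapping.keys m. (x j $ i) ^ Poly_Mapping.lookup m (j, i))"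

lemma mon_eval_superset:
  assumes "finite A" "Poly_Mapping.keys m \<subseteq> A"
  shows "mon_eval m x = (\<Prod>(j, i)\<in>A. (x j $ i) ^ Poly_Mapping.lookup m (j, i))"
  unfolding mon_eval_def
  by (rule prod.mono_neutral_left[OF assms]) (auto simp: in_keys_iff)

lemma mon_eval_add: "mon_eval (m + n) x = mon_eval m x * mon_eval n x"
proof -
  let ?A = "Poly_Mapping.keys m \<union> Poly_Mapping.keys n"
  have "mon_eval (m + n) x = (\<Prod>(j, i)\<in>?A. (x j $ i) ^ Poly_Mapping.lookup (m + n) (j, i))"
    by (rule mon_eval_superset) (simp_all add: keys_add)
  also have "\<dots> = (\<Prod>(j, i)\<in>?A. (x j $ i) ^ Poly_Mapping.lookup m (j, i)) *
      (\<Prod>(j, i)\<in>?A. (x j $ i) ^ Poly_Mapping.lookup n (j, i))"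
    unfolding prod.distrib[symmetric]
    by (rule prod.cong) (auto simp: lookup_add power_add)
  also have "\<dots> = mon_eval m x * mon_eval n x"
    using mon_eval_superset[of ?A m x] mon_eval_superset[of ?A n x] by simp
  finally show ?thesis .
qed

text \<open>Addition may cancel terms and so change the support; sums are compared over a common
  finite superset.\<close>

lemma meval_superset:
  assumes "finite A" "Poly_Mapping.keys f \<subseteq> A"
  shows "meval f x = (\<Sum>m\<in>A. to_ac (Poly_Mapping.lookup f m) * mon_eval m x)"
  unfolding meval_def mon_eval_def[symmetric]
  by (rule sum.mono_neutral_left[OF assms]) (auto simp: in_keys_iff)

lemma meval_add: "meval (f + g) x = meval f x + meval g x"
proof -
  let ?A = "Poly_Mapping.keys f \<union> Poly_Mapping.keys g"
  have "meval (f + g) x = (\<Sum>m\<in>?A. to_ac (Poly_Mapping.lookup (f + g) m) * mon_eval m x)"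
    by (rule meval_superset) (simp_all add: keys_add)
  also have "\<dots> = meval f x + meval g x"
    using meval_superset[of ?A f x] meval_superset[of ?A g x]
    by (simp add: lookup_add distrib_right sum.distrib)
  finally show ?thesis .
qed

lemma meval_zero [simp]: "meval 0 x = 0"
  by (simp add: meval_def)

lemma meval_sum: "meval (\<Sum>a\<in>A. f a) x = (\<Sum>a\<in>A. meval (f a) x)"
  by (induction A rule: infinite_finite_induct) (simp_all add: meval_add)

lemma meval_single: "meval (Poly_Mapping.single m c) x = to_ac c * mon_eval m x"
  by (subst meval_superset[of "{m}"]) (simp_all add: lookup_single)

lemma mpol_eq_sum_single: "f = (\<Sum>m\<in>Poly_Mapping.keys f. Poly_Mapping.single m (Poly_Mapping.lookup f m))"
  by (rule poly_mapping_eqI) (simp add: lookup_sum lookup_single when_def in_keys_iff)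

lemma meval_mult: "meval (f * g) x = meval f x * meval g x"
proof -
  let ?F = "\<lambda>f::'a mpol. \<lambda>m. Poly_Mapping.single m (Poly_Mapping.lookup f m)"
  have "f * g = (\<Sum>m\<in>Poly_Mapping.keys f. ?F f m) * (\<Sum>n\<in>Poly_Mapping.keys g. ?F g n)"
    by (simp flip: mpol_eq_sum_single)
  also have "meval \<dots> x = (\<Sum>m\<in>Poly_Mapping.keys f. meval (?F f m) x) * (\<Sum>n\<in>Poly_Mapping.keys g. meval (?F g n) x)"
    by (simp add: sum_product meval_sum meval_single mult_single mon_eval_add mult_ac)
  also have "\<dots> = meval f x * meval g x"
    by (simp only: meval_sum[symmetric] mpol_eq_sum_single[symmetric])
  finally show ?thesis .
qed

lemma meval_mconst [simp]: "meval (mconst c) x = to_ac c"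
  by (simp add: mconst_def meval_single mon_eval_def)

lemma meval_mvar [simp]: "meval (mvar j i) x = x j $ i"
  by (simp add: mvar_def meval_single mon_eval_def)

lemma meval_one: "meval 1 x = 1"
  using meval_mconst[of 1 x] by (simp add: mconst_def)

lemma meval_power: "meval (f ^ n) x = meval f x ^ n"
  by (induction n) (simp_all add: meval_mult meval_one)

lemma multihom_mconst: "multihom ns (\<lambda>_. 0) (mconst c)"
  by (auto simp: multihom_def mconst_def)

lemma multihom_mvar:
  assumes "j < length ns" "i \<le> ns ! j"
  shows "multihom ns (\<lambda>j'. if j' = j then 1 else 0) (mvar j i)"
  using assms by (auto simp: multihom_def mvar_def lookup_single when_def)

lemma multihom_add:
  assumes "multihom ns d f" "multihom ns d g"
  shows "multihom ns d (f + g)"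
  using assms keys_add[of f g] unfolding multihom_def by blast

lemma multihom_mult:
  assumes "multihom ns d f" "multihom ns e g"
  shows "multihom ns (\<lambda>j. d j + e j) (f * g)"
proof -
  have "Poly_Mapping.keys (m + n) \<subseteq> (SIGMA j:{..<length ns}. {..ns ! j}) \<and>
      (\<forall>j<length ns. (\<Sum>i\<le>ns ! j. Poly_Mapping.lookup (m + n) (j, i)) = d j + e j)"
    if "m \<in> Poly_Mapping.keys f" "n \<in> Poly_Mapping.keys g" for m n
    using assms that keys_add[of m n] by (fastforce simp: multihom_def lookup_add sum.distrib)
  then show ?thesis using keys_mult[of f g] unfolding multihom_def by blast
qed

lemma multihom_power:
  assumes "multihom ns d f" shows "multihom ns (\<lambda>j. n * d j) (f ^ n)"
proof (induction n)
  case 0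
  have "(1 :: 'a mpol) = mconst 1" by (simp add: mconst_def)
  then show ?case using multihom_mconst[of ns "1 :: 'a"] by simp
qed (use multihom_mult[OF assms] in simp)

lemma multihom_uminus: "multihom ns d f \<Longrightarrow> multihom ns d (- f)"
  by (simp add: multihom_def)

lemma meval_uminus: "meval (- f) x = - meval f x"
  using meval_add[of f "- f" x] by (simp add: eq_neg_iff_add_eq_0 add.commute)

lemma mon_eval_scale:
  fixes x y :: "nat \<Rightarrow> 'a::field vec"
  assumes m: "Poly_Mapping.keys m \<subseteq> (SIGMA j:{..<length ns}. {..ns ! j})"
    "\<And>j. j < length ns \<Longrightarrow> (\<Sum>i\<le>ns ! j. Poly_Mapping.lookup m (j, i)) = d j"
    and y: "\<And>j i. j < length ns \<Longrightarrow> i \<le> ns ! j \<Longrightarrow> y j $ i = c j * x j $ i"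
  shows "mon_eval m y = (\<Prod>j<length ns. c j ^ d j) * mon_eval m x"
proof -
  let ?S = "SIGMA j:{..<length ns}. {..ns ! j}"
  have S: "finite ?S" by simp
  have "mon_eval m y = (\<Prod>(j, i)\<in>?S. c j ^ Poly_Mapping.lookup m (j, i) * (x j $ i) ^ Poly_Mapping.lookup m (j, i))"
    unfolding mon_eval_superset[OF S m(1)]
    by (rule prod.cong) (auto simp: y power_mult_distrib)
  also have "\<dots> = (\<Prod>(j, i)\<in>?S. c j ^ Poly_Mapping.lookup m (j, i)) * mon_eval m x"
    unfolding mon_eval_superset[OF S m(1)] prod.distrib[symmetric] by (rule prod.cong) auto
  also have "(\<Prod>(j, i)\<in>?S. c j ^ Poly_Mapping.lookup m (j, i)) = (\<Prod>j<length ns. c j ^ d j)"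
    by (subst prod.Sigma[symmetric]) (auto simp: m(2) power_sum[symmetric] intro!: prod.cong)
  finally show ?thesis .
qed

text \<open>This makes vanishing, and quotients of forms of one multidegree, independent of the
  choice of homogeneous coordinates.\<close>

lemma meval_scale:
  fixes x y :: "nat \<Rightarrow> 'a::field alg_closure vec"
  assumes "multihom ns d f"
    and "\<And>j i. j < length ns \<Longrightarrow> i \<le> ns ! j \<Longrightarrow> y j $ i = c j * x j $ i"
  shows "meval f y = (\<Prod>j<length ns. c j ^ d j) * meval f x"
proof -
  have "mon_eval m y = (\<Prod>j<length ns. c j ^ d j) * mon_eval m x"
    if "m \<in> Poly_Mapping.keys f" for m
    using assms that by (intro mon_eval_scale) (auto simp: multihom_def)
  then show ?thesis
    unfolding meval_def mon_eval_def[symmetric] by (simp add: sum_distrib_left mult_ac)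
qed

lemma proj_point_self: "v \<in> proj_point v"
  unfolding proj_point_def by (auto intro!: exI[of _ 1])

lemma proj_point_smult: "c \<noteq> 0 \<Longrightarrow> proj_point (c \<cdot>\<^sub>v v) = proj_point v"
  unfolding proj_point_def
proof (safe, goal_cases)
  case (1 _ e) then show ?case by (auto simp: smult_smult_assoc intro!: exI[of _ "e * c"])
next
  case (2 _ e) then show ?case by (auto simp: smult_smult_assoc intro!: exI[of _ "e / c"])
qed

lemma proj_point_eq_iff: "proj_point v = proj_point w \<longleftrightarrow> (\<exists>c. c \<noteq> 0 \<and> v = c \<cdot>\<^sub>v w)"
proof
  assume "proj_point v = proj_point w"
  then have "v \<in> proj_point w" using proj_point_self[of v] by simp
  then show "\<exists>c. c \<noteq> 0 \<and> v = c \<cdot>\<^sub>v w" by (auto simp: proj_point_def)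
qed (auto simp: proj_point_smult)

lemma proj_point_in_space:
  "v \<in> carrier_vec (Suc n) \<Longrightarrow> v \<noteq> 0\<^sub>v (Suc n) \<Longrightarrow> proj_point v \<in> proj_space n"
  unfolding proj_space_def by blast

lemma proj_space_rep:
  assumes "P \<in> proj_space n" "v \<in> P"
  shows "v \<in> carrier_vec (Suc n)" "v \<noteq> 0\<^sub>v (Suc n)" "P = proj_point v"
proof -
  obtain w c where w: "w \<in> carrier_vec (Suc n)" "w \<noteq> 0\<^sub>v (Suc n)" "P = proj_point w"
    "c \<noteq> 0" "v = c \<cdot>\<^sub>v w"
    using assms unfolding proj_space_def proj_point_def by blast
  then show "v \<in> carrier_vec (Suc n)" "P = proj_point v" by (auto simp: proj_point_smult)
  show "v \<noteq> 0\<^sub>v (Suc n)"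
  proof
    assume "v = 0\<^sub>v (Suc n)"
    then have "w $ i = 0" if "i < Suc n" for i
      using w that by (metis carrier_vecD index_smult_vec(1) index_zero_vec(1) mult_eq_0_iff)
    then show False using w by (auto simp: vec_eq_iff)
  qed
qed

lemma proj_space_nonempty:
  assumes "P \<in> proj_space n" obtains v where "v \<in> P"
  using assms proj_point_self unfolding proj_space_def by blast

lemma multiproj_nth:
  assumes "p \<in> multiproj ns"
  shows "length p = length ns" "j < length ns \<Longrightarrow> p ! j \<in> proj_space (ns ! j)"
  using assms by (auto simp: multiproj_def list_all2_conv_all_nth)

lemma coords_nonempty:
  assumes "p \<in> multiproj ns" obtains x where "x \<in> coords p"
proof -
  have "\<forall>j. \<exists>v. j < length ns \<longrightarrow> v \<in> p ! j"
    using multiproj_nth[OF assms] proj_space_nonempty by metis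
  then obtain x where "\<forall>j<length ns. x j \<in> p ! j" by metis
  then show thesis using that multiproj_nth(1)[OF assms] by (auto simp: coords_def)
qed

lemma coords_rep:
  assumes "p \<in> multiproj ns" "x \<in> coords p" "j < length ns"
  shows "x j \<in> carrier_vec (Suc (ns ! j))" "x j \<noteq> 0\<^sub>v (Suc (ns ! j))" "p ! j = proj_point (x j)"
  using proj_space_rep[of "p ! j" "ns ! j" "x j"] multiproj_nth[OF assms(1)] assms(2,3)
  by (auto simp: coords_def)

lemma coords_proportional:
  fixes x y :: "nat \<Rightarrow> 'a::field alg_closure vec"
  assumes "p \<in> multiproj ns" "x \<in> coords p" "y \<in> coords p"
  shows "\<exists>c. (\<forall>j. c j \<noteq> 0) \<and> (\<forall>j<length ns. \<forall>i\<le>ns ! j. y j $ i = c j * x j $ i)"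
proof -
  have "\<forall>j. \<exists>c. c \<noteq> 0 \<and> (j < length ns \<longrightarrow> y j = c \<cdot>\<^sub>v x j)"
    using coords_rep(3)[OF assms(1,2)] coords_rep(3)[OF assms(1,3)] proj_point_eq_iff
    by (metis zero_neq_one)
  then obtain c where c: "\<forall>j. c j \<noteq> 0" "\<forall>j. j < length ns \<longrightarrow> y j = c j \<cdot>\<^sub>v x j" by metis
  moreover have "y j $ i = c j * x j $ i" if "j < length ns" "i \<le> ns ! j" for j i
    using c(2) coords_rep(1)[OF assms(1,2) that(1)] that by auto
  ultimately show ?thesis by blast
qed

lemma vanishes_at_iff:
  assumes "p \<in> multiproj ns" "x \<in> coords p" "multihom ns d f"
  shows "vanishes_at f p \<longleftrightarrow> meval f x = 0"
proof -
  have "meval f y = 0" if fx: "meval f x = 0" and y: "y \<in> coords p" for y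
  proof -
    obtain c where c: "\<forall>j<length ns. \<forall>i\<le>ns ! j. y j $ i = c j * x j $ i"
      using coords_proportional[OF assms(1,2) y] by blast
    show ?thesis using meval_scale[OF assms(3) c[rule_format]] fx by simp
  qed
  then show ?thesis using assms(2) by (auto simp: vanishes_at_def)
qed

lemma not_vanishes_atD:
  assumes "p \<in> multiproj ns" "x \<in> coords p" "multihom ns d f" "\<not> vanishes_at f p"
  shows "meval f x \<noteq> 0"
  using vanishes_at_iff[OF assms(1-3)] assms(4) by simp

subsection \<open>Open sets and regular functions\<close>

text \<open>The first half of \<open>dense_open\<close>. Density is proved separately, by
  parametrizations.\<close>

definition open_in :: "nat list \<Rightarrow> 'k::field mpoint set \<Rightarrow> 'k mpoint set \<Rightarrow> bool" where
  "open_in ns V U \<longleftrightarrow> (\<exists>Z. zariski_closed ns Z \<and> U = V - Z)"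

lemma open_in_self:
  assumes "V \<subseteq> multiproj ns" shows "open_in ns V V"
proof -
  have "zero_locus ns {mconst (1 :: 'a)} = {}"
  proof (rule ccontr)
    assume "zero_locus ns {mconst (1 :: 'a)} \<noteq> {}"
    then obtain p where p: "p \<in> multiproj ns" "vanishes_at (mconst (1 :: 'a)) p"
      by (auto simp: zero_locus_def)
    obtain x where "x \<in> coords p" by (rule coords_nonempty[OF p(1)])
    with p(2) show False by (auto simp: vanishes_at_def)
  qed
  then have "zariski_closed ns ({} :: 'a mpoint set)"
    unfolding zariski_closed_def using multihom_mconst by (metis singletonD)
  then show ?thesis unfolding open_in_def by blast
qed

lemma open_in_subset: "open_in ns V U \<Longrightarrow> U \<subseteq> V"
  by (auto simp: open_in_def)

text \<open>Multiplying every equation of a closed set by \<open>h\<close> adds the zero locus of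
  \<open>h\<close> to it.\<close>

lemma open_in_nonvanishing:
  assumes "open_in ns V U" "V \<subseteq> multiproj ns" "multihom ns d h"
  shows "open_in ns V {p \<in> U. \<not> vanishes_at h p}"
proof -
  obtain F where F: "\<And>f. f \<in> F \<Longrightarrow> \<exists>d. multihom ns d f" "U = V - zero_locus ns F"
    using assms(1) unfolding open_in_def zariski_closed_def by blast
  let ?G = "(\<lambda>f. f * h) ` F"
  have "{p \<in> U. \<not> vanishes_at h p} = V - zero_locus ns ?G"
  proof -
    have "p \<in> zero_locus ns ?G \<longleftrightarrow> p \<in> zero_locus ns F \<or> vanishes_at h p" if p: "p \<in> multiproj ns" for p
    proof -
      obtain x where x: "x \<in> coords p" by (rule coords_nonempty[OF p])
      have "vanishes_at (f * h) p \<longleftrightarrow> vanishes_at f p \<or> vanishes_at h p" if f: "f \<in> F" for f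
      proof -
        obtain e where e: "multihom ns e f" using F(1)[OF f] by blast
        show ?thesis
          using vanishes_at_iff[OF p x e] vanishes_at_iff[OF p x assms(3)]
            vanishes_at_iff[OF p x multihom_mult[OF e assms(3)]] by (simp add: meval_mult)
      qed
      then show ?thesis using p by (auto simp: zero_locus_def)
    qed
    then show ?thesis using F(2) assms(2) by blast
  qed
  moreover have "\<exists>e. multihom ns e g" if g: "g \<in> ?G" for g
    using F(1) multihom_mult[OF _ assms(3)] g by fastforce
  then have "zariski_closed ns (zero_locus ns ?G)"
    unfolding zariski_closed_def by (intro exI[of _ ?G]) simp
  ultimately show ?thesis unfolding open_in_def by blast
qed

text \<open>A regular function here is a global quotient of two forms of the same multidegree.\<close>

definition regular_fun :: "nat list \<Rightarrow> 'k::field mpoint set \<Rightarrow> ('k mpoint \<Rightarrow> 'k alg_closure) \<Rightarrow> bool" where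
  "regular_fun ns U f \<longleftrightarrow> (\<exists>d N D. multihom ns d N \<and> multihom ns d D \<and>
     (\<forall>p\<in>U. \<forall>x\<in>coords p. meval D x \<noteq> 0 \<and> f p = meval N x / meval D x))"

lemma regular_fun_subset: "regular_fun ns U f \<Longrightarrow> U' \<subseteq> U \<Longrightarrow> regular_fun ns U' f"
  unfolding regular_fun_def by blast

lemma regular_fun_const: "regular_fun ns U (\<lambda>_. to_ac c)"
  unfolding regular_fun_def
  by (intro exI[of _ "\<lambda>_. 0"] exI[of _ "mconst c"] exI[of _ "mconst 1"])
    (simp add: multihom_mconst)

lemma regular_fun_0: "regular_fun ns U (\<lambda>_. 0)"
  and regular_fun_1: "regular_fun ns U (\<lambda>_. 1)"
  and regular_fun_numeral: "regular_fun ns U (\<lambda>_. numeral k)"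
  using regular_fun_const[of ns U 0] regular_fun_const[of ns U 1] regular_fun_const[of ns U "numeral k"]
  by simp_all

lemma regular_fun_add:
  assumes "regular_fun ns U f" "regular_fun ns U g"
  shows "regular_fun ns U (\<lambda>p. f p + g p)"
proof -
  obtain d N D where 1: "multihom ns d N" "multihom ns d D"
    "\<forall>p\<in>U. \<forall>x\<in>coords p. meval D x \<noteq> 0 \<and> f p = meval N x / meval D x"
    using assms(1) unfolding regular_fun_def by blast
  obtain e M E where 2: "multihom ns e M" "multihom ns e E"
    "\<forall>p\<in>U. \<forall>x\<in>coords p. meval E x \<noteq> 0 \<and> g p = meval M x / meval E x"
    using assms(2) unfolding regular_fun_def by blast
  have "multihom ns (\<lambda>j. d j + e j) (N * E + D * M)" "multihom ns (\<lambda>j. d j + e j) (D * E)"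
    using 1 2 by (auto intro: multihom_add multihom_mult)
  moreover have "meval (D * E) x \<noteq> 0 \<and> f p + g p = meval (N * E + D * M) x / meval (D * E) x"
    if "p \<in> U" "x \<in> coords p" for p x
    using 1(3)[rule_format, OF that] 2(3)[rule_format, OF that]
    by (simp add: meval_add meval_mult add_frac_eq mult.commute)
  ultimately show ?thesis unfolding regular_fun_def by blast
qed

lemma regular_fun_mult:
  assumes "regular_fun ns U f" "regular_fun ns U g"
  shows "regular_fun ns U (\<lambda>p. f p * g p)"
proof -
  obtain d N D where 1: "multihom ns d N" "multihom ns d D"
    "\<forall>p\<in>U. \<forall>x\<in>coords p. meval D x \<noteq> 0 \<and> f p = meval N x / meval D x"
    using assms(1) unfolding regular_fun_def by blast
  obtain e M E where 2: "multihom ns e M" "multihom ns e E"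
    "\<forall>p\<in>U. \<forall>x\<in>coords p. meval E x \<noteq> 0 \<and> g p = meval M x / meval E x"
    using assms(2) unfolding regular_fun_def by blast
  have "multihom ns (\<lambda>j. d j + e j) (N * M)" "multihom ns (\<lambda>j. d j + e j) (D * E)"
    using 1 2 by (auto intro: multihom_mult)
  moreover have "meval (D * E) x \<noteq> 0 \<and> f p * g p = meval (N * M) x / meval (D * E) x"
    if "p \<in> U" "x \<in> coords p" for p x
    using 1(3)[rule_format, OF that] 2(3)[rule_format, OF that] by (simp add: meval_mult)
  ultimately show ?thesis unfolding regular_fun_def by blast
qed

lemma regular_fun_uminus: "regular_fun ns U f \<Longrightarrow> regular_fun ns U (\<lambda>p. - f p)"
  using regular_fun_mult[OF regular_fun_const[of ns U "-1"], of f] by simp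

lemma regular_fun_diff:
  "regular_fun ns U f \<Longrightarrow> regular_fun ns U g \<Longrightarrow> regular_fun ns U (\<lambda>p. f p - g p)"
  using regular_fun_add[OF _ regular_fun_uminus, of ns U f g] by simp

lemma regular_fun_power: "regular_fun ns U f \<Longrightarrow> regular_fun ns U (\<lambda>p. f p ^ n)"
  by (induction n) (simp_all add: regular_fun_1 regular_fun_mult)

lemma regular_fun_divide:
  assumes "regular_fun ns U f" "regular_fun ns U g" "\<And>p. p \<in> U \<Longrightarrow> p \<in> multiproj ns"
    "\<And>p. p \<in> U \<Longrightarrow> g p \<noteq> 0"
  shows "regular_fun ns U (\<lambda>p. f p / g p)"
proof -
  obtain e M E where 2: "multihom ns e M" "multihom ns e E"
    "\<forall>p\<in>U. \<forall>x\<in>coords p. meval E x \<noteq> 0 \<and> g p = meval M x / meval E x"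
    using assms(2) unfolding regular_fun_def by blast
  have "regular_fun ns U (\<lambda>p. 1 / g p)"
    unfolding regular_fun_def
    by (rule exI[of _ e], rule exI[of _ E], rule exI[of _ M]) (use 2 assms(4) in fastforce)
  from regular_fun_mult[OF assms(1) this] show ?thesis by simp
qed

lemmas regular_fun_intros = regular_fun_const regular_fun_0 regular_fun_1 regular_fun_numeral
  regular_fun_add regular_fun_mult regular_fun_uminus regular_fun_diff regular_fun_power

lemma open_in_regular_fun:
  assumes "open_in ns V U" "V \<subseteq> multiproj ns" "regular_fun ns U f"
  shows "open_in ns V {p \<in> U. f p \<noteq> 0}"
proof -
  obtain d N D where 1: "multihom ns d N" "multihom ns d D"
    "\<forall>p\<in>U. \<forall>x\<in>coords p. meval D x \<noteq> 0 \<and> f p = meval N x / meval D x"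
    using assms(3) unfolding regular_fun_def by blast
  have "f p \<noteq> 0 \<longleftrightarrow> \<not> vanishes_at N p" if p: "p \<in> U" for p
  proof -
    have pm: "p \<in> multiproj ns" using p assms(1,2) open_in_subset by blast
    obtain x where x: "x \<in> coords p" by (rule coords_nonempty[OF pm])
    show ?thesis using vanishes_at_iff[OF pm x 1(1)] 1(3) p x by auto
  qed
  then have "{p \<in> U. f p \<noteq> 0} = {p \<in> U. \<not> vanishes_at N p}" by blast
  then show ?thesis using open_in_nonvanishing[OF assms(1,2) 1(1)] by simp
qed

text \<open>\<open>SOME\<close> fixes homogeneous coordinates; by \<open>form_quot_eq\<close> the
  choice is immaterial when both forms have the same multidegree.\<close>

definition form_quot :: "'k::field mpol \<Rightarrow> 'k mpol \<Rightarrow> 'k mpoint \<Rightarrow> 'k alg_closure" where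
  "form_quot N D p = (let x = SOME x. x \<in> coords p in meval N x / meval D x)"

lemma form_quot_eq:
  assumes "p \<in> multiproj ns" "x \<in> coords p" "multihom ns d N" "multihom ns d D"
  shows "form_quot N D p = meval N x / meval D x"
proof -
  define y where "y = (SOME y. y \<in> coords p)"
  have y: "y \<in> coords p" unfolding y_def using someI[of "\<lambda>y. y \<in> coords p", OF assms(2)] .
  obtain c where c: "\<forall>j. c j \<noteq> 0" "\<forall>j<length ns. \<forall>i\<le>ns ! j. y j $ i = c j * x j $ i"
    using coords_proportional[OF assms(1,2) y] by blast
  define e where "e = (\<Prod>j<length ns. c j ^ d j)"
  have "meval N y = e * meval N x" "meval D y = e * meval D x"
    unfolding e_def using c(2) by (auto intro!: meval_scale[OF assms(3)] meval_scale[OF assms(4)])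
  moreover have "e \<noteq> 0" unfolding e_def using c(1) by simp
  ultimately show ?thesis by (simp only: form_quot_def Let_def flip: y_def) simp
qed

lemma regular_fun_form_quot:
  assumes "U \<subseteq> multiproj ns" "multihom ns d N" "multihom ns d D" "\<And>p. p \<in> U \<Longrightarrow> \<not> vanishes_at D p"
  shows "regular_fun ns U (form_quot N D)"
  unfolding regular_fun_def
proof (intro exI conjI ballI)
  fix p x assume p: "p \<in> U" and x: "x \<in> coords p"
  have pm: "p \<in> multiproj ns" using p assms(1) by blast
  show "meval D x \<noteq> 0" using not_vanishes_atD[OF pm x assms(3)] assms(4)[OF p] by blast
  show "form_quot N D p = meval N x / meval D x" by (rule form_quot_eq[OF pm x assms(2,3)])
qed (fact assms)+

text \<open>Each component of a \<open>regular_map\<close> needs a tuple of forms of one common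
  multidegree; clearing denominators produces it.\<close>

lemma regular_fun_common_denominator:
  assumes "\<And>i. i \<le> (n::nat) \<Longrightarrow> regular_fun ns U (f i)"
  shows "\<exists>d N D. (\<forall>i\<le>n. multihom ns d (N i)) \<and>
     (\<forall>p\<in>U. \<forall>x\<in>coords p. meval D x \<noteq> 0 \<and> (\<forall>i\<le>n. f i p = meval (N i) x / meval D x)) \<and> multihom ns d D"
  using assms
proof (induction n)
  case 0
  then obtain d N D where "multihom ns d N" "multihom ns d D"
     "\<forall>p\<in>U. \<forall>x\<in>coords p. meval D x \<noteq> 0 \<and> f 0 p = meval N x / meval D x"
    unfolding regular_fun_def by blast
  then show ?case by (intro exI[of _ d] exI[of _ "\<lambda>_. N"] exI[of _ D]) simp
next
  case (Suc n)
  obtain d N D where 1: "\<forall>i\<le>n. multihom ns d (N i)" "multihom ns d D"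
     "\<forall>p\<in>U. \<forall>x\<in>coords p. meval D x \<noteq> 0 \<and> (\<forall>i\<le>n. f i p = meval (N i) x / meval D x)"
    using Suc.IH Suc.prems by (metis le_SucI)
  obtain e M E where 2: "multihom ns e M" "multihom ns e E"
     "\<forall>p\<in>U. \<forall>x\<in>coords p. meval E x \<noteq> 0 \<and> f (Suc n) p = meval M x / meval E x"
    using Suc.prems[of "Suc n"] unfolding regular_fun_def by blast
  let ?N = "\<lambda>i. if i \<le> n then N i * E else D * M"
  have "\<forall>i\<le>Suc n. multihom ns (\<lambda>j. d j + e j) (?N i)"
    using 1 2 by (auto intro: multihom_mult)
  moreover have "multihom ns (\<lambda>j. d j + e j) (D * E)" using 1 2 by (auto intro: multihom_mult)
  moreover have "meval (D * E) x \<noteq> 0 \<and> (\<forall>i\<le>Suc n. f i p = meval (?N i) x / meval (D * E) x)"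
    if "p \<in> U" "x \<in> coords p" for p x
    using 1(3)[rule_format, OF that] 2(3)[rule_format, OF that] by (auto simp: meval_mult le_Suc_eq)
  ultimately show ?case by (intro exI[of _ "\<lambda>j. d j + e j"] exI[of _ ?N] exI[of _ "D * E"]) simp
qed

text \<open>Since a \<open>regular_fun\<close> is a quotient of forms on all of \<open>U\<close>, a
  single tuple of numerators serves as local description at every point.\<close>

lemma regular_mapI:
  assumes "\<phi> \<in> U \<rightarrow> W" "U \<subseteq> multiproj ns"
    and "\<And>j i. j < length ms \<Longrightarrow> i \<le> ms ! j \<Longrightarrow> regular_fun ns U (f j i)"
    and "\<And>p j. p \<in> U \<Longrightarrow> j < length ms \<Longrightarrow> \<exists>i\<le>ms ! j. f j i p \<noteq> 0"
    and "\<And>p j. p \<in> U \<Longrightarrow> j < length ms \<Longrightarrow>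
      \<phi> p ! j = proj_point (vec (Suc (ms ! j)) (\<lambda>i. f j i p))"
  shows "regular_map ns U ms W \<phi>"
  unfolding regular_map_def
proof (intro conjI ballI allI impI)
  show "\<phi> \<in> U \<rightarrow> W" by fact
  fix p j assume p: "p \<in> U" and j: "j < length ms"
  obtain d N D where 1: "\<forall>i\<le>ms ! j. multihom ns d (N i)" "multihom ns d D"
    "\<forall>p\<in>U. \<forall>x\<in>coords p. meval D x \<noteq> 0 \<and> (\<forall>i\<le>ms ! j. f j i p = meval (N i) x / meval D x)"
    using regular_fun_common_denominator[of "ms ! j" ns U "f j"] assms(3)[OF j] by blast
  have pm: "p \<in> multiproj ns" using p assms(2) by blast
  obtain x where x: "x \<in> coords p" by (rule coords_nonempty[OF pm])
  obtain i where i: "i \<le> ms ! j" "f j i p \<noteq> 0" using assms(4)[OF p j] by blast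
  have "\<not> vanishes_at (N i) p"
    using vanishes_at_iff[OF pm x 1(1)[rule_format, OF i(1)]] 1(3) i p x by auto
  moreover have "\<phi> q ! j = proj_point (vec (Suc (ms ! j)) (\<lambda>i. meval (N i) x))"
    if q: "q \<in> U" and x: "x \<in> coords q" for q x
  proof -
    have "vec (Suc (ms ! j)) (\<lambda>i. meval (N i) x) = meval D x \<cdot>\<^sub>v vec (Suc (ms ! j)) (\<lambda>i. f j i q)"
      using 1(3) q x by (auto simp: vec_eq_iff)
    then show ?thesis using assms(5)[OF q j] 1(3) q x by (simp add: proj_point_smult)
  qed
  ultimately show "\<exists>d F. (\<forall>i\<le>ms ! j. multihom ns d (F i)) \<and> (\<exists>i\<le>ms ! j. \<not> vanishes_at (F i) p) \<and>
      (\<forall>q\<in>U. (\<exists>i\<le>ms ! j. \<not> vanishes_at (F i) q) \<longrightarrow>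
        (\<forall>x\<in>coords q. \<phi> q ! j = proj_point (vec (Suc (ms ! j)) (\<lambda>i. meval (F i) x))))"
    using 1(1) i(1) by blast
qed

subsection \<open>Polynomial functions\<close>

text \<open>Functions are used instead of formal polynomials, so that composing a form with a
  parametrization is covered by closure rules.\<close>

inductive polyf :: "((nat \<Rightarrow> 'a::comm_ring_1) \<Rightarrow> 'a) \<Rightarrow> bool" where
  const: "polyf (\<lambda>_. c)"
| var: "polyf (\<lambda>u. u n)"
| add: "polyf f \<Longrightarrow> polyf g \<Longrightarrow> polyf (\<lambda>u. f u + g u)"
| mult: "polyf f \<Longrightarrow> polyf g \<Longrightarrow> polyf (\<lambda>u. f u * g u)"

lemma polyf_uminus: "polyf f \<Longrightarrow> polyf (\<lambda>u. - f u)"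
  using polyf.mult[OF polyf.const[of "-1"], of f] by simp

lemma polyf_diff: "polyf f \<Longrightarrow> polyf g \<Longrightarrow> polyf (\<lambda>u. f u - g u)"
  using polyf.add[OF _ polyf_uminus, of f g] by simp

lemma polyf_power: "polyf f \<Longrightarrow> polyf (\<lambda>u. f u ^ n)"
  by (induction n) (simp_all add: polyf.const polyf.mult)

lemma polyf_sum: "(\<And>a. a \<in> A \<Longrightarrow> polyf (f a)) \<Longrightarrow> polyf (\<lambda>u. \<Sum>a\<in>A. f a u)"
  by (induction A rule: infinite_finite_induct) (simp_all add: polyf.const polyf.add)

lemma polyf_prod: "(\<And>a. a \<in> A \<Longrightarrow> polyf (f a)) \<Longrightarrow> polyf (\<lambda>u. \<Prod>a\<in>A. f a u)"
  by (induction A rule: infinite_finite_induct) (simp_all add: polyf.const polyf.mult)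

lemma polyf_divide: "polyf f \<Longrightarrow> polyf (\<lambda>u. f u / (c :: 'a :: field))"
  using polyf.mult[OF _ polyf.const[of "inverse c"], of f] by (simp add: divide_inverse)

lemmas polyf_intros = polyf.intros polyf_uminus polyf_diff polyf_power polyf_divide

lemma polyf_line:
  assumes "polyf f" shows "\<exists>P. \<forall>t. f (\<lambda>n. u n + t * v n) = poly P t"
  using assms
proof induction
  case (const c)
  show ?case by (intro exI[of _ "[:c:]"]) simp
next
  case (var n)
  show ?case by (intro exI[of _ "[:u n, v n:]"]) simp
next
  case (add f g)
  then obtain P Q where "\<forall>t. f (\<lambda>n. u n + t * v n) = poly P t" "\<forall>t. g (\<lambda>n. u n + t * v n) = poly Q t"
    by blast
  then show ?case by (intro exI[of _ "P + Q"]) simp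
next
  case (mult f g)
  then obtain P Q where "\<forall>t. f (\<lambda>n. u n + t * v n) = poly P t" "\<forall>t. g (\<lambda>n. u n + t * v n) = poly Q t"
    by blast
  then show ?case by (intro exI[of _ "P * Q"]) simp
qed

text \<open>Restrict to the line through \<open>u0\<close> and \<open>u\<close>: the product of two
  polynomials in one variable vanishes identically there, while the one from \<open>g\<close> is
  nonzero at the parameter of \<open>u0\<close>.\<close>

lemma polyf_zero_product:
  fixes f g :: "(nat \<Rightarrow> 'a::field_char_0) \<Rightarrow> 'a"
  assumes "polyf f" "polyf g" and fg: "\<And>u. g u \<noteq> 0 \<Longrightarrow> f u = 0" and "g u0 \<noteq> 0"
  shows "f u = 0"
proof -
  let ?w = "\<lambda>t n. u0 n + t * (u n - u0 n)"
  obtain P where P: "\<forall>t. f (?w t) = poly P t"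
    using polyf_line[OF assms(1), where u = u0 and v = "\<lambda>n. u n - u0 n"] by blast
  obtain Q where Q: "\<forall>t. g (?w t) = poly Q t"
    using polyf_line[OF assms(2), where u = u0 and v = "\<lambda>n. u n - u0 n"] by blast
  have "poly (P * Q) t = 0" for t using fg[of "?w t"] P Q by auto
  then have "P * Q = 0" using poly_all_0_iff_0 by blast
  moreover have "poly Q 0 \<noteq> 0" using Q[rule_format, of 0, symmetric] assms(4) by simp
  ultimately have "P = 0" by auto
  then show ?thesis using P[rule_format, of 1] by simp
qed

lemma polyf_meval:
  fixes par :: "(nat \<Rightarrow> 'k::field alg_closure) \<Rightarrow> nat \<Rightarrow> 'k alg_closure vec"
  assumes "multihom ns d f"
    and "\<And>j i. j < length ns \<Longrightarrow> i \<le> ns ! j \<Longrightarrow> polyf (\<lambda>u. par u j $ i)"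
  shows "polyf (\<lambda>u. meval f (par u))"
proof -
  have "polyf (\<lambda>u. mon_eval m (par u))" if "m \<in> Poly_Mapping.keys f" for m
  proof -
    have "Poly_Mapping.keys m \<subseteq> (SIGMA j:{..<length ns}. {..ns ! j})"
      using assms(1) that by (simp add: multihom_def)
    then show ?thesis
      unfolding mon_eval_def split_def by (intro polyf_prod polyf_power assms(2)) auto
  qed
  then show ?thesis
    unfolding meval_def mon_eval_def[symmetric] by (intro polyf_sum polyf.mult polyf.const)
qed

text \<open>The polynomial \<open>e\<close> takes care of parameters for which \<open>par u\<close> is not a coordinate vector.\<close>

lemma vanishes_on_parametrization:
  fixes par :: "(nat \<Rightarrow> 'k::field_char_0 alg_closure) \<Rightarrow> nat \<Rightarrow> 'k alg_closure vec"
  assumes "open_in ns V U" "V \<subseteq> multiproj ns" "multihom ns d f" "\<And>p. p \<in> U \<Longrightarrow> vanishes_at f p"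
    and X: "\<And>j i. j < length ns \<Longrightarrow> i \<le> ns ! j \<Longrightarrow> polyf (\<lambda>u. par u j $ i)"
    and e: "polyf e" "\<And>u. e u \<noteq> 0 \<Longrightarrow> \<exists>p\<in>V. par u \<in> coords p"
    and p0: "p0 \<in> U" "par u0 \<in> coords p0" "e u0 \<noteq> 0"
  shows "meval f (par u) = 0"
proof -
  obtain F where F: "\<And>f. f \<in> F \<Longrightarrow> \<exists>d. multihom ns d f" "U = V - zero_locus ns F"
    using assms(1) unfolding open_in_def zariski_closed_def by blast
  have "p0 \<in> multiproj ns" using p0(1) F(2) assms(2) by blast
  then obtain h where h: "h \<in> F" "\<not> vanishes_at h p0"
    using p0(1) F(2) by (auto simp: zero_locus_def)
  obtain d' where d': "multihom ns d' h" using F(1) h(1) by blast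
  \<comment> \<open>Where \<open>e\<close> and \<open>h\<close> do not vanish, \<open>par u\<close>
    represents a point of \<open>U\<close>. \<open>polyf_zero_product\<close> then removes this
    restriction on \<open>u\<close>.\<close>
  have "meval f (par u) = 0" if u: "e u * meval h (par u) \<noteq> 0" for u
  proof -
    obtain p where p: "p \<in> V" "par u \<in> coords p" using e(2) u by auto
    have pm: "p \<in> multiproj ns" using p(1) assms(2) by blast
    have "\<not> vanishes_at h p" using vanishes_at_iff[OF pm p(2) d'] u by simp
    then have "p \<in> U" using p(1) F(2) h(1) by (auto simp: zero_locus_def)
    then show ?thesis using assms(4) vanishes_at_iff[OF pm p(2) assms(3)] by simp
  qed
  moreover have "e u0 * meval h (par u0) \<noteq> 0"
    using p0(3) not_vanishes_atD[OF \<open>p0 \<in> multiproj ns\<close> p0(2) d' h(2)] by simp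
  moreover have "polyf (\<lambda>u. meval f (par u))" by (rule polyf_meval[OF assms(3) X])
  moreover have "polyf (\<lambda>u. meval h (par u))" by (rule polyf_meval[OF d' X])
  then have "polyf (\<lambda>u. e u * meval h (par u))" by (rule polyf.mult[OF e(1)])
  ultimately show ?thesis
    using polyf_zero_product[of "\<lambda>u. meval f (par u)" "\<lambda>u. e u * meval h (par u)" u0 u] by blast
qed

lemma vec_nonzero_index: "v \<in> carrier_vec n \<Longrightarrow> v \<noteq> 0\<^sub>v n \<Longrightarrow> \<exists>i<n. v $ i \<noteq> 0"
  by (auto simp: vec_eq_iff)

lemma dense_open_projective_space:
  fixes U :: "'k::field_char_0 mpoint set"
  assumes "open_in [n] (multiproj [n]) U" "p0 \<in> U"
  shows "dense_open [n] (multiproj [n]) U"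
  unfolding dense_open_def
proof (intro conjI allI impI)
  show "\<exists>Z. zariski_closed [n] Z \<and> U = multiproj [n] - Z" using assms(1) by (simp add: open_in_def)
  fix Z :: "'k mpoint set" assume Z: "zariski_closed [n] Z \<and> U \<subseteq> Z"
  then obtain F where F: "\<And>f. f \<in> F \<Longrightarrow> \<exists>d. multihom [n] d f" "Z = zero_locus [n] F"
    unfolding zariski_closed_def by blast
  have p0: "p0 \<in> multiproj [n]" using assms open_in_subset by blast
  obtain x0 where x0: "x0 \<in> coords p0" by (rule coords_nonempty[OF p0])
  have x0': "x0 0 \<in> carrier_vec (Suc n)" "x0 0 \<noteq> 0\<^sub>v (Suc n)" "x0 0 \<in> p0 ! 0"
    using coords_rep[OF p0 x0, of 0] x0 multiproj_nth(1)[OF p0] by (auto simp: coords_def)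
  have x0c: "(\<lambda>_. x0 0) \<in> coords p0"
    using multiproj_nth(1)[OF p0] x0' by (auto simp: coords_def)
  \<comment> \<open>The index of a nonzero coordinate of \<open>p0\<close>; the condition
    \<open>u l \<noteq> 0\<close> will keep the parametrized vector nonzero.\<close>
  obtain l where l: "l < Suc n" "x0 0 $ l \<noteq> 0" using vec_nonzero_index x0'(1,2) by blast
  let ?X = "\<lambda>u::nat \<Rightarrow> 'k alg_closure. \<lambda>j::nat. vec (Suc n) u"
  have Xp: "?X u \<in> coords [proj_point (vec (Suc n) u)]" for u
    by (simp add: coords_def proj_point_self)
  show "multiproj [n] \<subseteq> Z"
  proof
    fix p :: "'k mpoint" assume p: "p \<in> multiproj [n]"
    obtain x where x: "x \<in> coords p" by (rule coords_nonempty[OF p])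
    have "vanishes_at f p" if f: "f \<in> F" for f
    proof -
      obtain d where d: "multihom [n] d f" using F(1) f by blast
      have van: "vanishes_at f q" if "q \<in> U" for q using Z F(2) f that by (auto simp: zero_locus_def)
      have x': "x 0 \<in> carrier_vec (Suc n)" "x 0 \<in> p ! 0" "length p = 1"
        using coords_rep[OF p x, of 0] x multiproj_nth(1)[OF p] by (auto simp: coords_def)
      have X: "?X (vec_index v) = (\<lambda>_. v)" if "v \<in> carrier_vec (Suc n)" for v
        using that by (auto simp: vec_eq_iff)
      have "meval f (?X (vec_index (x 0))) = 0"
      proof (rule vanishes_on_parametrization[OF assms(1) subset_refl d, where par = ?X and e = "\<lambda>u. u l"
            and u = "vec_index (x 0)" and ?p0.0 = p0 and ?u0.0 = "vec_index (x0 0)"])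
        show "vanishes_at f q" if "q \<in> U" for q by (rule van[OF that])
        show "polyf (\<lambda>u. ?X u j $ i)" if "j < length [n]" "i \<le> [n] ! j" for j i
          using that polyf.var by simp
        show "polyf (\<lambda>u. u l)" by (rule polyf.var)
        fix u :: "nat \<Rightarrow> 'k alg_closure" assume "u l \<noteq> 0"
        then have "vec (Suc n) u \<noteq> 0\<^sub>v (Suc n)" using l(1) by (metis index_vec index_zero_vec(1))
        then have "[proj_point (vec (Suc n) u)] \<in> multiproj [n]"
          by (auto simp: multiproj_def intro!: proj_point_in_space)
        then show "\<exists>p\<in>multiproj [n]. ?X u \<in> coords p" using Xp by blast
      qed (use assms(2) l x0c in \<open>simp_all add: X[OF x0'(1)]\<close>)
      then have "meval f (\<lambda>_. x 0) = 0" using X[OF x'(1)] by simp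
      moreover have "(\<lambda>_. x 0) \<in> coords p" using x' by (simp add: coords_def)
      ultimately show ?thesis using vanishes_at_iff[OF p _ d] by blast
    qed
    then show "p \<in> Z" using p F(2) by (simp add: zero_locus_def)
  qed
qed

subsection \<open>The surface in adapted coordinates\<close>

locale dp4 =
  fixes z :: "'k::field_char_0"
  assumes z2: "z^2 + z + 1 = 0"
begin

abbreviation zc :: "'k alg_closure" where "zc \<equiv> to_ac z"

abbreviation th :: "'k alg_closure" where "th \<equiv> zc - zc^2"

sublocale K: cube_root zc
proof
  have "to_ac (z^2 + z + 1) = 0" unfolding z2 by simp
  then show "zc^2 + zc + 1 = 0" by simp
qed

lemma th2: "th^2 = -3" "th \<noteq> 0"
proof -
  show "th^2 = -3" using K.z2 by Groebner_Basis.algebra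
  then show "th \<noteq> 0" by (metis neg_equal_0_iff_equal zero_neq_numeral zero_power2)
qed

text \<open>The coefficients stay in \<open>'k\<close>: the same list yields the values
  \<open>lin c\<close> over the closure and the form \<open>lform c\<close> over the ground
  field.\<close>

definition lin :: "'k list \<Rightarrow> 'k alg_closure vec \<Rightarrow> 'k alg_closure" where
  "lin c v = (\<Sum>i\<le>4. to_ac (c ! i) * v $ i)"

definition lform :: "'k list \<Rightarrow> 'k mpol" where
  "lform c = (\<Sum>i\<le>4. mconst (c ! i) * mvar 0 i)"

lemma meval_lform: "meval (lform c) x = lin c (x 0)"
  by (simp add: lform_def lin_def meval_sum meval_mult)

lemma multihom_sum:
  assumes "finite A" "A \<noteq> {}" "\<And>a. a \<in> A \<Longrightarrow> multihom ns d (f a)"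
  shows "multihom ns d (\<Sum>a\<in>A. f a)"
  using assms by (induction A rule: finite_ne_induct) (auto intro: multihom_add)

lemma multihom_lform: "multihom (4 # ns) (\<lambda>j. if j = 0 then 1 else 0) (lform c)"
proof -
  have "multihom (4 # ns) (\<lambda>j. 0 + (if j = 0 then 1 else 0)) (mconst (c ! i) * mvar 0 i)" if "i \<le> 4" for i
    using that by (intro multihom_mult multihom_mconst multihom_mvar) auto
  then show ?thesis unfolding lform_def by (intro multihom_sum) auto
qed

text \<open>
  Homogeneous coordinates \<open>[s : b\<^sub>0 : b\<^sub>1 : b\<^sub>2 : b\<^sub>3]\<close> in which \<open>\<tau>\<close> permutes the \<open>b\<^sub>j\<close> cyclically and the
  surface becomes \<open>b\<^sub>0 b\<^sub>2 = s (b\<^sub>1 + b\<^sub>3)\<close>, \<open>b\<^sub>1 b\<^sub>3 = s (b\<^sub>0 + b\<^sub>2)\<close>.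
\<close>

definition cs :: "'k list" where "cs = [1, 1, 1, 0, 0]"
definition cb :: "nat \<Rightarrow> 'k list" where
  "cb j = [[-1, - (z^2), - z, z - z^2, 0], [-1, - z, - (z^2), 0, z^2 - z],
           [-1, - (z^2), - z, z^2 - z, 0], [-1, - z, - (z^2), 0, z - z^2]] ! j"

lemma lin_simps:
  "lin cs v = v $ 0 + v $ 1 + v $ 2"
  "lin (cb 0) v = th * v $ 3 - (v $ 0 + zc^2 * v $ 1 + zc * v $ 2)"
  "lin (cb (Suc 0)) v = - th * v $ 4 - (v $ 0 + zc * v $ 1 + zc^2 * v $ 2)"
  "lin (cb 2) v = - th * v $ 3 - (v $ 0 + zc^2 * v $ 1 + zc * v $ 2)"
  "lin (cb 3) v = th * v $ 4 - (v $ 0 + zc * v $ 1 + zc^2 * v $ 2)"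
  by (simp_all add: lin_def cs_def cb_def atMost_Suc eval_nat_numeral algebra_simps)

text \<open>The inverse change of coordinates; on the first three entries it is an inverse Fourier
  transform.\<close>

definition vecof ::
  "'k alg_closure \<Rightarrow> 'k alg_closure \<Rightarrow> 'k alg_closure \<Rightarrow> 'k alg_closure \<Rightarrow> 'k alg_closure \<Rightarrow> 'k alg_closure vec"
where
  "vecof s b0 b1 b2 b3 = (let l1 = (b1 + b3) / 2; l2 = (b0 + b2) / 2 in
     vec_of_list [(s - l1 - l2) / 3, (s - zc^2 * l1 - zc * l2) / 3, (s - zc * l1 - zc^2 * l2) / 3,
       (b0 - b2) / (2 * th), (b3 - b1) / (2 * th)])"

lemma vecof_carrier [simp]: "vecof s b0 b1 b2 b3 \<in> carrier_vec 5"
  by (auto simp: vecof_def Let_def intro!: carrier_vecI)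

lemma vecof_index:
  "vecof s b0 b1 b2 b3 $ 0 = (s - (b1 + b3) / 2 - (b0 + b2) / 2) / 3"
  "vecof s b0 b1 b2 b3 $ Suc 0 = (s - zc^2 * ((b1 + b3) / 2) - zc * ((b0 + b2) / 2)) / 3"
  "vecof s b0 b1 b2 b3 $ 2 = (s - zc * ((b1 + b3) / 2) - zc^2 * ((b0 + b2) / 2)) / 3"
  "vecof s b0 b1 b2 b3 $ 3 = (b0 - b2) / (2 * th)"
  "vecof s b0 b1 b2 b3 $ 4 = (b3 - b1) / (2 * th)"
  by (simp_all add: vecof_def Let_def eval_nat_numeral)

lemma vecof_eqs:
  "6 * vecof s b0 b1 b2 b3 $ 0 = 2 * s - (b1 + b3) - (b0 + b2)"
  "6 * vecof s b0 b1 b2 b3 $ Suc 0 = 2 * s - zc^2 * (b1 + b3) - zc * (b0 + b2)"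
  "6 * vecof s b0 b1 b2 b3 $ 2 = 2 * s - zc * (b1 + b3) - zc^2 * (b0 + b2)"
  "2 * th * vecof s b0 b1 b2 b3 $ 3 = b0 - b2"
  "2 * th * vecof s b0 b1 b2 b3 $ 4 = b3 - b1"
proof -
  define h1 h2 where "h1 = (b1 + b3) / 2" and "h2 = (b0 + b2) / 2"
  have t: "3 * (a / 3) = a" for a :: "'k alg_closure" by simp
  have h: "2 * h1 = b1 + b3" "2 * h2 = b0 + b2" by (simp_all add: h1_def h2_def)
  have "3 * vecof s b0 b1 b2 b3 $ 0 = s - h1 - h2"
    "3 * vecof s b0 b1 b2 b3 $ Suc 0 = s - zc^2 * h1 - zc * h2"
    "3 * vecof s b0 b1 b2 b3 $ 2 = s - zc * h1 - zc^2 * h2"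
    unfolding vecof_index h1_def[symmetric] h2_def[symmetric] by (simp_all only: t)
  then show "6 * vecof s b0 b1 b2 b3 $ 0 = 2 * s - (b1 + b3) - (b0 + b2)"
    "6 * vecof s b0 b1 b2 b3 $ Suc 0 = 2 * s - zc^2 * (b1 + b3) - zc * (b0 + b2)"
    "6 * vecof s b0 b1 b2 b3 $ 2 = 2 * s - zc * (b1 + b3) - zc^2 * (b0 + b2)"
    using h by Groebner_Basis.algebra+
  have nz: "2 * th \<noteq> 0" using th2(2) by (metis mult_eq_0_iff zero_neq_numeral)
  show "2 * th * vecof s b0 b1 b2 b3 $ 3 = b0 - b2"
    "2 * th * vecof s b0 b1 b2 b3 $ 4 = b3 - b1"
    by (simp_all only: vecof_index times_divide_eq_right nonzero_mult_div_cancel_left[OF nz])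
qed

lemma lin_vecof:
  "lin cs (vecof s b0 b1 b2 b3) = s" "lin (cb 0) (vecof s b0 b1 b2 b3) = b0"
  "lin (cb (Suc 0)) (vecof s b0 b1 b2 b3) = b1" "lin (cb 2) (vecof s b0 b1 b2 b3) = b2"
  "lin (cb 3) (vecof s b0 b1 b2 b3) = b3"
proof -
  define v where "v = vecof s b0 b1 b2 b3"
  have v: "6 * v $ 0 = 2 * s - (b1 + b3) - (b0 + b2)"
    "6 * v $ 1 = 2 * s - zc^2 * (b1 + b3) - zc * (b0 + b2)"
    "6 * v $ 2 = 2 * s - zc * (b1 + b3) - zc^2 * (b0 + b2)"
    "2 * (th * v $ 3) = b0 - b2" "2 * (th * v $ 4) = b3 - b1"
    using vecof_eqs[of s b0 b1 b2 b3] unfolding v_def by (simp_all only: mult.assoc One_nat_def)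
  have "6 * lin cs v = 6 * s" "6 * lin (cb 0) v = 6 * b0"
    "6 * lin (cb (Suc 0)) v = 6 * b1" "6 * lin (cb 2) v = 6 * b2" "6 * lin (cb 3) v = 6 * b3"
    unfolding lin_simps using v K.z2 by Groebner_Basis.algebra+
  then show "lin cs v = s" "lin (cb 0) v = b0"
    "lin (cb (Suc 0)) v = b1" "lin (cb 2) v = b2" "lin (cb 3) v = b3" by simp_all
qed

lemma vecof_lin:
  assumes "v \<in> carrier_vec 5"
  shows "vecof (lin cs v) (lin (cb 0) v) (lin (cb (Suc 0)) v) (lin (cb 2) v) (lin (cb 3) v) = v"
    (is "?w = v")
proof (rule eq_vecI)
  have e: "6 * ?w $ 0 = 6 * v $ 0" "6 * ?w $ Suc 0 = 6 * v $ 1" "6 * ?w $ 2 = 6 * v $ 2"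
    "2 * th * ?w $ 3 = 2 * th * v $ 3" "2 * th * ?w $ 4 = 2 * th * v $ 4"
  proof -
    have "6 * ?w $ 0 = 2 * lin cs v - (lin (cb (Suc 0)) v + lin (cb 3) v) - (lin (cb 0) v + lin (cb 2) v)"
      "6 * ?w $ Suc 0 = 2 * lin cs v - zc^2 * (lin (cb (Suc 0)) v + lin (cb 3) v) - zc * (lin (cb 0) v + lin (cb 2) v)"
      "6 * ?w $ 2 = 2 * lin cs v - zc * (lin (cb (Suc 0)) v + lin (cb 3) v) - zc^2 * (lin (cb 0) v + lin (cb 2) v)"
      "2 * th * ?w $ 3 = lin (cb 0) v - lin (cb 2) v" "2 * th * ?w $ 4 = lin (cb 3) v - lin (cb (Suc 0)) v"
      by (rule vecof_eqs)+
    then show "6 * ?w $ 0 = 6 * v $ 0" "6 * ?w $ Suc 0 = 6 * v $ 1" "6 * ?w $ 2 = 6 * v $ 2"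
    "2 * th * ?w $ 3 = 2 * th * v $ 3" "2 * th * ?w $ 4 = 2 * th * v $ 4"
      unfolding lin_simps using K.z2 by Groebner_Basis.algebra+
  qed
  fix i assume "i < dim_vec v"
  then have "i = 0 \<or> i = 1 \<or> i = 2 \<or> i = 3 \<or> i = 4" using assms by auto
  then show "?w $ i = v $ i" using e th2 by auto
qed (use assms carrier_vecD[OF vecof_carrier] in auto)

lemma lin_smult: "v \<in> carrier_vec 5 \<Longrightarrow> lin c (a \<cdot>\<^sub>v v) = a * lin c v"
  unfolding lin_def sum_distrib_left by (rule sum.cong) auto

definition on_surface :: "'k alg_closure vec \<Rightarrow> bool" where
  "on_surface v \<longleftrightarrow>
     lin (cb 0) v * lin (cb 2) v = lin cs v * (lin (cb (Suc 0)) v + lin (cb 3) v) \<and>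
     lin (cb (Suc 0)) v * lin (cb 3) v = lin cs v * (lin (cb 0) v + lin (cb 2) v)"

text \<open>Put \<open>m = v $ 0 + zc^2 * v $ 1 + zc * v $ 2\<close>, and let \<open>m'\<close> have
  \<open>zc\<close> and \<open>zc^2\<close> exchanged. Three times the part of
  \<open>quadric1\<close> in the first three variables is \<open>m^2 + 2 * s * m'\<close>, where
  \<open>b1 + b3 = - 2 * m'\<close>. Because \<open>th^2 = - 3\<close>, adding
  \<open>3 * (v $ 3)^2\<close> to \<open>m^2\<close> gives a difference of squares, which factors as
  \<open>b0 * b2\<close>. The second quadric is treated alike.\<close>

lemma meval_quadrics:
  "meval (quadric1 z) x = 0 \<and> meval (quadric2 z) x = 0 \<longleftrightarrow> on_surface (x 0)"
proof -
  let ?v = "x 0"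
  have "3 * meval (quadric1 z) x =
      lin (cb 0) ?v * lin (cb 2) ?v - lin cs ?v * (lin (cb (Suc 0)) ?v + lin (cb 3) ?v)"
    "3 * meval (quadric2 z) x =
      lin (cb (Suc 0)) ?v * lin (cb 3) ?v - lin cs ?v * (lin (cb 0) ?v + lin (cb 2) ?v)"
    unfolding lin_simps quadric1_def quadric2_def meval_add meval_mult meval_power meval_mvar
      meval_mconst to_ac_power
    using K.z2 by Groebner_Basis.algebra+
  then show ?thesis unfolding on_surface_def
    by (metis eq_iff_diff_eq_0 mult_eq_0_iff zero_neq_numeral)
qed

lemma multihom_quadrics: "multihom [4] (\<lambda>j. if j = 0 then 2 else 0) (quadric1 z)"
  "multihom [4] (\<lambda>j. if j = 0 then 2 else 0) (quadric2 z)"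
proof -
  have 1: "multihom [4] (\<lambda>j. if j = 0 then 2 else 0) (mvar 0 i ^ 2 :: 'k mpol)" if "i \<le> 4" for i
    using multihom_power[OF multihom_mvar[of 0 "[4]" i], of 2] that by (simp add: if_distrib cong: if_cong)
  have 2: "multihom [4] (\<lambda>j. if j = 0 then 2 else 0) (mconst c * mvar 0 i ^ 2 :: 'k mpol)" if "i \<le> 4" for c i
    using multihom_mult[OF multihom_mconst 1[OF that], of c] by simp
  show "multihom [4] (\<lambda>j. if j = 0 then 2 else 0) (quadric1 z)"
    "multihom [4] (\<lambda>j. if j = 0 then 2 else 0) (quadric2 z)"
    unfolding quadric1_def quadric2_def by (intro multihom_add 1 2; simp)+
qed

lemma dP4_iff:
  assumes "p \<in> multiproj [4]" "x \<in> coords p"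
  shows "p \<in> dP4 z \<longleftrightarrow> on_surface (x 0)"
  using vanishes_at_iff[OF assms multihom_quadrics(1)] vanishes_at_iff[OF assms multihom_quadrics(2)]
    meval_quadrics[of x] assms(1)
  by (auto simp: dP4_def zero_locus_def)

lemma dP4_subset: "dP4 z \<subseteq> multiproj [4]"
  by (auto simp: dP4_def zero_locus_def)

lemma multiproj4E:
  assumes "p \<in> multiproj [n]"
  obtains v where "v \<in> carrier_vec (Suc n)" "v \<noteq> 0\<^sub>v (Suc n)" "p = [proj_point v]"
  using assms by (auto simp: multiproj_def list_all2_Cons2 proj_space_def)

lemma proj_point_in_dP4:
  assumes "v \<in> carrier_vec 5" "v \<noteq> 0\<^sub>v 5"
  shows "[proj_point v] \<in> dP4 z \<longleftrightarrow> on_surface v"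
proof -
  have "[proj_point v] \<in> multiproj [4]"
    using proj_point_in_space[of v 4] assms by (simp add: multiproj_def)
  moreover have "(\<lambda>_. v) \<in> coords [proj_point v]"
    by (simp add: coords_def proj_point_self)
  ultimately show ?thesis using dP4_iff by blast
qed

text \<open>An arbitrary list of further projective factors is allowed, so that one density lemma
  serves both the surface itself (generic freeness) and its product with a plane (the birational
  map).\<close>

definition surf_times :: "nat list \<Rightarrow> 'k mpoint set" where
  "surf_times ms = {q # p | q p. [q] \<in> dP4 z \<and> p \<in> multiproj ms}"

lemma multiproj_Cons: "q # p \<in> multiproj (n # ms) \<longleftrightarrow> q \<in> proj_space n \<and> p \<in> multiproj ms"
  by (simp add: multiproj_def)

lemma surf_times_subset: "surf_times ms \<subseteq> multiproj (4 # ms)"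
  using dP4_subset by (auto simp: surf_times_def multiproj_Cons multiproj_def)

lemma surf_times_iff:
  assumes "p \<in> multiproj (4 # ms)" "x \<in> coords p"
  shows "p \<in> surf_times ms \<longleftrightarrow> on_surface (x 0)"
proof -
  obtain q p' where p: "p = q # p'" "q \<in> proj_space 4" "p' \<in> multiproj ms"
    using assms(1) by (auto simp: multiproj_def list_all2_Cons2)
  have "[q] \<in> multiproj [4]" "(\<lambda>_. x 0) \<in> coords [q]"
    using p assms(2) by (auto simp: multiproj_def coords_def)
  from dP4_iff[OF this] show ?thesis using p by (auto simp: surf_times_def)
qed

text \<open>Surface points with \<open>s \<noteq> 0\<close> and \<open>b\<^sub>0 b\<^sub>1 \<noteq> s\<^sup>2\<close> are determined by \<open>s\<close>, \<open>b\<^sub>0\<close>, \<open>b\<^sub>1\<close>.\<close>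

definition in_chart :: "'k alg_closure vec \<Rightarrow> bool" where
  "in_chart v \<longleftrightarrow> lin cs v \<noteq> 0 \<and> lin (cb 0) v * lin (cb (Suc 0)) v \<noteq> (lin cs v)^2"

text \<open>Given \<open>s\<close>, \<open>b0\<close>, \<open>b1\<close>, the surface equations are
  linear in \<open>b2\<close>, \<open>b3\<close> with determinant \<open>d\<close>. This is Cramer's
  rule with the denominator cleared.\<close>

definition chart_par :: "(nat \<Rightarrow> 'k alg_closure) \<Rightarrow> 'k alg_closure vec" where
  "chart_par u = (let s = u 0; b0 = u 1; b1 = u 2; d = b0 * b1 - s^2 in
     vecof (s * d) (b0 * d) (b1 * d) (s * (s * b0 + b1^2)) (s * (s * b1 + b0^2)))"

lemma on_surface_chart_par: "on_surface (chart_par u)"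
  unfolding on_surface_def chart_par_def Let_def lin_vecof by (intro conjI; Groebner_Basis.algebra)

lemma chart_par_lin:
  assumes "v \<in> carrier_vec 5" "on_surface v" "in_chart v"
    and "u 0 = lin cs v" "u 1 = lin (cb 0) v" "u 2 = lin (cb (Suc 0)) v"
  shows "chart_par u = (u 1 * u 2 - (u 0)^2) \<cdot>\<^sub>v v" "u 1 * u 2 - (u 0)^2 \<noteq> 0" "u 0 \<noteq> 0"
proof -
  define d where "d = u 1 * u 2 - (u 0)^2"
  show "u 0 \<noteq> 0" "u 1 * u 2 - (u 0)^2 \<noteq> 0" using assms(3-) by (auto simp: in_chart_def)
  have e: "u 0 * (u 0 * u 1 + (u 2)^2) = d * lin (cb 2) v"
    "u 0 * (u 0 * u 2 + (u 1)^2) = d * lin (cb 3) v"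
    using assms(2) unfolding on_surface_def d_def assms(4-6) by Groebner_Basis.algebra+
  have "chart_par u = vecof (d * lin cs v) (d * lin (cb 0) v) (d * lin (cb (Suc 0)) v)
      (d * lin (cb 2) v) (d * lin (cb 3) v)"
    unfolding chart_par_def Let_def assms(4-6)[symmetric] d_def[symmetric] e
    by (simp only: mult.commute[of _ d])
  also have "\<dots> = d \<cdot>\<^sub>v v"
    using vecof_lin[of "d \<cdot>\<^sub>v v"] assms(1) by (simp add: lin_smult)
  finally show "chart_par u = (u 1 * u 2 - (u 0)^2) \<cdot>\<^sub>v v" by (simp add: d_def)
qed

lemma polyf_vecof:
  assumes "polyf s" "polyf b0" "polyf b1" "polyf b2" "polyf b3" "i \<le> 4"
  shows "polyf (\<lambda>u. vecof (s u) (b0 u) (b1 u) (b2 u) (b3 u) $ i)"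
proof -
  let ?v = "\<lambda>u. vecof (s u) (b0 u) (b1 u) (b2 u) (b3 u)"
  have "polyf (\<lambda>u. ?v u $ 0)" "polyf (\<lambda>u. ?v u $ Suc 0)" "polyf (\<lambda>u. ?v u $ 2)"
    "polyf (\<lambda>u. ?v u $ 3)" "polyf (\<lambda>u. ?v u $ 4)"
    unfolding vecof_index by (intro polyf_intros assms(1-5))+
  moreover have "i = 0 \<or> i = Suc 0 \<or> i = 2 \<or> i = 3 \<or> i = 4" using assms(6) by auto
  ultimately show ?thesis by auto
qed

text \<open>Parameters from index \<open>5\<close> on are the coordinates of the other factors.\<close>

definition full_par :: "nat list \<Rightarrow> 'k alg_closure vec \<Rightarrow> (nat \<Rightarrow> 'k alg_closure) \<Rightarrow> nat \<Rightarrow> 'k alg_closure vec" where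
  "full_par ms v u = (\<lambda>j. if j = 0 then v else vec (Suc (ms ! (j - 1))) (\<lambda>i. u (5 + prod_encode (j, i))))"

definition tail_of :: "(nat \<Rightarrow> 'k alg_closure vec) \<Rightarrow> nat \<Rightarrow> 'k alg_closure" where
  "tail_of x n = (let (j, i) = prod_decode (n - 5) in x j $ i)"

text \<open>\<open>l\<close> selects one coordinate in each further factor. The product of these
  coordinates is polynomial in \<open>u\<close>, and its nonvanishing keeps all their vectors
  nonzero.\<close>

lemma full_par_coords:
  assumes "v \<in> carrier_vec 5" "v \<noteq> 0\<^sub>v 5" "on_surface v"
    and l: "\<And>j. j < length ms \<Longrightarrow> l j \<le> ms ! j"
    and "(\<Prod>j<length ms. u (5 + prod_encode (Suc j, l j))) \<noteq> 0"
  shows "\<exists>p\<in>surf_times ms. full_par ms v u \<in> coords p"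
proof -
  let ?p = "map (\<lambda>j. proj_point (full_par ms v u j)) [0..<Suc (length ms)]"
  have "full_par ms v u (Suc j) \<noteq> 0\<^sub>v (Suc (ms ! j))" if "j < length ms" for j
  proof -
    have "full_par ms v u (Suc j) $ l j \<noteq> 0" using assms(5) l[OF that] that
      by (auto simp: full_par_def)
    then show ?thesis using l[OF that] by (metis index_zero_vec(1) less_Suc_eq_le)
  qed
  then have "proj_point (full_par ms v u (Suc j)) \<in> proj_space (ms ! j)" if "j < length ms" for j
    using that by (intro proj_point_in_space) (auto simp: full_par_def)
  moreover have "proj_point v \<in> proj_space 4" using assms(1,2) by (intro proj_point_in_space) auto
  ultimately have p: "?p \<in> multiproj (4 # ms)"
    unfolding multiproj_def list_all2_conv_all_nth
    by (auto simp: full_par_def nth_Cons nth_append less_Suc_eq_0_disj simp del: upt_Suc split: nat.splits)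
  have c: "full_par ms v u \<in> coords ?p"
    by (auto simp: coords_def proj_point_self simp del: upt_Suc)
  show ?thesis using surf_times_iff[OF p c] assms(3) c by (auto simp: full_par_def)
qed

lemma full_par_eq:
  assumes "p \<in> multiproj (4 # ms)" "x \<in> coords p" "c \<noteq> 0"
    and "\<And>n. 5 \<le> n \<Longrightarrow> u n = tail_of x n"
  shows "full_par ms (c \<cdot>\<^sub>v x 0) u \<in> coords p"
proof -
  have "full_par ms (c \<cdot>\<^sub>v x 0) u j \<in> p ! j" if j: "j < length p" for j
  proof (cases j)
    case 0
    have "p ! 0 = proj_point (x 0)" using coords_rep(3)[OF assms(1,2), of 0] by simp
    then show ?thesis unfolding 0 full_par_def using assms(3) by (auto simp: proj_point_def)
  next
    case (Suc j')
    have j': "j < length (4 # ms)" using j multiproj_nth(1)[OF assms(1)] by simp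
    have "full_par ms (c \<cdot>\<^sub>v x 0) u j = x j"
      using coords_rep(1)[OF assms(1,2) j'] assms(4)
      by (auto simp: Suc full_par_def tail_of_def vec_eq_iff)
    then show ?thesis using assms(2) j by (auto simp: coords_def)
  qed
  then show ?thesis by (auto simp: coords_def)
qed

lemma tail_of_nonzero:
  assumes "p \<in> multiproj (4 # ms)" "x \<in> coords p"
  shows "\<exists>l. (\<forall>j<length ms. l j \<le> ms ! j) \<and>
    (\<Prod>j<length ms. tail_of x (5 + prod_encode (Suc j, l j))) \<noteq> 0"
proof -
  have "\<forall>j. \<exists>i. j < length ms \<longrightarrow> i \<le> ms ! j \<and> x (Suc j) $ i \<noteq> 0"
    using coords_rep(1,2)[OF assms, of "Suc _"] vec_nonzero_index
    by (metis Suc_less_eq length_Cons less_Suc_eq_le nth_Cons_Suc)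
  then obtain l where "\<forall>j. j < length ms \<longrightarrow> l j \<le> ms ! j \<and> x (Suc j) $ l j \<noteq> 0" by metis
  then show ?thesis by (intro exI[of _ l]) (simp add: tail_of_def)
qed

end

section \<open>Polynomial functions on a biquadratic cover\<close>

definition indep34 :: "((nat \<Rightarrow> 'a) \<Rightarrow> 'b) \<Rightarrow> bool" where
  "indep34 f \<longleftrightarrow> (\<forall>w a b. f (w(3 := a, 4 := b)) = f w)"

text \<open>The coordinate ring of the biquadratic cover \<open>w\<^sub>3\<^sup>2 = q\<^sub>1\<close>, \<open>w\<^sub>4\<^sup>2 = q\<^sub>2\<close> is free on \<open>1, w\<^sub>3, w\<^sub>4, w\<^sub>3 w\<^sub>4\<close>.\<close>

definition decomposes ::
  "((nat \<Rightarrow> 'a::comm_ring_1) \<Rightarrow> 'a) \<Rightarrow> ((nat \<Rightarrow> 'a) \<Rightarrow> 'a) \<Rightarrow> ((nat \<Rightarrow> 'a) \<Rightarrow> 'a) \<Rightarrow> ((nat \<Rightarrow> 'a) \<Rightarrow> 'a) \<Rightarrow>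
   ((nat \<Rightarrow> 'a) \<Rightarrow> 'a) \<Rightarrow> ((nat \<Rightarrow> 'a) \<Rightarrow> 'a) \<Rightarrow> ((nat \<Rightarrow> 'a) \<Rightarrow> 'a) \<Rightarrow> bool"
where
  "decomposes q1 q2 F f0 f1 f2 f3 \<longleftrightarrow>
     (polyf f0 \<and> polyf f1 \<and> polyf f2 \<and> polyf f3) \<and>
     (indep34 f0 \<and> indep34 f1 \<and> indep34 f2 \<and> indep34 f3) \<and>
     (\<forall>w. (w 3)^2 = q1 w \<longrightarrow> (w 4)^2 = q2 w \<longrightarrow>
        F w = f0 w + f1 w * w 3 + f2 w * w 4 + f3 w * (w 3 * w 4))"

lemma decomposes_add:
  assumes "decomposes q1 q2 F f0 f1 f2 f3" "decomposes q1 q2 G g0 g1 g2 g3"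
  shows "decomposes q1 q2 (\<lambda>w. F w + G w) (\<lambda>w. f0 w + g0 w) (\<lambda>w. f1 w + g1 w)
    (\<lambda>w. f2 w + g2 w) (\<lambda>w. f3 w + g3 w)"
  using assms unfolding decomposes_def by (auto intro: polyf.add simp: indep34_def algebra_simps)

lemma decomposes_mult:
  assumes F: "decomposes q1 q2 F f0 f1 f2 f3" and G: "decomposes q1 q2 G g0 g1 g2 g3"
    and q: "polyf q1" "polyf q2" "indep34 q1" "indep34 q2"
  shows "decomposes q1 q2 (\<lambda>w. F w * G w)
    (\<lambda>w. f0 w * g0 w + f1 w * g1 w * q1 w + f2 w * g2 w * q2 w + f3 w * g3 w * (q1 w * q2 w))
    (\<lambda>w. f0 w * g1 w + f1 w * g0 w + (f2 w * g3 w + f3 w * g2 w) * q2 w)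
    (\<lambda>w. f0 w * g2 w + f2 w * g0 w + (f1 w * g3 w + f3 w * g1 w) * q1 w)
    (\<lambda>w. f0 w * g3 w + f3 w * g0 w + f1 w * g2 w + f2 w * g1 w)"
proof -
  have p: "polyf f0" "polyf f1" "polyf f2" "polyf f3" "polyf g0" "polyf g1" "polyf g2" "polyf g3"
    using F G by (auto simp: decomposes_def)
  have e: "F w * G w = (f0 w + f1 w * w 3 + f2 w * w 4 + f3 w * (w 3 * w 4)) *
      (g0 w + g1 w * w 3 + g2 w * w 4 + g3 w * (w 3 * w 4))"
    if "(w 3)^2 = q1 w" "(w 4)^2 = q2 w" for w
    using F G that unfolding decomposes_def by simp
  show ?thesis
    unfolding decomposes_def
  proof (intro conjI allI impI)
    fix w :: "nat \<Rightarrow> 'a" assume w: "(w 3)^2 = q1 w" "(w 4)^2 = q2 w"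
    show "F w * G w = f0 w * g0 w + f1 w * g1 w * q1 w + f2 w * g2 w * q2 w + f3 w * g3 w * (q1 w * q2 w) +
        (f0 w * g1 w + f1 w * g0 w + (f2 w * g3 w + f3 w * g2 w) * q2 w) * w 3 +
        (f0 w * g2 w + f2 w * g0 w + (f1 w * g3 w + f3 w * g1 w) * q1 w) * w 4 +
        (f0 w * g3 w + f3 w * g0 w + f1 w * g2 w + f2 w * g1 w) * (w 3 * w 4)"
      unfolding e[OF w] w[symmetric] by (simp only: algebra_simps power2_eq_square)
  qed ((intro polyf.add polyf.mult p q)+ | use F G q in \<open>simp add: decomposes_def indep34_def\<close>)+
qed

lemma polyf_decompose:
  assumes "polyf F" and q: "polyf q1" "polyf q2" "indep34 q1" "indep34 q2"
  shows "\<exists>f0 f1 f2 f3. decomposes q1 q2 F f0 f1 f2 f3"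
  using assms(1)
proof induction
  case (const c)
  have "decomposes q1 q2 (\<lambda>_. c) (\<lambda>_. c) (\<lambda>_. 0) (\<lambda>_. 0) (\<lambda>_. 0)"
    by (simp add: decomposes_def polyf.const indep34_def)
  then show ?case by blast
next
  case (var n)
  consider "n = 3" | "n = 4" | "n \<noteq> 3" "n \<noteq> 4" by blast
  then show ?case
  proof cases
    case 1
    have "decomposes q1 q2 (\<lambda>w. w n) (\<lambda>_. 0) (\<lambda>_. 1) (\<lambda>_. 0) (\<lambda>_. 0)"
      by (simp add: 1 decomposes_def polyf.const indep34_def)
    then show ?thesis by blast
  next
    case 2
    have "decomposes q1 q2 (\<lambda>w. w n) (\<lambda>_. 0) (\<lambda>_. 0) (\<lambda>_. 1) (\<lambda>_. 0)"
      by (simp add: 2 decomposes_def polyf.const indep34_def)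
    then show ?thesis by blast
  next
    case 3
    have "decomposes q1 q2 (\<lambda>w. w n) (\<lambda>w. w n) (\<lambda>_. 0) (\<lambda>_. 0) (\<lambda>_. 0)"
      by (simp add: 3 decomposes_def polyf.const polyf.var indep34_def)
    then show ?thesis by blast
  qed
next
  case (add F G)
  then show ?case using decomposes_add by blast
next
  case (mult F G)
  then obtain f0 f1 f2 f3 g0 g1 g2 g3
    where "decomposes q1 q2 F f0 f1 f2 f3" "decomposes q1 q2 G g0 g1 g2 g3" by blast
  from decomposes_mult[OF this q] show ?case by blast
qed

text \<open>\<open>H\<close> comes from the base of the cover, so freeness makes it a nonzerodivisor
  without any appeal to irreducibility. The four sign choices for the square roots separate the four
  components of \<open>F\<close>.\<close>

lemma polyf_zero_on_cover:
  fixes q1 q2 :: "(nat \<Rightarrow> 'a::{alg_closed_field, field_char_0}) \<Rightarrow> 'a"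
  assumes "polyf F" and q: "polyf q1" "polyf q2" "indep34 q1" "indep34 q2" "q1 u1 \<noteq> 0" "q2 u2 \<noteq> 0"
    and H: "polyf H" "indep34 H" "H u0 \<noteq> 0"
    and F: "\<And>w. (w 3)^2 = q1 w \<Longrightarrow> (w 4)^2 = q2 w \<Longrightarrow> H w \<noteq> 0 \<Longrightarrow> F w = 0"
    and w: "(w 3)^2 = q1 w" "(w 4)^2 = q2 w"
  shows "F w = 0"
proof -
  obtain f0 f1 f2 f3 where D: "decomposes q1 q2 F f0 f1 f2 f3"
    using polyf_decompose[OF assms(1) q(1-4)] by blast
  have p: "polyf f0" "polyf f1" "polyf f2" "polyf f3"
    and i: "indep34 f0" "indep34 f1" "indep34 f2" "indep34 f3"
    and e: "\<forall>w. (w 3)^2 = q1 w \<longrightarrow> (w 4)^2 = q2 w \<longrightarrow> F w = f0 w + f1 w * w 3 + f2 w * w 4 + f3 w * (w 3 * w 4)"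
    using D unfolding decomposes_def by blast+
  have z: "f0 u = 0 \<and> f1 u * q1 u = 0 \<and> f2 u * q2 u = 0 \<and> f3 u * (q1 u * q2 u) = 0" if u: "H u \<noteq> 0" for u
  proof -
    obtain a where a: "a^2 = q1 u" using nth_root_exists[of 2 "q1 u"] by auto
    obtain b where b: "b^2 = q2 u" using nth_root_exists[of 2 "q2 u"] by auto
    have s: "f0 u + f1 u * a' + f2 u * b' + f3 u * (a' * b') = 0" if "a'^2 = q1 u" "b'^2 = q2 u" for a' b'
      using F[of "u(3 := a', 4 := b')"] e[rule_format, of "u(3 := a', 4 := b')"] i q(3,4) H(2) u that
      unfolding indep34_def by simp
    have "4 * f0 u = 0" "4 * (f1 u * a) = 0" "4 * (f2 u * b) = 0" "4 * (f3 u * (a * b)) = 0"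
      using s[of a b] s[of "-a" b] s[of a "-b"] s[of "-a" "-b"] a b
      by (simp_all, Groebner_Basis.algebra+)
    \<comment> \<open>The roots \<open>a\<close>, \<open>b\<close> are not polynomial in
      \<open>u\<close>. Multiplying by them once more brings in \<open>q1\<close> and
      \<open>q2\<close>, which are polynomial and are cancelled afterwards.\<close>
    then show ?thesis unfolding a[symmetric] b[symmetric] by (simp add: power2_eq_square)
  qed
  have 0: "f0 u = 0" for u
    by (rule polyf_zero_product[OF p(1) H(1) _ H(3)]) (use z in auto)
  have 1: "f1 u * q1 u = 0" for u
    by (rule polyf_zero_product[OF polyf.mult[OF p(2) q(1)] H(1) _ H(3)]) (use z in auto)
  have 2: "f2 u * q2 u = 0" for u
    by (rule polyf_zero_product[OF polyf.mult[OF p(3) q(2)] H(1) _ H(3)]) (use z in auto)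
  have 3: "f3 u * (q1 u * q2 u) = 0" for u
    by (rule polyf_zero_product[OF polyf.mult[OF p(4) polyf.mult[OF q(1,2)]] H(1) _ H(3)]) (use z in auto)
  have "f1 u = 0" for u
    by (rule polyf_zero_product[OF p(2) q(1) _ q(5)]) (use 1 in auto)
  moreover have "f2 u = 0" for u
    by (rule polyf_zero_product[OF p(3) q(2) _ q(6)]) (use 2 in auto)
  moreover have 4: "f3 u * q1 u = 0" for u
    by (rule polyf_zero_product[OF polyf.mult[OF p(4) q(1)] q(2) _ q(6)]) (use 3 in auto)
  have "f3 u = 0" for u
    by (rule polyf_zero_product[OF p(4) q(1) _ q(5)]) (use 4 in auto)
  ultimately show ?thesis using e w 0 by simp
qed

context dp4
begin

lemma lin_zero: "lin c (0\<^sub>v 5) = 0"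
  by (simp add: lin_def)

text \<open>
  A form that vanishes on \<open>U\<close> vanishes on the chart \<open>in_chart\<close>, which \<open>chart_par\<close> parametrizes
  rationally.  The points outside the chart are reached through the coordinates \<open>w\<close>, in which the cone
  over the surface is the biquadratic cover \<open>w\<^sub>3\<^sup>2 = q\<^sub>1\<close>, \<open>w\<^sub>4\<^sup>2 = q\<^sub>2\<close> of affine \<open>3\<close>-space, and
  \<open>H \<noteq> 0\<close> puts a point of the cover into the chart.
\<close>

lemma dense_open_surf_times:
  assumes U: "open_in (4 # ms) (surf_times ms) U" and p0: "p0 \<in> U" "x0 \<in> coords p0" "in_chart (x0 0)"
  shows "dense_open (4 # ms) (surf_times ms) U"
  unfolding dense_open_def
proof (intro conjI allI impI)
  show "\<exists>Z. zariski_closed (4 # ms) Z \<and> U = surf_times ms - Z" using U by (simp add: open_in_def)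
  fix Z :: "'k mpoint set" assume Z: "zariski_closed (4 # ms) Z \<and> U \<subseteq> Z"
  then obtain G where G: "\<And>f. f \<in> G \<Longrightarrow> \<exists>d. multihom (4 # ms) d f" "Z = zero_locus (4 # ms) G"
    unfolding zariski_closed_def by blast
  have p0V: "p0 \<in> surf_times ms" using p0(1) U open_in_subset by blast
  then have p0m: "p0 \<in> multiproj (4 # ms)" using surf_times_subset by blast
  have x00: "x0 0 \<in> carrier_vec 5" using coords_rep(1)[OF p0m p0(2), of 0] by simp
  have polyf_full_par: "polyf (\<lambda>u. full_par ms (v u) u j $ i)"
    if "j < length (4 # ms)" "i \<le> (4 # ms) ! j" "\<And>i. i \<le> 4 \<Longrightarrow> polyf (\<lambda>u. v u $ i)"
    for v :: "(nat \<Rightarrow> 'k alg_closure) \<Rightarrow> 'k alg_closure vec" and j i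
    using that by (cases j) (auto simp: full_par_def polyf.var)
  show "surf_times ms \<subseteq> Z"
  proof
    fix p assume p: "p \<in> surf_times ms"
    have pm: "p \<in> multiproj (4 # ms)" using p surf_times_subset by blast
    obtain x where x: "x \<in> coords p" by (rule coords_nonempty[OF pm])
    have "vanishes_at f p" if f: "f \<in> G" for f
    proof -
      obtain d where d: "multihom (4 # ms) d f" using G(1) f by blast
      have van: "vanishes_at f q" if "q \<in> U" for q using Z G(2) f that by (auto simp: zero_locus_def)
      define t0 where "t0 = (\<lambda>y n. if n = 0 then lin cs (y 0) else if n = 1 then lin (cb 0) (y 0)
        else if n = 2 then lin (cb (Suc 0)) (y 0) else tail_of y n)"
      have t0: "full_par ms (chart_par (t0 y)) (t0 y) \<in> coords q" "t0 y 0 * (t0 y 1 * t0 y 2 - (t0 y 0)^2) \<noteq> 0"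
        if "q \<in> surf_times ms" "y \<in> coords q" "in_chart (y 0)" for q y
      proof -
        have qm: "q \<in> multiproj (4 # ms)" using that(1) surf_times_subset by blast
        have y: "y 0 \<in> carrier_vec 5" "on_surface (y 0)"
          using coords_rep(1)[OF qm that(2), of 0] surf_times_iff[OF qm that(2)] that(1) by auto
        have c: "chart_par (t0 y) = (t0 y 1 * t0 y 2 - (t0 y 0)^2) \<cdot>\<^sub>v y 0" "t0 y 1 * t0 y 2 - (t0 y 0)^2 \<noteq> 0"
          "t0 y 0 \<noteq> 0"
          by (rule chart_par_lin[OF y that(3)]; simp add: t0_def)+
        show "full_par ms (chart_par (t0 y)) (t0 y) \<in> coords q"
          unfolding c(1) by (rule full_par_eq[OF qm that(2) c(2)]) (simp add: t0_def)
        show "t0 y 0 * (t0 y 1 * t0 y 2 - (t0 y 0)^2) \<noteq> 0" using c by simp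
      qed
      obtain l where l: "\<forall>j<length ms. l j \<le> ms ! j"
        "(\<Prod>j<length ms. tail_of x0 (5 + prod_encode (Suc j, l j))) \<noteq> 0"
        using tail_of_nonzero[OF p0m p0(2)] by blast
      let ?e = "\<lambda>u::nat \<Rightarrow> 'k alg_closure. u 0 * (u 1 * u 2 - (u 0)^2) * (\<Prod>j<length ms. u (5 + prod_encode (Suc j, l j)))"
      have 1: "meval f (full_par ms (chart_par u) u) = 0" for u
      proof (rule vanishes_on_parametrization[OF U surf_times_subset d,
            where e = ?e and par = "\<lambda>u. full_par ms (chart_par u) u" and ?u0.0 = "t0 x0" and ?p0.0 = p0])
        show "vanishes_at f q" if "q \<in> U" for q by (rule van[OF that])
        show "polyf (\<lambda>u. full_par ms (chart_par u) u j $ i)" if "j < length (4 # ms)" "i \<le> (4 # ms) ! j" for j i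
          using that unfolding chart_par_def Let_def
          by (intro polyf_full_par polyf_vecof polyf_intros)
        show "polyf ?e" by (intro polyf_intros polyf_prod)
        show "p0 \<in> U" "full_par ms (chart_par (t0 x0)) (t0 x0) \<in> coords p0"
          using p0 t0(1)[OF p0V p0(2,3)] by auto
        show "?e (t0 x0) \<noteq> 0" using t0(2)[OF p0V p0(2,3)] l(2) by (simp add: t0_def)
        fix u :: "nat \<Rightarrow> 'k alg_closure" assume u: "?e u \<noteq> 0"
        have c: "chart_par u \<in> carrier_vec 5" by (simp add: chart_par_def Let_def)
        have "lin cs (chart_par u) = u 0 * (u 1 * u 2 - (u 0)^2)"
          by (simp add: chart_par_def Let_def lin_vecof)
        then have "chart_par u \<noteq> 0\<^sub>v 5" using u lin_zero by force
        then show "\<exists>p\<in>surf_times ms. full_par ms (chart_par u) u \<in> coords p"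
          using u by (intro full_par_coords[OF c _ on_surface_chart_par l(1)[rule_format]]) auto
      qed
      \<comment> \<open>On the chart, \<open>chart_par\<close> returns a nonzero multiple of the
        given coordinate vector, so vanishing along the parametrization reaches every point of the
        chart.\<close>
      have 2: "meval f y = 0" if "q \<in> surf_times ms" "y \<in> coords q" "in_chart (y 0)" for q y
      proof -
        have qm: "q \<in> multiproj (4 # ms)" using that(1) surf_times_subset by blast
        show ?thesis
          using 1[of "t0 y"] vanishes_at_iff[OF qm t0(1)[OF that] d] vanishes_at_iff[OF qm that(2) d] by simp
      qed
      obtain m where m: "\<forall>j<length ms. m j \<le> ms ! j"
        "(\<Prod>j<length ms. tail_of x (5 + prod_encode (Suc j, m j))) \<noteq> 0"
        using tail_of_nonzero[OF pm x] by blast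
      \<comment> \<open>With this substitution \<open>b0 b2 = w2^2 - w3^2\<close>,
        \<open>b1 b3 = w1^2 - w4^2\<close>, \<open>b1 + b3 = - 2 w1\<close> and
        \<open>b0 + b2 = - 2 w2\<close>, so the surface equations become \<open>w3^2 = q1\<close>
        and \<open>w4^2 = q2\<close>.\<close>
      define v where "v = (\<lambda>w::nat \<Rightarrow> 'k alg_closure. vecof (w 0) (w 3 - w 2) (- w 4 - w 1) (- w 3 - w 2) (w 4 - w 1))"
      define q1 q2 where "q1 = (\<lambda>w::nat \<Rightarrow> 'k alg_closure. 2 * (w 0 * w 1) + (w 2)^2)"
        and "q2 = (\<lambda>w::nat \<Rightarrow> 'k alg_closure. 2 * (w 0 * w 2) + (w 1)^2)"
      \<comment> \<open>On the surface with \<open>s \<noteq> 0\<close>, the excluded equality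
        \<open>b0 b1 = s^2\<close> entails \<open>w0^2 + 2 w1 w2 = - 2 w3 w4\<close>. Squaring gives
        an equation in \<open>w0\<close>, \<open>w1\<close>, \<open>w2\<close> alone, which the
        middle factor of \<open>H\<close> rules out.\<close>
      define H where "H = (\<lambda>w::nat \<Rightarrow> 'k alg_closure. w 0 * (((w 0)^2 + 2 * (w 1 * w 2))^2 - 4 * (q1 w * q2 w)) *
        (\<Prod>j<length ms. w (5 + prod_encode (Suc j, m j))))"
      define w where "w = (\<lambda>n. if n = 0 then lin cs (x 0)
        else if n = 1 then - (lin (cb (Suc 0)) (x 0) + lin (cb 3) (x 0)) / 2
        else if n = 2 then - (lin (cb 0) (x 0) + lin (cb 2) (x 0)) / 2
        else if n = 3 then (lin (cb 0) (x 0) - lin (cb 2) (x 0)) / 2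
        else if n = 4 then (lin (cb 3) (x 0) - lin (cb (Suc 0)) (x 0)) / 2 else tail_of x n)"
      have x0: "x 0 \<in> carrier_vec 5" "on_surface (x 0)"
          using coords_rep(1)[OF pm x, of 0] surf_times_iff[OF pm x] p by auto
      have w5: "w 0 = lin cs (x 0)" "2 * w 1 = - (lin (cb (Suc 0)) (x 0) + lin (cb 3) (x 0))"
        "2 * w 2 = - (lin (cb 0) (x 0) + lin (cb 2) (x 0))"
        "2 * w 3 = lin (cb 0) (x 0) - lin (cb 2) (x 0)"
        "2 * w 4 = lin (cb 3) (x 0) - lin (cb (Suc 0)) (x 0)"
        by (simp_all add: w_def)
      have wq: "(w 3)^2 = q1 w" "(w 4)^2 = q2 w"
      proof -
        have e: "lin (cb 0) (x 0) * lin (cb 2) (x 0) = w 0 * (- (2 * w 1))"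
          "lin (cb (Suc 0)) (x 0) * lin (cb 3) (x 0) = w 0 * (- (2 * w 2))"
          using x0(2) w5 unfolding on_surface_def by simp_all
        have "4 * (w 3)^2 = (2 * w 3)^2" "4 * (w 4)^2 = (2 * w 4)^2"
          "4 * q1 w = 4 * (w 0 * (2 * w 1)) + (2 * w 2)^2" "4 * q2 w = 4 * (w 0 * (2 * w 2)) + (2 * w 1)^2"
          unfolding q1_def q2_def by Groebner_Basis.algebra+
        then have "4 * (w 3)^2 = 4 * q1 w" "4 * (w 4)^2 = 4 * q2 w"
          using e w5(2-5) by Groebner_Basis.algebra+
        then show "(w 3)^2 = q1 w" "(w 4)^2 = q2 w" by simp_all
      qed
      have vw: "v w = x 0"
      proof -
        have "2 * (w 3 - w 2) = 2 * lin (cb 0) (x 0)" "2 * (- w 4 - w 1) = 2 * lin (cb (Suc 0)) (x 0)"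
          "2 * (- w 3 - w 2) = 2 * lin (cb 2) (x 0)" "2 * (w 4 - w 1) = 2 * lin (cb 3) (x 0)"
          by (simp_all only: right_diff_distrib mult_minus_right w5) simp_all
        then have "w 3 - w 2 = lin (cb 0) (x 0)" "- w 4 - w 1 = lin (cb (Suc 0)) (x 0)"
          "- w 3 - w 2 = lin (cb 2) (x 0)" "w 4 - w 1 = lin (cb 3) (x 0)"
          by (simp_all only: mult_cancel_left) simp_all
        then show ?thesis unfolding v_def w5(1) using vecof_lin[OF x0(1)] by (simp only:)
      qed
      have "meval f (full_par ms (v w) w) = 0"
      proof (rule polyf_zero_on_cover[where F = "\<lambda>w. meval f (full_par ms (v w) w)" and ?q1.0 = q1 and ?q2.0 = q2 and H = H
            and ?u1.0 = "\<lambda>_. 1" and ?u2.0 = "\<lambda>_. 1" and ?u0.0 = "\<lambda>n. if n = 1 \<or> n = 2 then 0 else 1"])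
        show "polyf (\<lambda>w. meval f (full_par ms (v w) w))"
          by (rule polyf_meval[OF d], rule polyf_full_par)
            (use polyf_vecof in \<open>auto simp: v_def intro!: polyf_vecof polyf_intros\<close>)
        show "polyf q1" "polyf q2" unfolding q1_def q2_def by (intro polyf_intros)+
        show "indep34 q1" "indep34 q2" by (simp_all add: q1_def q2_def indep34_def)
        show "q1 (\<lambda>_. 1) \<noteq> 0" "q2 (\<lambda>_. 1) \<noteq> 0" by (simp_all add: q1_def q2_def)
        show "polyf H" unfolding H_def q1_def q2_def by (intro polyf_intros polyf_prod)
        show "indep34 H" by (simp add: H_def q1_def q2_def indep34_def)
        show "H (\<lambda>n. if n = 1 \<or> n = 2 then 0 else 1) \<noteq> 0" by (simp add: H_def q1_def q2_def)
        show "(w 3)^2 = q1 w" "(w 4)^2 = q2 w" by (fact wq)+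
        fix u :: "nat \<Rightarrow> 'k alg_closure" assume u: "(u 3)^2 = q1 u" "(u 4)^2 = q2 u" "H u \<noteq> 0"
        have vu: "v u \<in> carrier_vec 5" by (simp add: v_def)
        have "lin cs (v u) = u 0" by (simp add: v_def lin_vecof)
        moreover have u0: "u 0 \<noteq> 0" using u(3) by (auto simp: H_def)
        ultimately have nz: "v u \<noteq> 0\<^sub>v 5" using lin_zero by force
        have on: "on_surface (v u)"
          unfolding on_surface_def v_def lin_vecof using u(1,2) unfolding q1_def q2_def
          by (intro conjI; Groebner_Basis.algebra)
        have "in_chart (v u)"
          unfolding in_chart_def v_def lin_vecof
        proof (intro conjI u0 notI)
          assume "(u 3 - u 2) * (- u 4 - u 1) = (u 0)^2"
          then have "(u 0)^2 * ((u 0)^2 + 2 * (u 1 * u 2) + 2 * (u 3 * u 4)) = 0"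
            using u(1,2) unfolding q1_def q2_def by Groebner_Basis.algebra
          then have "(u 0)^2 + 2 * (u 1 * u 2) = - 2 * (u 3 * u 4)" using u0 by (simp add: eq_neg_iff_add_eq_0)
          then have "((u 0)^2 + 2 * (u 1 * u 2))^2 - 4 * (q1 u * q2 u) = 0"
            unfolding u(1,2)[symmetric] by Groebner_Basis.algebra
          then show False using u(3) by (simp add: H_def)
        qed
        moreover have "\<exists>p\<in>surf_times ms. full_par ms (v u) u \<in> coords p"
          using u(3) by (intro full_par_coords[OF vu nz on m(1)[rule_format]]) (auto simp: H_def)
        ultimately show "meval f (full_par ms (v u) u) = 0" using 2 by (auto simp: full_par_def)
      qed
      moreover have "full_par ms (v w) w \<in> coords p"
        using full_par_eq[OF pm x, of 1 w] vw by (simp add: w_def)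
      ultimately show ?thesis using vanishes_at_iff[OF pm _ d] by blast
    qed
    then show "p \<in> Z" using pm G(2) by (simp add: zero_locus_def)
  qed
qed

end

section \<open>The domains, the two mutually inverse maps, and their equivariance\<close>

context cube_root
begin

text \<open>Every inequation has the shape expression \<open>\<noteq> 0\<close>, ready for
  \<open>open_in_regular_fun\<close>. The difference of cubes is the determinant of the twist in
  \<open>triangular_solve\<close>.\<close>

definition dom_surf :: "'a \<Rightarrow> 'a \<Rightarrow> 'a \<Rightarrow> 'a \<Rightarrow> 'a \<Rightarrow> 'a \<Rightarrow> bool" where
  "dom_surf b0 b1 b2 b3 r1 r2 \<longleftrightarrow>
     b0 * b2 = b1 + b3 \<and> b1 * b3 = b0 + b2 \<and>
     (b0 + b2)^3 - (b1 + b3)^3 \<noteq> 0 \<and> kappa z (b0 + b2) (b1 + b3) r1 r2 \<noteq> 0 \<and> 1 - r1 * r2 \<noteq> 0 \<and>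
     coef z 0 (sect z b0 b1 b2 b3 r1 r2) \<noteq> 0 \<and> coef z 0 (sect z b1 b2 b3 b0 r2 r1) \<noteq> 0 \<and>
     coef z 0 (sect z b2 b3 b0 b1 r1 r2) \<noteq> 0 \<and> coef z 0 (sect z b3 b0 b1 b2 r2 r1) \<noteq> 0 \<and>
     1 - fib_coord b0 b1 b2 b3 r1 r2 * fib_coord b1 b2 b3 b0 r2 r1 *
       fib_coord b2 b3 b0 b1 r1 r2 * fib_coord b3 b0 b1 b2 r2 r1 \<noteq> 0"

definition lin_quot :: "'a \<Rightarrow> 'a \<Rightarrow> 'a \<Rightarrow> 'a \<Rightarrow> 'a \<Rightarrow> 'a" where
  "lin_quot u0 u1 u2 u3 =
     fib_quot (surf_coord u0 u1 u2 u3) (surf_coord u1 u2 u3 u0) (surf_coord u2 u3 u0 u1)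
       (surf_coord u3 u0 u1 u2) u0 (solve_r u0 u1 u2 u3)"

definition dom_lin :: "'a \<Rightarrow> 'a \<Rightarrow> 'a \<Rightarrow> 'a \<Rightarrow> bool" where
  "dom_lin u0 u1 u2 u3 \<longleftrightarrow>
     1 - u0 * u1 * u2 * u3 \<noteq> 0 \<and>
     pair_norm u0 u1 u2 u3 \<noteq> 0 \<and> pair_norm u1 u2 u3 u0 \<noteq> 0 \<and>
     pair_norm u2 u3 u0 u1 \<noteq> 0 \<and> pair_norm u3 u0 u1 u2 \<noteq> 0 \<and>
     (let b0 = surf_coord u0 u1 u2 u3; b1 = surf_coord u1 u2 u3 u0; b2 = surf_coord u2 u3 u0 u1;
          b3 = surf_coord u3 u0 u1 u2; y = lin_quot u0 u1 u2 u3 in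
        (b0 + b2)^3 - (b1 + b3)^3 \<noteq> 0 \<and>
        base_sect z b0 b1 b2 b3 1 \<noteq> 0 \<and> base_sect z b0 b1 b2 b3 z \<noteq> 0 \<and> base_sect z b0 b1 b2 b3 (z^2) \<noteq> 0 \<and>
        coef z 0 y \<noteq> 0 \<and> (coef z 0 y)^2 - coef z 1 y * coef z 2 y \<noteq> 0 \<and>
        kappa z (b0 + b2) (b1 + b3) (rho1 y) (rho2 y) \<noteq> 0 \<and> 1 - rho1 y * rho2 y \<noteq> 0)"

lemma dom_surf_shift:
  assumes "dom_surf b0 b1 b2 b3 r1 r2" shows "dom_surf b1 b2 b3 b0 r2 r1"
proof -
  have "(b1 + b3)^3 - (b2 + b0)^3 = - ((b0 + b2)^3 - (b1 + b3)^3)" by (simp add: add.commute)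
  moreover have "kappa z (b1 + b3) (b2 + b0) r2 r1 = kappa z (b0 + b2) (b1 + b3) r1 r2"
    using kappa_swap by (simp add: add.commute)
  ultimately show ?thesis using assms unfolding dom_surf_def by (auto simp: ac_simps)
qed

theorem lin_of_surf:
  assumes "dom_surf b0 b1 b2 b3 r1 r2"
  defines "u0 \<equiv> fib_coord b0 b1 b2 b3 r1 r2" and "u1 \<equiv> fib_coord b1 b2 b3 b0 r2 r1"
    and "u2 \<equiv> fib_coord b2 b3 b0 b1 r1 r2" and "u3 \<equiv> fib_coord b3 b0 b1 b2 r2 r1"
  shows "dom_lin u0 u1 u2 u3"
    "surf_coord u0 u1 u2 u3 = b0" "surf_coord u1 u2 u3 u0 = b1"
    "surf_coord u2 u3 u0 u1 = b2" "surf_coord u3 u0 u1 u2 = b3"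
    "rho1 (lin_quot u0 u1 u2 u3) = r1" "rho2 (lin_quot u0 u1 u2 u3) = r2"
proof -
  \<comment> \<open>It suffices to treat index 0 for arbitrary arguments;
    \<open>dom_surf_shift\<close> yields the other three by rotation.\<close>
  have main: "1 - u0 * u1 * u2 * u3 \<noteq> 0 \<and> pair_norm u0 u1 u2 u3 \<noteq> 0 \<and> surf_coord u0 u1 u2 u3 = b0"
    if d: "dom_surf b0 b1 b2 b3 r1 r2"
      and u: "u0 = fib_coord b0 b1 b2 b3 r1 r2" "u1 = fib_coord b1 b2 b3 b0 r2 r1"
        "u2 = fib_coord b2 b3 b0 b1 r1 r2" "u3 = fib_coord b3 b0 b1 b2 r2 r1"
    for b0 b1 b2 b3 r1 r2 u0 u1 u2 u3
    using d surf_coord_fib_coord[of b0 b2 b1 b3 r1 r2] unfolding dom_surf_def u by auto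
  note d0 = assms(1)
  note d1 = dom_surf_shift[OF d0] note d2 = dom_surf_shift[OF d1] note d3 = dom_surf_shift[OF d2]
  show b: "surf_coord u0 u1 u2 u3 = b0" "surf_coord u1 u2 u3 u0 = b1"
    "surf_coord u2 u3 u0 u1 = b2" "surf_coord u3 u0 u1 u2 = b3"
    unfolding u0_def u1_def u2_def u3_def
    using main[OF d0 refl refl refl refl] main[OF d1 refl refl refl refl]
      main[OF d2 refl refl refl refl] main[OF d3 refl refl refl refl] by auto
  have n: "1 - u0 * u1 * u2 * u3 \<noteq> 0"
    "pair_norm u0 u1 u2 u3 \<noteq> 0" "pair_norm u1 u2 u3 u0 \<noteq> 0"
    "pair_norm u2 u3 u0 u1 \<noteq> 0" "pair_norm u3 u0 u1 u2 \<noteq> 0"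
    unfolding u0_def u1_def u2_def u3_def
    using main[OF d0 refl refl refl refl] main[OF d1 refl refl refl refl]
      main[OF d2 refl refl refl refl] main[OF d3 refl refl refl refl] by auto
  let ?a = "coef z 0 (sect z b0 b1 b2 b3 r1 r2)"
  have rel: "b0 * b2 = b1 + b3" "b1 * b3 = b0 + b2" and k: "kappa z (b0 + b2) (b1 + b3) r1 r2 \<noteq> 0"
    and a: "?a \<noteq> 0" and r: "r1 * r2 \<noteq> 1" and t: "(b0 + b2)^3 - (b1 + b3)^3 \<noteq> 0"
    using d0 unfolding dom_surf_def by auto
  have nz: "coef z 0 (sect z b0 b1 b2 b3 r1 r2) \<noteq> 0" "coef z 0 (sect z b1 b2 b3 b0 r2 r1) \<noteq> 0"
      "coef z 0 (sect z b2 b3 b0 b1 r1 r2) \<noteq> 0" "coef z 0 (sect z b3 b0 b1 b2 r2 r1) \<noteq> 0"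
    using d0 unfolding dom_surf_def by auto
  have D: "u0 * u1 * u2 * u3 \<noteq> 1" using n(1) by auto
  let ?y = "lin_quot u0 u1 u2 u3"
  have bs: "base_sect z b0 b1 b2 b3 w \<noteq> 0" if "w^3 = 1" for w
    by (rule base_factors_nonzero(2)[OF k that rel])
  have r13: "r1^3 \<noteq> 1" using base_factors_nonzero(3)[OF k _ rel, of 1] by simp
  \<comment> \<open>The normalised factor is \<open>A0\<close> divided by its leading coefficient,
    so dividing by \<open>base_sect\<close> leaves only the fibre factor over that
    coefficient.\<close>
  have y: "?y w = 1 / ?a * ((1 - w^2 * r2) * (1 + w * r1 + w^2 * r1^2))" if w: "w^3 = 1" for w
  proof -
    have "sect z b0 b1 b2 b3 r1 r2 w = ?a * (1 + w * u0 + w^2 * solve_r u0 u1 u2 u3)"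
      using coef_expand[OF w, of "sect z b0 b1 b2 b3 r1 r2"] a
        fib_coord_solve_r[OF rel nz] D
      unfolding u0_def u1_def u2_def u3_def by (simp add: fib_coord_def algebra_simps)
    then have "1 + w * u0 + w^2 * solve_r u0 u1 u2 u3 = sect z b0 b1 b2 b3 r1 r2 w / ?a"
      using a by simp
    then show ?thesis using bs[OF w] unfolding lin_quot_def b fib_quot_def sect_def by simp
  qed
  have "1 / ?a \<noteq> 0" using a by simp
  note rho = rho_fib_quot[OF y this r r13]
  show "rho1 ?y = r1" "rho2 ?y = r2" using rho(3,4) by simp_all
  show "dom_lin u0 u1 u2 u3"
    unfolding dom_lin_def Let_def b rho using n t k r bs z3 z_powers rho by simp
qed

text \<open>\<open>fib_quot_sect\<close> identifies \<open>A0\<close> with the normalised factor of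
  \<open>u0\<close> up to a scalar; three applications of \<open>sect_proportional_step\<close> do
  the same for the rest of the cycle.\<close>

theorem surf_of_lin:
  assumes "dom_lin u0 u1 u2 u3"
  defines "b0 \<equiv> surf_coord u0 u1 u2 u3" and "b1 \<equiv> surf_coord u1 u2 u3 u0"
    and "b2 \<equiv> surf_coord u2 u3 u0 u1" and "b3 \<equiv> surf_coord u3 u0 u1 u2"
    and "r1 \<equiv> rho1 (lin_quot u0 u1 u2 u3)" and "r2 \<equiv> rho2 (lin_quot u0 u1 u2 u3)"
  shows "dom_surf b0 b1 b2 b3 r1 r2"
    "fib_coord b0 b1 b2 b3 r1 r2 = u0" "fib_coord b1 b2 b3 b0 r2 r1 = u1"
    "fib_coord b2 b3 b0 b1 r1 r2 = u2" "fib_coord b3 b0 b1 b2 r2 r1 = u3"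
proof -
  let ?y = "lin_quot u0 u1 u2 u3"
  have d: "u0 * u1 * u2 * u3 \<noteq> 1"
     "pair_norm u0 u1 u2 u3 \<noteq> 0" "pair_norm u1 u2 u3 u0 \<noteq> 0"
     "pair_norm u2 u3 u0 u1 \<noteq> 0" "pair_norm u3 u0 u1 u2 \<noteq> 0"
    and t: "(b0 + b2)^3 - (b1 + b3)^3 \<noteq> 0"
    and bs: "base_sect z b0 b1 b2 b3 1 \<noteq> 0" "base_sect z b0 b1 b2 b3 z \<noteq> 0" "base_sect z b0 b1 b2 b3 (z^2) \<noteq> 0"
    and y: "coef z 0 ?y \<noteq> 0" "(coef z 0 ?y)^2 - coef z 1 ?y * coef z 2 ?y \<noteq> 0"
    and k: "kappa z (b0 + b2) (b1 + b3) r1 r2 \<noteq> 0" and r: "1 - r1 * r2 \<noteq> 0"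
    using assms(1) unfolding dom_lin_def Let_def b0_def b1_def b2_def b3_def r1_def r2_def by auto
  have d': "u1 * u2 * u3 * u0 \<noteq> 1" "u2 * u3 * u0 * u1 \<noteq> 1" "u3 * u0 * u1 * u2 \<noteq> 1"
    using d(1) by (simp_all add: mult_ac)
  have rel: "b0 * b2 = b1 + b3" "b1 * b3 = b0 + b2"
    unfolding b0_def b1_def b2_def b3_def by (rule surf_coord_relation[OF d])+
  have rel': "b1 * b3 = b2 + b0" "b2 * b0 = b1 + b3" "b2 * b0 = b3 + b1" "b3 * b1 = b2 + b0"
    using rel by (simp_all add: ac_simps)
  have r13: "(rho1 ?y)^3 \<noteq> 1"
    using base_factors_nonzero(3)[OF k _ rel, of 1] unfolding r1_def by simp
  obtain c where c: "c \<noteq> 0"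
    "\<And>w. w^3 = 1 \<Longrightarrow> (1 - w^2 * rho2 ?y) * (1 + w * rho1 ?y + w^2 * (rho1 ?y)^2) = c * ?y w"
    using fib_quot_sect[OF y r13] by metis
  have s0: "sect z b0 b1 b2 b3 r1 r2 w = c * (1 + w * u0 + w^2 * solve_r u0 u1 u2 u3)"
    if w: "w^3 = 1" for w
  proof -
    have "base_sect z b0 b1 b2 b3 w \<noteq> 0" using w bs by (cases rule: cube_root_cases) auto
    then show ?thesis
      unfolding sect_def r1_def r2_def c(2)[OF w]
      by (simp add: lin_quot_def fib_quot_def flip: b0_def b1_def b2_def b3_def)
  qed
  have k': "kappa z (b1 + b3) (b2 + b0) r2 r1 \<noteq> 0" "kappa z (b2 + b0) (b3 + b1) r1 r2 \<noteq> 0"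
    using k kappa_swap by (simp_all add: add.commute)
  obtain c1 where s1: "c1 \<noteq> 0" "\<And>w. w^3 = 1 \<Longrightarrow>
      sect z b1 b2 b3 b0 r2 r1 w = c1 * (1 + w * u1 + w^2 * solve_r u1 u2 u3 u0)"
    using sect_proportional_step[OF d(1,2) rel b0_def[THEN meta_eq_to_obj_eq] k s0 c(1)] by metis
  obtain c2 where s2: "c2 \<noteq> 0" "\<And>w. w^3 = 1 \<Longrightarrow>
      sect z b2 b3 b0 b1 r1 r2 w = c2 * (1 + w * u2 + w^2 * solve_r u2 u3 u0 u1)"
    using sect_proportional_step[OF d'(1) d(3) rel'(1,2) b1_def[THEN meta_eq_to_obj_eq] k'(1) s1(2,1)] by metis
  obtain c3 where s3: "c3 \<noteq> 0" "\<And>w. w^3 = 1 \<Longrightarrow>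
      sect z b3 b0 b1 b2 r2 r1 w = c3 * (1 + w * u3 + w^2 * solve_r u3 u0 u1 u2)"
    using sect_proportional_step[OF d'(2) d(4) rel'(3,4) b2_def[THEN meta_eq_to_obj_eq] k'(2) s2(2,1)] by metis
  note f = fib_coord_eqI[OF s0 c(1)] fib_coord_eqI[OF s1(2,1)] fib_coord_eqI[OF s2(2,1)]
    fib_coord_eqI[OF s3(2,1)]
  show u: "fib_coord b0 b1 b2 b3 r1 r2 = u0" "fib_coord b1 b2 b3 b0 r2 r1 = u1"
    "fib_coord b2 b3 b0 b1 r1 r2 = u2" "fib_coord b3 b0 b1 b2 r2 r1 = u3"
    using f(2,4,6,8) by simp_all
  show "dom_surf b0 b1 b2 b3 r1 r2"
    unfolding dom_surf_def u using rel t k r f d(1) by simp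
qed

text \<open>Weighted homogeneity modulo 3: \<open>b0\<close>, \<open>b2\<close>, \<open>r1\<close>
  always occur with \<open>w\<close>, and \<open>b1\<close>, \<open>b3\<close>, \<open>r2\<close>
  with \<open>w^2\<close>. Rescaling them amounts to substituting \<open>w * x\<close> for
  \<open>w\<close>.\<close>

lemma sect_rotate:
  assumes x: "x^3 = 1" and w: "w^3 = 1"
  shows "sect z (x * b0) (x^2 * b1) (x * b2) (x^2 * b3) (x * r1) (x^2 * r2) w =
    sect z b0 b1 b2 b3 r1 r2 (w * x)"
proof -
  have "x^2 * x^2 = x" "x * x = x^2" using x by (Groebner_Basis.algebra, simp add: power2_eq_square)
  then have 1: "norm_factor (x * b0 + x * b2) (x^2 * b1 + x^2 * b3) (w * z) =
      norm_factor (b0 + b2) (b1 + b3) (w * x * z)"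
    unfolding norm_factor_def by (simp add: algebra_simps power_mult_distrib)
  show ?thesis
    unfolding sect_def base_sect_def 1 by (simp add: algebra_simps power_mult_distrib)
qed

lemma coef_rotate:
  assumes x: "x^3 = 1"
  shows "coef z 0 (\<lambda>w. h (w * x)) = coef z 0 h" "coef z 1 (\<lambda>w. h (w * x)) = x * coef z 1 h"
proof -
  have "h (w * x) = coef z 0 h + w * (x * coef z 1 h) + w^2 * (x^2 * coef z 2 h)" if w: "w^3 = 1" for w
  proof -
    have "(w * x)^3 = 1" using x w by (simp add: power_mult_distrib)
    from coef_expand[OF this, of h] show ?thesis by (simp add: power_mult_distrib mult.assoc)
  qed
  from coef_eqI[OF this]
  show "coef z 0 (\<lambda>w. h (w * x)) = coef z 0 h" "coef z 1 (\<lambda>w. h (w * x)) = x * coef z 1 h" by auto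
qed

lemma sect_coef_rotate:
  assumes x: "x^3 = 1"
  shows "coef z 0 (sect z (x * b0) (x^2 * b1) (x * b2) (x^2 * b3) (x * r1) (x^2 * r2)) =
      coef z 0 (sect z b0 b1 b2 b3 r1 r2)"
    "fib_coord (x * b0) (x^2 * b1) (x * b2) (x^2 * b3) (x * r1) (x^2 * r2) =
      x * fib_coord b0 b1 b2 b3 r1 r2"
proof -
  have c: "coef z m (sect z (x * b0) (x^2 * b1) (x * b2) (x^2 * b3) (x * r1) (x^2 * r2)) =
    coef z m (\<lambda>w. sect z b0 b1 b2 b3 r1 r2 (w * x))" for m
    by (rule coef_cong) (rule sect_rotate[OF x])
  show "coef z 0 (sect z (x * b0) (x^2 * b1) (x * b2) (x^2 * b3) (x * r1) (x^2 * r2)) =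
      coef z 0 (sect z b0 b1 b2 b3 r1 r2)"
    "fib_coord (x * b0) (x^2 * b1) (x * b2) (x^2 * b3) (x * r1) (x^2 * r2) =
      x * fib_coord b0 b1 b2 b3 r1 r2"
    unfolding fib_coord_def c coef_rotate[OF x] by simp_all
qed

text \<open>The second equation is \<open>sect_coef_rotate\<close> for the cube root
  \<open>z^2\<close>, whose square is \<open>z\<close>.\<close>

lemma fib_coord_rotate:
  "fib_coord (z * b0) (z^2 * b1) (z * b2) (z^2 * b3) (z * r1) (z^2 * r2) = z * fib_coord b0 b1 b2 b3 r1 r2"
  "fib_coord (z^2 * b1) (z * b2) (z^2 * b3) (z * b0) (z^2 * r2) (z * r1) = z^2 * fib_coord b1 b2 b3 b0 r2 r1"
  using sect_coef_rotate(2)[OF z3] sect_coef_rotate(2)[OF z_powers(5), unfolded z_powers] by auto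

lemma coef_sect_rotate:
  "coef z 0 (sect z (z * b0) (z^2 * b1) (z * b2) (z^2 * b3) (z * r1) (z^2 * r2)) =
    coef z 0 (sect z b0 b1 b2 b3 r1 r2)"
  "coef z 0 (sect z (z^2 * b1) (z * b2) (z^2 * b3) (z * b0) (z^2 * r2) (z * r1)) =
    coef z 0 (sect z b1 b2 b3 b0 r2 r1)"
  using sect_coef_rotate(1)[OF z3] sect_coef_rotate(1)[OF z_powers(5), unfolded z_powers] by auto

lemma dom_surf_rotate:
  assumes "dom_surf b0 b1 b2 b3 r1 r2"
  shows "dom_surf (z * b0) (z^2 * b1) (z * b2) (z^2 * b3) (z * r1) (z^2 * r2)"
proof -
  have rel: "b0 * b2 = b1 + b3" "b1 * b3 = b0 + b2" using assms by (auto simp: dom_surf_def)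
  have e1: "(z * b0) * (z * b2) = z^2 * b1 + z^2 * b3" "(z^2 * b1) * (z^2 * b3) = z * b0 + z * b2"
    using rel z3 by Groebner_Basis.algebra+
  have e2: "(z * b0 + z * b2)^3 - (z^2 * b1 + z^2 * b3)^3 = (b0 + b2)^3 - (b1 + b3)^3"
    by (simp add: z3 z_powers power_mult_distrib flip: distrib_left)
  have e3: "kappa z (z * b0 + z * b2) (z^2 * b1 + z^2 * b3) (z * r1) (z^2 * r2) =
      kappa z (b0 + b2) (b1 + b3) r1 r2"
    using kappa_rotate by (simp flip: distrib_left)
  have e4: "1 - (z * r1) * (z^2 * r2) = 1 - r1 * r2"
    using z_powers(3) by Groebner_Basis.algebra
  have e5: "1 - z * f0 * (z^2 * f1) * (z * f2) * (z^2 * f3) = 1 - f0 * f1 * f2 * f3" for f0 f1 f2 f3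
    using z_powers(3) by Groebner_Basis.algebra
  show ?thesis
    using assms e1 unfolding dom_surf_def coef_sect_rotate fib_coord_rotate e2 e3 e4 e5 by blast
qed

end

subsection \<open>The group\<close>

lemma carrier_C3_C4: "carrier C3_C4 = {0..<3} \<times> {0..<4}"
  by (simp add: C3_C4_def semidirect_product_def carrier_integer_mod_group)

lemma one_C3_C4: "\<one>\<^bsub>C3_C4\<^esub> = (0, 0)"
  by (simp add: C3_C4_def semidirect_product_def)

lemma mult_C3_C4:
  assumes "c \<in> {0..<3}"
  shows "(a, b) \<otimes>\<^bsub>C3_C4\<^esub> (c, d) = ((a + (if even b then c else - c)) mod 3, (b + d) mod 4)"
  using assms
  by (simp add: C3_C4_def semidirect_product_def inv_integer_mod_group carrier_integer_mod_group
      mod_add_right_eq mod_diff_right_eq)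

lemma group_C3_C4: "group C3_C4"
proof (rule groupI)
  fix x y assume "x \<in> carrier C3_C4" "y \<in> carrier C3_C4"
  then show "x \<otimes>\<^bsub>C3_C4\<^esub> y \<in> carrier C3_C4"
    by (cases x; cases y) (simp add: carrier_C3_C4 mult_C3_C4)
next
  show "\<one>\<^bsub>C3_C4\<^esub> \<in> carrier C3_C4" by (simp add: carrier_C3_C4 one_C3_C4)
next
  fix x y w assume "x \<in> carrier C3_C4" "y \<in> carrier C3_C4" "w \<in> carrier C3_C4"
  moreover obtain a b c d e f where "x = (a, b)" "y = (c, d)" "w = (e, f)"
    by (metis surj_pair)
  moreover have "even ((b + d) mod 4) \<longleftrightarrow> even (b + d)" for b d :: int by presburger
  ultimately show "x \<otimes>\<^bsub>C3_C4\<^esub> y \<otimes>\<^bsub>C3_C4\<^esub> w = x \<otimes>\<^bsub>C3_C4\<^esub> (y \<otimes>\<^bsub>C3_C4\<^esub> w)"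
    by (auto simp: carrier_C3_C4 mult_C3_C4 mod_simps algebra_simps)
next
  fix x assume "x \<in> carrier C3_C4"
  then show "\<one>\<^bsub>C3_C4\<^esub> \<otimes>\<^bsub>C3_C4\<^esub> x = x"
    by (cases x) (simp add: carrier_C3_C4 one_C3_C4 mult_C3_C4)
next
  fix x assume x: "x \<in> carrier C3_C4"
  then obtain a b where ab: "x = (a, b)" "a \<in> {0..<3}" "b \<in> {0..<4}" by (auto simp: carrier_C3_C4)
  let ?y = "((if even b then - a else a) mod 3, (- b) mod 4)"
  have "even ((- b) mod 4) \<longleftrightarrow> even b" by presburger
  then have "?y \<otimes>\<^bsub>C3_C4\<^esub> x = \<one>\<^bsub>C3_C4\<^esub>"
    using ab by (simp add: mult_C3_C4 one_C3_C4 mod_simps)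
  moreover have "?y \<in> carrier C3_C4" by (simp add: carrier_C3_C4)
  ultimately show "\<exists>y\<in>carrier C3_C4. y \<otimes>\<^bsub>C3_C4\<^esub> x = \<one>\<^bsub>C3_C4\<^esub>" by blast
qed

lemma (in monoid) nat_pow_mod:
  assumes "s \<in> carrier G" "s [^] k = \<one>"
  shows "s [^] (n mod k :: nat) = s [^] n"
proof -
  have "s [^] n = s [^] (n mod k + k * (n div k))" by simp
  also have "\<dots> = s [^] (n mod k) \<otimes> (s [^] k) [^] (n div k)"
    using assms(1) by (simp only: nat_pow_mult[symmetric] nat_pow_pow)
  also have "\<dots> = s [^] (n mod k)" using assms by simp
  finally show ?thesis by simp
qed

text \<open>Stated for monoids because it serves two targets: bijections of the surface and
  \<open>GL 5\<close>. The relation says that conjugation by \<open>t\<close> inverts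
  \<open>s\<close>, with \<open>s \<otimes> s\<close> in the role of the inverse.\<close>

lemma (in monoid) C3_C4_hom:
  assumes st: "s \<in> carrier G" "t \<in> carrier G" and s3: "s [^] (3::nat) = \<one>" and t4: "t [^] (4::nat) = \<one>"
    and ts: "t \<otimes> s = s \<otimes> s \<otimes> t"
  shows "(\<lambda>(a, b). s [^] nat a \<otimes> t [^] nat b) \<in> hom C3_C4 G"
proof -
  have 1: "t \<otimes> s [^] m = s [^] (2 * m) \<otimes> t" for m :: nat
  proof (induction m)
    case (Suc m)
    have "t \<otimes> s [^] Suc m = t \<otimes> s [^] m \<otimes> s" using st by (simp add: m_assoc)
    also have "\<dots> = s [^] (2 * m) \<otimes> (t \<otimes> s)" using st by (simp add: Suc m_assoc)
    also have "\<dots> = s [^] (2 * Suc m) \<otimes> t" unfolding ts using st by (simp add: m_assoc)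
    finally show ?case .
  qed (use st in simp)
  have 2: "t [^] n \<otimes> s [^] m = s [^] (if even n then m else 2 * m) \<otimes> t [^] n" for n m :: nat
  proof (induction n arbitrary: m)
    case (Suc n)
    have "t [^] Suc n \<otimes> s [^] m = t [^] n \<otimes> s [^] (2 * m) \<otimes> t"
      using st 1[of m] by (simp add: m_assoc)
    also have "\<dots> = s [^] (if even n then 2 * m else 4 * m) \<otimes> t [^] Suc n"
      using st by (simp add: Suc m_assoc)
    also have "s [^] (if even n then 2 * m else 4 * m) = s [^] (if even (Suc n) then m else 2 * m)"
      using nat_pow_mod[OF st(1) s3, of "4 * m"] nat_pow_mod[OF st(1) s3, of m]
      by (simp add: mod_mult_left_eq[of 4 3 m, symmetric])
    finally show ?case .
  qed (use st in simp)
  have "s [^] nat ((a + (if even b then c else - c)) mod 3) \<otimes> t [^] nat ((b + d) mod 4) =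
      s [^] nat a \<otimes> t [^] nat b \<otimes> (s [^] nat c \<otimes> t [^] nat d)"
    if nonneg: "0 \<le> a" "0 \<le> b" "0 \<le> c" "0 \<le> d" for a b c d :: int
  proof -
    obtain k l m n where e: "a = int k" "b = int l" "c = int m" "d = int n"
      using nonneg by (metis nonneg_int_cases)
    \<comment> \<open>Modulo 3, \<open>- m\<close> agrees with \<open>2 * m\<close>, which keeps the
      exponents natural numbers.\<close>
    have "(int k + (if even (int l) then int m else - int m)) mod 3 = int ((k + (if even l then m else 2 * m)) mod 3)"
      by (simp add: zmod_int) presburger
    then have e1: "nat ((a + (if even b then c else - c)) mod 3) = (k + (if even l then m else 2 * m)) mod 3"
      unfolding e by (simp only: nat_int)
    have e2: "nat ((b + d) mod 4) = (l + n) mod 4"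
      unfolding e by (simp add: nat_mod_distrib nat_int_add)
    have "s [^] nat ((a + (if even b then c else - c)) mod 3) \<otimes> t [^] nat ((b + d) mod 4) =
      s [^] (k + (if even l then m else 2 * m)) \<otimes> t [^] (l + n)"
      unfolding e1 e2 nat_pow_mod[OF st(1) s3] nat_pow_mod[OF st(2) t4] ..
    also have "\<dots> = s [^] k \<otimes> (s [^] (if even l then m else 2 * m) \<otimes> t [^] l) \<otimes> t [^] n"
      using st by (simp only: nat_pow_mult[symmetric] m_assoc nat_pow_closed m_closed)
    also have "\<dots> = s [^] k \<otimes> t [^] l \<otimes> (s [^] m \<otimes> t [^] n)"
      unfolding 2[symmetric] using st by (simp only: m_assoc nat_pow_closed m_closed)
    finally show ?thesis by (simp add: e)
  qed
  then show ?thesis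
    using st by (auto simp: hom_def carrier_C3_C4 mult_C3_C4)
qed

section \<open>Actions as homomorphisms into the group of bijections\<close>

lemma restrict_in_Bij:
  assumes "\<And>p. p \<in> V \<Longrightarrow> f p \<in> V" "\<And>p. p \<in> V \<Longrightarrow> g p \<in> V"
    "\<And>p. p \<in> V \<Longrightarrow> g (f p) = p" "\<And>p. p \<in> V \<Longrightarrow> f (g p) = p"
  shows "restrict f V \<in> Bij V"
proof -
  have "bij_betw f V V" by (rule bij_betw_byWitness[where f' = g]) (use assms in auto)
  then show ?thesis by (simp add: Bij_def bij_betw_restrict_eq)
qed

lemma BijGroup_mult_restrict:
  assumes "restrict f V \<in> Bij V" "restrict g V \<in> Bij V"
  shows "restrict f V \<otimes>\<^bsub>BijGroup V\<^esub> restrict g V = restrict (f \<circ> g) V"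
proof -
  have "g x \<in> V" if "x \<in> V" for x
    using funcset_mem[OF Bij_imp_funcset[OF assms(2)] that] that by simp
  then show ?thesis
    using assms by (auto simp: BijGroup_def compose_def restrict_def fun_eq_iff)
qed

lemma BijGroup_pow_restrict:
  assumes "restrict f V \<in> Bij V"
  shows "restrict f V [^]\<^bsub>BijGroup V\<^esub> (n::nat) = restrict (f ^^ n) V \<and> restrict (f ^^ n) V \<in> Bij V"
proof (induction n)
  case 0
  show ?case using id_Bij[of V] by (simp add: BijGroup_def id_def restrict_def)
next
  case (Suc n)
  interpret group "BijGroup V" by (rule group_BijGroup)
  have "restrict f V [^]\<^bsub>BijGroup V\<^esub> Suc n = restrict (f ^^ n \<circ> f) V"
    unfolding nat_pow_Suc conjunct1[OF Suc] by (rule BijGroup_mult_restrict[OF conjunct2[OF Suc] assms])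
  moreover have "restrict f V [^]\<^bsub>BijGroup V\<^esub> Suc n \<in> carrier (BijGroup V)"
    using assms by (intro nat_pow_closed) (simp add: BijGroup_def)
  moreover have "carrier (BijGroup V) = Bij V" by (simp add: BijGroup_def)
  ultimately show ?case by (simp only: funpow_Suc_right simp_thms)
qed

lemma group_action_C3_C4:
  assumes V: "\<And>p. p \<in> V \<Longrightarrow> s p \<in> V" "\<And>p. p \<in> V \<Longrightarrow> t p \<in> V"
    and s3: "\<And>p. p \<in> V \<Longrightarrow> s (s (s p)) = p" and t4: "\<And>p. p \<in> V \<Longrightarrow> t (t (t (t p))) = p"
    and ts: "\<And>p. p \<in> V \<Longrightarrow> t (s p) = s (s (t p))"
  shows "group_action C3_C4 V (\<lambda>(a, b). restrict ((s ^^ nat a) \<circ> (t ^^ nat b)) V)"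
proof -
  interpret group "BijGroup V" by (rule group_BijGroup)
  have s: "restrict s V \<in> Bij V" by (rule restrict_in_Bij[of V s "\<lambda>p. s (s p)"]) (use V s3 in auto)
  have t: "restrict t V \<in> Bij V" by (rule restrict_in_Bij[of V t "\<lambda>p. t (t (t p))"]) (use V t4 in auto)
  have c: "carrier (BijGroup V) = Bij V" and o: "\<one>\<^bsub>BijGroup V\<^esub> = restrict id V"
    by (simp_all add: BijGroup_def id_def)
  have "(\<lambda>(a, b). restrict s V [^]\<^bsub>BijGroup V\<^esub> nat a \<otimes>\<^bsub>BijGroup V\<^esub> restrict t V [^]\<^bsub>BijGroup V\<^esub> nat b)
      \<in> hom C3_C4 (BijGroup V)"
  proof (rule C3_C4_hom)
    have ss: "restrict s V \<otimes>\<^bsub>BijGroup V\<^esub> restrict s V = restrict (s \<circ> s) V"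
      by (rule BijGroup_mult_restrict[OF s s])
    have "restrict (s \<circ> s) V \<in> Bij V" using m_closed[of "restrict s V" "restrict s V"] s ss c by simp
    then show "restrict t V \<otimes>\<^bsub>BijGroup V\<^esub> restrict s V =
        restrict s V \<otimes>\<^bsub>BijGroup V\<^esub> restrict s V \<otimes>\<^bsub>BijGroup V\<^esub> restrict t V"
      unfolding ss using s t ts by (subst (1 2) BijGroup_mult_restrict) (auto simp: restrict_def fun_eq_iff)
    show "restrict s V [^]\<^bsub>BijGroup V\<^esub> (3::nat) = \<one>\<^bsub>BijGroup V\<^esub>"
      unfolding o conjunct1[OF BijGroup_pow_restrict[OF s]] using s3
      by (auto simp: restrict_def fun_eq_iff numeral_3_eq_3)
    show "restrict t V [^]\<^bsub>BijGroup V\<^esub> (4::nat) = \<one>\<^bsub>BijGroup V\<^esub>"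
      unfolding o conjunct1[OF BijGroup_pow_restrict[OF t]] using t4
      by (auto simp: restrict_def fun_eq_iff eval_nat_numeral)
  qed (use s t c in auto)
  also have "(\<lambda>(a, b). restrict s V [^]\<^bsub>BijGroup V\<^esub> nat a \<otimes>\<^bsub>BijGroup V\<^esub> restrict t V [^]\<^bsub>BijGroup V\<^esub> nat b) =
      (\<lambda>(a, b). restrict ((s ^^ nat a) \<circ> (t ^^ nat b)) V)"
  proof -
    have "restrict s V [^]\<^bsub>BijGroup V\<^esub> m \<otimes>\<^bsub>BijGroup V\<^esub> restrict t V [^]\<^bsub>BijGroup V\<^esub> n =
        restrict ((s ^^ m) \<circ> (t ^^ n)) V" for m n :: nat
      using BijGroup_pow_restrict[OF s, of m] BijGroup_pow_restrict[OF t, of n] BijGroup_mult_restrict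
      by metis
    then show ?thesis by auto
  qed
  finally show ?thesis
    unfolding group_action_def group_hom_def group_hom_axioms_def
    using group_C3_C4 group_BijGroup by blast
qed

lemma image_proj_point:
  assumes "\<And>c. f (c \<cdot>\<^sub>v v) = c \<cdot>\<^sub>v f v"
  shows "f ` proj_point v = proj_point (f v)"
proof -
  have "f ` proj_point v = {f (c \<cdot>\<^sub>v v) | c. c \<noteq> 0}" by (auto simp: proj_point_def)
  then show ?thesis unfolding assms proj_point_def .
qed

lemma map_image_comp: "map ((`) (f \<circ> g)) p = map ((`) f) (map ((`) g) p)"
  by (simp add: image_comp comp_def image_image)

lemma map_image_funpow:
  fixes f :: "'a \<Rightarrow> 'a"
  shows "map ((`) (f ^^ n)) p = (map ((`) f) ^^ n) p"
proof (induction n arbitrary: p)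
  case (Suc n)
  show ?case unfolding funpow_Suc_right map_image_comp Suc by simp
qed simp

subsection \<open>The action on the surface\<close>

context dp4
begin

lemma carrier_vec5_cases: "i < 5 \<Longrightarrow> i = 0 \<or> i = Suc 0 \<or> i = 2 \<or> i = 3 \<or> i = (4::nat)"
  by auto

lemma sigma_carrier [simp]: "lin_sigma z v \<in> carrier_vec 5"
  and tau_carrier [simp]: "lin_tau v \<in> carrier_vec 5"
  by (auto simp: lin_sigma_def lin_tau_def intro!: carrier_vecI)

lemma sigma_index:
  "lin_sigma z v $ 0 = v $ Suc 0" "lin_sigma z v $ Suc 0 = v $ 2" "lin_sigma z v $ 2 = v $ 0"
  "lin_sigma z v $ 3 = zc * v $ 3" "lin_sigma z v $ 4 = zc^2 * v $ 4"
  by (simp_all add: lin_sigma_def eval_nat_numeral)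

lemma tau_index:
  "lin_tau v $ 0 = v $ 0" "lin_tau v $ Suc 0 = v $ 2" "lin_tau v $ 2 = v $ Suc 0"
  "lin_tau v $ 3 = - v $ 4" "lin_tau v $ 4 = v $ 3"
  by (simp_all add: lin_tau_def eval_nat_numeral)

lemma vec5_eqI:
  fixes v w :: "'k alg_closure vec"
  assumes "v \<in> carrier_vec 5" "w \<in> carrier_vec 5"
    "v $ 0 = w $ 0" "v $ Suc 0 = w $ Suc 0" "v $ 2 = w $ 2" "v $ 3 = w $ 3" "v $ 4 = w $ 4"
  shows "v = w"
  using assms carrier_vec5_cases by (intro eq_vecI) auto

lemma sigma_tau_relations:
  assumes "v \<in> carrier_vec 5"
  shows "lin_sigma z (lin_sigma z (lin_sigma z v)) = v"
    "lin_tau (lin_tau (lin_tau (lin_tau v))) = v"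
    "lin_tau (lin_sigma z v) = lin_sigma z (lin_sigma z (lin_tau v))"
proof -
  have e: "zc * (zc * (zc * a)) = a" "zc^2 * (zc^2 * (zc^2 * a)) = a" "zc^2 * (zc^2 * a) = zc * a" for a
    using K.z2 by Groebner_Basis.algebra+
  have e': "zc * (zc * a) = zc^2 * a" for a by (simp add: power2_eq_square)
  have e'': "zc * (zc^2 * a) = a" for a using e(1)[of a] by (simp only: e')
  show "lin_sigma z (lin_sigma z (lin_sigma z v)) = v"
    "lin_tau (lin_tau (lin_tau (lin_tau v))) = v"
    "lin_tau (lin_sigma z v) = lin_sigma z (lin_sigma z (lin_tau v))"
    using assms by (auto intro!: vec5_eqI simp: sigma_index tau_index e' e'' K.z_powers)
qed

lemma sigma_smult: "v \<in> carrier_vec 5 \<Longrightarrow> lin_sigma z (c \<cdot>\<^sub>v v) = c \<cdot>\<^sub>v lin_sigma z v"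
  and tau_smult: "v \<in> carrier_vec 5 \<Longrightarrow> lin_tau (c \<cdot>\<^sub>v v) = c \<cdot>\<^sub>v lin_tau v"
  by (rule vec5_eqI;
      simp add: sigma_index tau_index carrier_vecD[OF sigma_carrier] carrier_vecD[OF tau_carrier])+

lemma lin_sigma_coords:
  "lin cs (lin_sigma z v) = lin cs v"
  "lin (cb 0) (lin_sigma z v) = zc * lin (cb 0) v"
  "lin (cb (Suc 0)) (lin_sigma z v) = zc^2 * lin (cb (Suc 0)) v"
  "lin (cb 2) (lin_sigma z v) = zc * lin (cb 2) v"
  "lin (cb 3) (lin_sigma z v) = zc^2 * lin (cb 3) v"
  unfolding lin_simps One_nat_def sigma_index using K.z2
  by (simp_all only: add_ac) (Groebner_Basis.algebra+)

lemma lin_tau_coords: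
  "lin cs (lin_tau v) = lin cs v"
  "lin (cb 0) (lin_tau v) = lin (cb (Suc 0)) v"
  "lin (cb (Suc 0)) (lin_tau v) = lin (cb 2) v"
  "lin (cb 2) (lin_tau v) = lin (cb 3) v"
  "lin (cb 3) (lin_tau v) = lin (cb 0) v"
  unfolding lin_simps One_nat_def tau_index by (simp_all add: algebra_simps)

lemma on_surface_sigma:
  assumes "on_surface v" shows "on_surface (lin_sigma z v)"
proof -
  have e: "zc * a * (zc * b) = zc^2 * (a * b)" "zc^2 * a * (zc^2 * b) = zc * (a * b)" for a b
    using K.z_powers(1) by (simp_all add: power2_eq_square eval_nat_numeral mult_ac)
  show ?thesis
    using assms unfolding on_surface_def lin_sigma_coords e by (simp add: distrib_left mult.left_commute)
qed

lemma on_surface_tau: "on_surface v \<Longrightarrow> on_surface (lin_tau v)"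
  unfolding on_surface_def lin_tau_coords by (auto simp: ac_simps)

abbreviation sP :: "'k mpoint \<Rightarrow> 'k mpoint" where "sP \<equiv> map ((`) (lin_sigma z))"
abbreviation tP :: "'k mpoint \<Rightarrow> 'k mpoint" where "tP \<equiv> map ((`) lin_tau)"

lemma sP_proj_point: "v \<in> carrier_vec 5 \<Longrightarrow> sP [proj_point v] = [proj_point (lin_sigma z v)]"
  and tP_proj_point: "v \<in> carrier_vec 5 \<Longrightarrow> tP [proj_point v] = [proj_point (lin_tau v)]"
  by (simp_all add: image_proj_point sigma_smult tau_smult)

lemma dP4E:
  assumes "p \<in> dP4 z"
  obtains v where "v \<in> carrier_vec 5" "v \<noteq> 0\<^sub>v 5" "on_surface v" "p = [proj_point v]"
proof -
  have "p \<in> multiproj [4]" using assms dP4_subset by blast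
  then obtain v where "v \<in> carrier_vec 5" "v \<noteq> 0\<^sub>v 5" "p = [proj_point v]"
    by (rule multiproj4E) (auto simp: eval_nat_numeral)
  then show thesis using that proj_point_in_dP4 assms by blast
qed

lemma sigma_nonzero: "v \<in> carrier_vec 5 \<Longrightarrow> v \<noteq> 0\<^sub>v 5 \<Longrightarrow> lin_sigma z v \<noteq> 0\<^sub>v 5"
  and tau_nonzero: "v \<in> carrier_vec 5 \<Longrightarrow> v \<noteq> 0\<^sub>v 5 \<Longrightarrow> lin_tau v \<noteq> 0\<^sub>v 5"
proof -
  have "lin_sigma z (0\<^sub>v 5) = 0\<^sub>v 5" "lin_tau (0\<^sub>v 5) = (0\<^sub>v 5 :: 'k alg_closure vec)"
    by (auto intro!: vec5_eqI simp: sigma_index tau_index)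
  then show "v \<in> carrier_vec 5 \<Longrightarrow> v \<noteq> 0\<^sub>v 5 \<Longrightarrow> lin_sigma z v \<noteq> 0\<^sub>v 5"
    "v \<in> carrier_vec 5 \<Longrightarrow> v \<noteq> 0\<^sub>v 5 \<Longrightarrow> lin_tau v \<noteq> 0\<^sub>v 5"
    using sigma_tau_relations[of v] by metis+
qed

lemma sP_dP4: "p \<in> dP4 z \<Longrightarrow> sP p \<in> dP4 z"
  by (elim dP4E) (simp add: sP_proj_point proj_point_in_dP4 sigma_nonzero on_surface_sigma del: list.map)

lemma tP_dP4: "p \<in> dP4 z \<Longrightarrow> tP p \<in> dP4 z"
  by (elim dP4E) (simp add: tP_proj_point proj_point_in_dP4 tau_nonzero on_surface_tau del: list.map)

lemma dP4_action_eq: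
  "dP4_action z = (\<lambda>(a, b). restrict ((sP ^^ nat a) \<circ> (tP ^^ nat b)) (dP4 z))"
proof -
  have "map ((`) ((lin_sigma z ^^ a) \<circ> (lin_tau ^^ b))) = (sP ^^ a) \<circ> (tP ^^ b)" for a b
  proof
    show "map ((`) ((lin_sigma z ^^ a) \<circ> (lin_tau ^^ b))) p = ((sP ^^ a) \<circ> (tP ^^ b)) p" for p
      unfolding map_image_comp map_image_funpow by simp
  qed
  then show ?thesis unfolding dP4_action_def by simp
qed

lemma group_action_dP4: "group_action C3_C4 (dP4 z) (dP4_action z)"
  unfolding dP4_action_eq
proof (rule group_action_C3_C4)
  fix p assume p: "p \<in> dP4 z"
  show "sP p \<in> dP4 z" "tP p \<in> dP4 z" using p sP_dP4 tP_dP4 by blast+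
  obtain v where v: "v \<in> carrier_vec 5" "p = [proj_point v]" using p dP4E by metis
  show "sP (sP (sP p)) = p" "tP (tP (tP (tP p))) = p" "tP (sP p) = sP (sP (tP p))"
    unfolding v by (simp_all add: sP_proj_point tP_proj_point sigma_tau_relations v del: list.map)
qed

text \<open>Linear maps over the ground field, recorded by their coordinate forms, the data that
  \<open>regular_map\<close> asks for.\<close>

definition klinear :: "('k alg_closure vec \<Rightarrow> 'k alg_closure vec) \<Rightarrow> bool" where
  "klinear f \<longleftrightarrow> (\<exists>F. (\<forall>i\<le>4. multihom [4] (\<lambda>j. if j = 0 then 1 else 0) (F i)) \<and>
     (\<forall>x. x 0 \<in> carrier_vec 5 \<longrightarrow> f (x 0) = vec 5 (\<lambda>i. meval (F i) x)))"

lemma klinear_id: "klinear id"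
  unfolding klinear_def
  by (intro exI[of _ "\<lambda>i. mvar 0 i"] conjI allI impI multihom_mvar) (auto simp: vec_eq_iff)

lemma multihom_cmult:
  "multihom ns d f \<Longrightarrow> multihom ns d (mconst c * f)"
  using multihom_mult[OF multihom_mconst, of ns d f c] by simp

lemma klinear_sigma:
  assumes "klinear f" shows "klinear (lin_sigma z \<circ> f)"
proof -
  obtain F where F: "\<forall>i\<le>4. multihom [4] (\<lambda>j. if j = 0 then 1 else 0) (F i)"
    "\<forall>x. x 0 \<in> carrier_vec 5 \<longrightarrow> f (x 0) = vec 5 (\<lambda>i. meval (F i) x)"
    using assms unfolding klinear_def by blast
  let ?G = "\<lambda>i::nat. if i = 0 then F 1 else if i = 1 then F 2 else if i = 2 then F 0
    else if i = 3 then mconst z * F 3 else mconst (z^2) * F 4"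
  have "multihom [4] (\<lambda>j. if j = 0 then 1 else 0) (?G i)" if "i \<le> 4" for i
    using F(1) by (auto intro!: multihom_cmult)
  moreover have "(lin_sigma z \<circ> f) (x 0) = vec 5 (\<lambda>i. meval (?G i) x)" if "x 0 \<in> carrier_vec 5" for x
    using F(2)[rule_format, of x] that by (intro vec5_eqI) (simp_all add: sigma_index meval_mult)
  ultimately show ?thesis
    unfolding klinear_def by (intro exI[of _ ?G] conjI allI impI) blast+
qed

lemma klinear_tau:
  assumes "klinear f" shows "klinear (lin_tau \<circ> f)"
proof -
  obtain F where F: "\<forall>i\<le>4. multihom [4] (\<lambda>j. if j = 0 then 1 else 0) (F i)"
    "\<forall>x. x 0 \<in> carrier_vec 5 \<longrightarrow> f (x 0) = vec 5 (\<lambda>i. meval (F i) x)"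
    using assms unfolding klinear_def by blast
  let ?G = "\<lambda>i::nat. if i = 0 then F 0 else if i = 1 then F 2 else if i = 2 then F 1
    else if i = 3 then mconst (-1) * F 4 else F 3"
  have "multihom [4] (\<lambda>j. if j = 0 then 1 else 0) (?G i)" if "i \<le> 4" for i
    using F(1) by (auto intro!: multihom_cmult)
  moreover have "(lin_tau \<circ> f) (x 0) = vec 5 (\<lambda>i. meval (?G i) x)" if "x 0 \<in> carrier_vec 5" for x
    using F(2)[rule_format, of x] that by (intro vec5_eqI) (simp_all add: tau_index meval_mult)
  ultimately show ?thesis
    unfolding klinear_def by (intro exI[of _ ?G] conjI allI impI) blast+
qed

lemma klinear_word: "klinear ((lin_sigma z ^^ a) \<circ> (lin_tau ^^ b))"
proof -
  have t: "klinear (lin_tau ^^ b)"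
  proof (induction b)
    case (Suc b)
    show ?case using klinear_tau[OF Suc] by (simp add: comp_def)
  qed (use klinear_id in \<open>simp add: id_def\<close>)
  show ?thesis
  proof (induction a)
    case (Suc a)
    show ?case using klinear_sigma[OF Suc] by (simp add: comp_def)
  qed (use t in simp)
qed

lemma regular_map_klinear:
  assumes f: "klinear f" and V: "V \<subseteq> multiproj [4]" "\<And>p. p \<in> V \<Longrightarrow> a p \<in> V"
    and a: "\<And>p. p \<in> V \<Longrightarrow> a p = map ((`) f) p"
  shows "regular_map [4] V [4] V a"
  unfolding regular_map_def
proof (intro conjI ballI allI impI)
  show "a \<in> V \<rightarrow> V" using V by blast
  obtain F where F: "\<forall>i\<le>4. multihom [4] (\<lambda>j. if j = 0 then 1 else 0) (F i)"
    "\<forall>x. x 0 \<in> carrier_vec 5 \<longrightarrow> f (x 0) = vec 5 (\<lambda>i. meval (F i) x)"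
    using f unfolding klinear_def by blast
  have eq: "a q ! 0 = proj_point (f (x 0)) \<and> f (x 0) = vec 5 (\<lambda>i. meval (F i) x)"
    and nz: "f (x 0) \<noteq> 0\<^sub>v 5" if q: "q \<in> V" and x: "x \<in> coords q" for q x
  proof -
    have qm: "q \<in> multiproj [4]" using q V by blast
    note r = coords_rep[OF qm x, of 0]
    have x0: "x 0 \<in> carrier_vec 5" using r(1) by simp
    have "length (a q) = 1" "a q ! 0 = f ` (q ! 0)"
      using a[OF q] multiproj_nth(1)[OF qm] by auto
    then have aq: "a q ! 0 = f ` proj_point (x 0)" using r(3) by simp
    moreover have "a q \<in> multiproj [4]" using V q by blast
    \<comment> \<open>\<open>a\<close> maps \<open>V\<close> into \<open>V\<close>, so the image is
      a point of projective space; this is what makes \<open>f (x 0)\<close> nonzero.\<close>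
    ultimately have s: "f ` proj_point (x 0) \<in> proj_space 4" using multiproj_nth(2)[of "a q" "[4]" 0] by simp
    moreover have "f (x 0) \<in> f ` proj_point (x 0)" using proj_point_self by blast
    ultimately have "f (x 0) \<noteq> 0\<^sub>v (Suc 4)" "f ` proj_point (x 0) = proj_point (f (x 0))"
      using proj_space_rep by blast+
    then show "a q ! 0 = proj_point (f (x 0)) \<and> f (x 0) = vec 5 (\<lambda>i. meval (F i) x)" "f (x 0) \<noteq> 0\<^sub>v 5"
      using aq F(2) x0 by auto
  qed
  fix p j assume p: "p \<in> V" and j: "j < length [4::nat]"
  have pm: "p \<in> multiproj [4]" using p V by blast
  obtain x where x: "x \<in> coords p" by (rule coords_nonempty[OF pm])
  obtain i where i: "i < 5" "meval (F i) x \<noteq> 0"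
    using eq[OF p x] nz[OF p x] vec_nonzero_index[of "f (x 0)" 5] by auto
  then have "\<not> vanishes_at (F i) p" using vanishes_at_iff[OF pm x F(1)[rule_format, of i]] by simp
  then show "\<exists>d F. (\<forall>i\<le>[4] ! j. multihom [4] d (F i)) \<and> (\<exists>i\<le>[4] ! j. \<not> vanishes_at (F i) p) \<and>
      (\<forall>q\<in>V. (\<exists>i\<le>[4] ! j. \<not> vanishes_at (F i) q) \<longrightarrow>
        (\<forall>x\<in>coords q. a q ! j = proj_point (vec (Suc ([4] ! j)) (\<lambda>i. meval (F i) x))))"
    using i(1) j eq F(1)
    by (intro exI[of _ "\<lambda>j. if j = 0 then 1 else 0"] exI[of _ F]) (auto intro!: exI[of _ i])
qed

lemma regular_action_dP4: "regular_action C3_C4 [4] (dP4 z) (dP4_action z)"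
proof -
  interpret group_action C3_C4 "dP4 z" "dP4_action z" by (rule group_action_dP4)
  have "regular_map [4] (dP4 z) [4] (dP4 z) (dP4_action z (a, b))" if "(a, b) \<in> carrier C3_C4" for a b
    by (rule regular_map_klinear[OF klinear_word[of "nat a" "nat b"] dP4_subset])
      (use element_image[OF that] in \<open>auto simp: dP4_action_def\<close>)
  then show ?thesis unfolding regular_action_def using group_action_dP4 by auto
qed

end

section \<open>A point in the domain\<close>

context cube_root
begin

text \<open>The norm form of Eisenstein integers: \<open>a - b - b * z\<close> is the conjugate
  \<open>a + b * z^2\<close>.\<close>

lemma Eisenstein_nonzero:
  assumes "a * a - a * b + b * b \<noteq> 0" shows "a + b * z \<noteq> (0::'a)"
proof
  assume "a + b * z = 0"
  moreover have "(a + b * z) * (a - b - b * z) = a * a - a * b + b * b"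
    using z2 by Groebner_Basis.algebra
  ultimately show False using assms by simp
qed

lemma one_minus_quotients_nonzero:
  fixes p0 p1 p2 p3 q0 q1 q2 q3 :: 'a
  assumes "q0 * q1 * q2 * q3 \<noteq> p0 * p1 * p2 * p3" "q0 \<noteq> 0" "q1 \<noteq> 0" "q2 \<noteq> 0" "q3 \<noteq> 0"
  shows "1 - p0 / q0 * (p1 / q1) * (p2 / q2) * (p3 / q3) \<noteq> 0"
proof -
  have "p0 / q0 * (p1 / q1) * (p2 / q2) * (p3 / q3) = (p0 * p1 * p2 * p3) / (q0 * q1 * q2 * q3)"
    by simp
  then show ?thesis using assms by auto
qed

text \<open>A point of the surface over \<open>\<rat>(\<zeta>\<^sub>3)\<close> at which none of the open conditions fails.\<close>

lemma dom_surf_witness: "dom_surf 0 (1 + 2 * z) 3 (- (1 + 2 * z)) 0 0"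
proof -
  \<comment> \<open>\<open>e^2 = - 3\<close>, so \<open>(0, e, 3, - e)\<close> solves both
    equations. The values \<open>b1 + b3 = 0\<close> and \<open>r1 = r2 = 0\<close> keep the
    sections short.\<close>
  define e where "e = 1 + 2 * z"
  have s0: "sect z 0 e 3 (- e) 0 0 w = (11 - 12 * z) + w * (3 + 39 * z) + w^2 * (- 22 + 19 * z)"
    if "w^3 = 1" for w
  proof -
    have "sect z 0 e 3 (- e) 0 0 w = (2 + w * 3 + w^2 * (- e)) * ((1 + w * z * 3) * (4 + w * z * 3))"
      by (simp add: sect_def base_sect_def norm_factor_def)
    then show ?thesis using that z2 unfolding e_def by Groebner_Basis.algebra
  qed
  have s1: "sect z e 3 (- e) 0 0 0 w = (23 + 12 * z) + w * (- 41 - 19 * z) + w^2 * (- 36 - 39 * z)"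
    if "w^3 = 1" for w
  proof -
    have "sect z e 3 (- e) 0 0 0 w = (1 + w * e) * (2 + w * (- e)) * ((1 + (w * z)^2 * 3) * (4 + (w * z)^2 * 3))"
      by (simp add: sect_def base_sect_def norm_factor_def)
    then show ?thesis using that z2 unfolding e_def by Groebner_Basis.algebra
  qed
  have s2: "sect z 3 (- e) 0 e 0 0 w = (- 64 - 45 * z) + w * (- 57 - 24 * z) + w^2 * (13 + 53 * z)"
    if "w^3 = 1" for w
  proof -
    have "sect z 3 (- e) 0 e 0 0 w = (1 + w * 3) * (2 + w^2 * e) * ((1 + w * z * 3) * (4 + w * z * 3))"
      by (simp add: sect_def base_sect_def norm_factor_def)
    then show ?thesis using that z2 unfolding e_def by Groebner_Basis.algebra
  qed
  have s3: "sect z (- e) 0 e 3 0 0 w = (- 19 + 45 * z) + w * (- 40 - 53 * z) + w^2 * (- 33 + 24 * z)"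
    if "w^3 = 1" for w
  proof -
    have "sect z (- e) 0 e 3 0 0 w = (1 + w * (- e)) * (2 + w * e + w^2 * 3) * ((1 + (w * z)^2 * 3) * (4 + (w * z)^2 * 3))"
      by (simp add: sect_def base_sect_def norm_factor_def)
    then show ?thesis using that z2 unfolding e_def by Groebner_Basis.algebra
  qed
  have c: "coef z 0 (sect z 0 e 3 (- e) 0 0) = 11 - 12 * z" "coef z 1 (sect z 0 e 3 (- e) 0 0) = 3 + 39 * z"
    "coef z 0 (sect z e 3 (- e) 0 0 0) = 23 + 12 * z" "coef z 1 (sect z e 3 (- e) 0 0 0) = - 41 - 19 * z"
    "coef z 0 (sect z 3 (- e) 0 e 0 0) = - 64 - 45 * z" "coef z 1 (sect z 3 (- e) 0 e 0 0) = - 57 - 24 * z"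
    "coef z 0 (sect z (- e) 0 e 3 0 0) = - 19 + 45 * z" "coef z 1 (sect z (- e) 0 e 3 0 0) = - 40 - 53 * z"
    using coef_eqI(1,2)[OF s0] coef_eqI(1,2)[OF s1] coef_eqI(1,2)[OF s2] coef_eqI(1,2)[OF s3] by auto
  have nz: "11 - 12 * z \<noteq> 0" "23 + 12 * z \<noteq> 0" "- 64 - 45 * z \<noteq> 0" "- 19 + 45 * z \<noteq> 0"
    using Eisenstein_nonzero[of 11 "-12"] Eisenstein_nonzero[of 23 12]
      Eisenstein_nonzero[of "-64" "-45"] Eisenstein_nonzero[of "-19" 45] by simp_all
  \<comment> \<open>With denominators cleared, the last condition of \<open>dom_surf\<close> says
    that this Eisenstein integer is nonzero.\<close>
  have "(11 - 12 * z) * (23 + 12 * z) * (- 64 - 45 * z) * (- 19 + 45 * z) -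
      (3 + 39 * z) * (- 41 - 19 * z) * (- 57 - 24 * z) * (- 40 - 53 * z) = - 1815002 + - 3230577 * z"
    using z2 by Groebner_Basis.algebra
  moreover have "- 1815002 + - 3230577 * z \<noteq> 0" by (rule Eisenstein_nonzero) simp
  ultimately have "(11 - 12 * z) * (23 + 12 * z) * (- 64 - 45 * z) * (- 19 + 45 * z) \<noteq>
      (3 + 39 * z) * (- 41 - 19 * z) * (- 57 - 24 * z) * (- 40 - 53 * z)" by (metis diff_self)
  then have prod: "1 - (3 + 39 * z) / (11 - 12 * z) * ((- 41 - 19 * z) / (23 + 12 * z)) *
      ((- 57 - 24 * z) / (- 64 - 45 * z)) * ((- 40 - 53 * z) / (- 19 + 45 * z)) \<noteq> 0"
    using nz by (intro one_minus_quotients_nonzero)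
  have "norm_factor 3 0 w \<noteq> 0" if "w^3 = 1" for w :: 'a
  proof -
    \<comment> \<open>Sums of cubes: \<open>(1 + 3 * w) * (1 - 3 * w + 9 * w^2) = 28\<close> and
      \<open>(4 + 3 * w) * (16 - 12 * w + 9 * w^2) = 91\<close>.\<close>
    have "norm_factor 3 0 w * (28 * (1 - 3 * w + 9 * w^2) * (16 - 12 * w + 9 * w^2)) = 28 * 28 * 91"
      using that by (simp add: norm_factor_def) Groebner_Basis.algebra
    then show ?thesis by auto
  qed
  then have "kappa z 3 0 0 0 \<noteq> 0"
    unfolding kappa_def using z3 z_powers by simp
  moreover have "e * (- e) = 3" unfolding e_def using z2 by Groebner_Basis.algebra
  ultimately show ?thesis
    unfolding e_def[symmetric] dom_surf_def fib_coord_def c using nz prod by simp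
qed

end

subsection \<open>The linear representation\<close>

definition monom_mat :: "(nat \<Rightarrow> 'a::comm_ring_1) \<Rightarrow> (nat \<Rightarrow> nat) \<Rightarrow> nat \<Rightarrow> 'a mat" where
  "monom_mat d \<pi> n = mat n n (\<lambda>(i, j). if j = \<pi> i then d i else 0)"

lemma monom_mat_carrier [simp]: "monom_mat d \<pi> n \<in> carrier_mat n n"
  by (simp add: monom_mat_def)

text \<open>Row \<open>i\<close> of the left factor selects row \<open>\<pi> i\<close> of the right
  one, which explains the order of composition.\<close>

lemma monom_mat_mult:
  assumes "\<And>i. i < n \<Longrightarrow> \<pi> i < n"
  shows "monom_mat d \<pi> n * monom_mat e \<rho> n = monom_mat (\<lambda>i. d i * e (\<pi> i)) (\<rho> \<circ> \<pi>) n"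
proof (rule eq_matI)
  fix i j assume ij: "i < dim_row (monom_mat (\<lambda>i. d i * e (\<pi> i)) (\<rho> \<circ> \<pi>) n)"
    "j < dim_col (monom_mat (\<lambda>i. d i * e (\<pi> i)) (\<rho> \<circ> \<pi>) n)"
  then have "(monom_mat d \<pi> n * monom_mat e \<rho> n) $$ (i, j) =
      (\<Sum>k = 0..<n. (if k = \<pi> i then d i else 0) * (if j = \<rho> k then e k else 0))"
    by (simp add: monom_mat_def scalar_prod_def)
  also have "\<dots> = (\<Sum>k = 0..<n. if k = \<pi> i then d i * (if j = \<rho> k then e k else 0) else 0)"
    by (rule sum.cong) auto
  also have "\<dots> = d i * (if j = \<rho> (\<pi> i) then e (\<pi> i) else 0)"
    using assms ij by (simp add: monom_mat_def)
  finally show "(monom_mat d \<pi> n * monom_mat e \<rho> n) $$ (i, j) =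
      monom_mat (\<lambda>i. d i * e (\<pi> i)) (\<rho> \<circ> \<pi>) n $$ (i, j)"
    using ij by (simp add: monom_mat_def)
qed (simp_all add: monom_mat_def)

lemma monom_mat_cong:
  assumes "\<And>i. i < n \<Longrightarrow> d i = e i" "\<And>i. i < n \<Longrightarrow> \<pi> i = \<rho> i"
  shows "monom_mat d \<pi> n = monom_mat e \<rho> n"
  using assms by (auto simp: monom_mat_def intro!: eq_matI)

lemma monom_mat_one: "monom_mat (\<lambda>_. 1) (\<lambda>i. i) n = 1\<^sub>m n"
  by (auto simp: monom_mat_def intro!: eq_matI)

lemma monom_mat_vec:
  fixes f :: "'a::comm_ring_1 \<Rightarrow> 'b::comm_ring_1"
  assumes "v \<in> carrier_vec n" "i < n" "\<pi> i < n"
  shows "(map_mat f (monom_mat d \<pi> n) *\<^sub>v v) $ i = (f (d i) - f 0) * v $ \<pi> i + f 0 * (\<Sum>k = 0..<n. v $ k)"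
proof -
  have "(map_mat f (monom_mat d \<pi> n) *\<^sub>v v) $ i = (\<Sum>k = 0..<n. f (if k = \<pi> i then d i else 0) * v $ k)"
    using assms by (auto simp: monom_mat_def scalar_prod_def intro!: sum.cong)
  also have "\<dots> = (\<Sum>k = 0..<n. (if k = \<pi> i then (f (d i) - f 0) * v $ k else 0) + f 0 * v $ k)"
    by (rule sum.cong) (auto simp: algebra_simps)
  also have "\<dots> = (f (d i) - f 0) * v $ \<pi> i + f 0 * (\<Sum>k = 0..<n. v $ k)"
    using assms by (simp add: sum.distrib sum_distrib_left)
  finally show ?thesis .
qed

interpretation to_ac: semiring_hom "to_ac :: 'k::field \<Rightarrow> 'k alg_closure"
  by unfold_locales simp_all

definition mact :: "'k::field mat \<Rightarrow> 'k mpoint \<Rightarrow> 'k mpoint" where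
  "mact M q = map ((`) (\<lambda>v. map_mat to_ac M *\<^sub>v v)) q"

text \<open>Matrix-vector laws hold for vectors of matching dimension, a condition that points as
  bare sets of vectors do not carry.\<close>

definition in_dim :: "nat \<Rightarrow> 'k::field mpoint \<Rightarrow> bool" where
  "in_dim n q \<longleftrightarrow> (\<forall>Q\<in>set q. Q \<subseteq> carrier_vec n)"

lemma mact_in_dim: "M \<in> carrier_mat n n \<Longrightarrow> in_dim n (mact M q)"
  by (auto simp: in_dim_def mact_def intro!: carrier_vecI)

lemma mact_mult:
  assumes "M \<in> carrier_mat n n" "N \<in> carrier_mat n n" "in_dim n q"
  shows "mact (M * N) q = mact M (mact N q)"
proof -
  have "map_mat to_ac (M * N) *\<^sub>v v = map_mat to_ac M *\<^sub>v (map_mat to_ac N *\<^sub>v v)"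
    if "v \<in> carrier_vec n" for v
    using assms that to_ac.mat_hom_mult[OF assms(1,2)]
    by (simp add: assoc_mult_mat_vec[of _ n n _ n])
  then show ?thesis
    using assms(3) by (auto simp: mact_def in_dim_def image_image intro!: image_cong)
qed

lemma mact_one:
  assumes "in_dim n q" shows "mact (1\<^sub>m n) q = (q :: 'k::field mpoint)"
proof -
  have "map_mat to_ac (1\<^sub>m n :: 'k mat) = 1\<^sub>m n" by (auto intro!: eq_matI)
  then have "(\<lambda>v. map_mat to_ac (1\<^sub>m n :: 'k mat) *\<^sub>v v) ` Q = Q" if "Q \<in> set q" for Q
    using assms that by (force simp: in_dim_def image_def)
  then show ?thesis by (simp add: mact_def map_idI)
qed

lemma monoid_GL: "Group.monoid (GL n :: 'k::field mat monoid)"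
proof -
  interpret R: ring "ring_mat TYPE('k) n ()" by (rule ring_mat)
  have "group (GL n :: 'k mat monoid)"
    unfolding GL_def by (rule R.units_group)
  then show ?thesis by (simp add: group_def)
qed

lemma GL_simps:
  "carrier (GL n) = Units (ring_mat TYPE('k::field) n ())" "x \<otimes>\<^bsub>GL n\<^esub> y = x * (y :: 'k mat)" "\<one>\<^bsub>GL n\<^esub> = (1\<^sub>m n :: 'k mat)"
  by (simp_all add: GL_def units_of_carrier units_of_mult units_of_one ring_mat_simps)

lemma mact_pow:
  assumes M: "M \<in> carrier_mat n n" and q: "in_dim n q"
  shows "M [^]\<^bsub>GL n\<^esub> (k::nat) \<in> carrier_mat n n \<and> mact (M [^]\<^bsub>GL n\<^esub> k) q = (mact M ^^ k) q"
  using q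
proof (induction k arbitrary: q)
  case 0
  then show ?case by (simp add: GL_simps mact_one nat_pow_def)
next
  case (Suc k)
  have "M [^]\<^bsub>GL n\<^esub> Suc k = M [^]\<^bsub>GL n\<^esub> k * M" by (simp add: nat_pow_def GL_simps)
  then show ?case
    using Suc.IH[OF Suc.prems] Suc.IH[OF mact_in_dim[OF M, of q]] mact_mult[OF _ M Suc.prems] M
      mult_carrier_mat[OF _ M, of "M [^]\<^bsub>GL n\<^esub> k" n]
    by (simp add: funpow_swap1)
qed

context dp4
begin

text \<open>Coordinate 0 is the homogenising one, on which the group acts trivially; coordinates 1
  to 4 carry \<open>u0\<close> to \<open>u3\<close>.\<close>

definition weight :: "nat \<Rightarrow> 'k" where "weight i = [1, z, z^2, z, z^2] ! i"
definition shift :: "nat \<Rightarrow> nat" where "shift i = [0, 2, 3, 4, 1] ! i"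

definition SL :: "'k mat" where "SL = monom_mat weight (\<lambda>i. i) 5"
definition TL :: "'k mat" where "TL = monom_mat (\<lambda>_. 1) shift 5"

definition rep :: "int \<times> int \<Rightarrow> 'k mat" where
  "rep = (\<lambda>(a, b). SL [^]\<^bsub>GL 5\<^esub> nat a \<otimes>\<^bsub>GL 5\<^esub> TL [^]\<^bsub>GL 5\<^esub> nat b)"

lemma lt5: "i < 5 \<longleftrightarrow> i = 0 \<or> i = 1 \<or> i = 2 \<or> i = 3 \<or> i = (4::nat)"
  by auto

lemma shift_less: "i < 5 \<Longrightarrow> shift i < 5"
  by (auto simp: lt5 shift_def)

lemma z_base: "z * z = z^2" "z * z^2 = 1" "z^2 * z = 1" "z^2 * z^2 = z" "z^3 = 1" "z^6 = 1" "z^4 = z"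
proof -
  show 3: "z^3 = 1" using z2 by Groebner_Basis.algebra
  then show "z * z = z^2" "z * z^2 = 1" "z^2 * z = 1" by (simp_all add: eval_nat_numeral mult_ac)
  then show "z^2 * z^2 = z" using 3 by (simp add: eval_nat_numeral mult_ac)
  show "z^6 = 1" using 3 power_mult[of z 3 2] by simp
  show "z^4 = z" using 3 by (simp add: eval_nat_numeral)
qed

lemma SL_TL_carrier: "SL \<in> carrier_mat 5 5" "TL \<in> carrier_mat 5 5"
  by (simp_all add: SL_def TL_def)

lemma SL_TL_relations:
  "SL * (SL * SL) = 1\<^sub>m 5" "(SL * SL) * SL = 1\<^sub>m 5" "TL * (TL * (TL * TL)) = 1\<^sub>m 5" "((TL * TL) * TL) * TL = 1\<^sub>m 5"
  "TL * SL = SL * SL * TL"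
proof -
  note c = SL_TL_carrier
  have S: "SL * monom_mat e \<rho> 5 = monom_mat (\<lambda>i. weight i * e i) \<rho> 5" for e \<rho>
    unfolding SL_def monom_mat_mult[of 5 "\<lambda>i. i", simplified] by (simp add: comp_def)
  have T: "TL * monom_mat e \<rho> 5 = monom_mat (\<lambda>i. 1 * e (shift i)) (\<rho> \<circ> shift) 5" for e \<rho>
    unfolding TL_def by (rule monom_mat_mult) (rule shift_less)
  have S2: "SL * SL = monom_mat (\<lambda>i. weight i * weight i) (\<lambda>i. i) 5"
    using S[of weight "\<lambda>i. i"] by (simp only: SL_def[symmetric])
  have T2: "TL * TL = monom_mat (\<lambda>i. 1 * 1) (shift \<circ> shift) 5"
    using T[of "\<lambda>_. 1" shift] by (simp only: TL_def[symmetric])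
  show S3: "SL * (SL * SL) = 1\<^sub>m 5"
    unfolding S2 S monom_mat_one[symmetric]
    by (rule monom_mat_cong) (auto simp: lt5 weight_def z_base)
  show "(SL * SL) * SL = 1\<^sub>m 5" using S3 assoc_mult_mat[OF c(1) c(1) c(1)] by simp
  show T4: "TL * (TL * (TL * TL)) = 1\<^sub>m 5"
    unfolding T2 T monom_mat_one[symmetric]
    by (rule monom_mat_cong) (auto simp: lt5 shift_def)
  have c2: "TL * TL \<in> carrier_mat 5 5" using c by simp
  show "((TL * TL) * TL) * TL = 1\<^sub>m 5"
    using T4 assoc_mult_mat[OF c2 c(2) c(2)] assoc_mult_mat[OF c(2) c(2) c2] by simp
  have "SL * SL * TL = SL * (SL * TL)" by (rule assoc_mult_mat[OF c(1) c(1) c(2)])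
  then show "TL * SL = SL * SL * TL"
    using S[of "\<lambda>i. weight i * 1" shift] S[of "\<lambda>_. 1" shift] T[of weight "\<lambda>i. i"]
    unfolding SL_def[symmetric] TL_def[symmetric]
    by (simp only: comp_def) (rule monom_mat_cong; auto simp: lt5 weight_def shift_def z_base)
qed

lemma rep_hom: "rep \<in> hom C3_C4 (GL 5)"
proof -
  interpret Group.monoid "GL 5 :: 'k mat monoid" by (rule monoid_GL)
  note c = SL_TL_carrier
  have "SL \<in> carrier (GL 5)" "TL \<in> carrier (GL 5)"
  proof -
    show "SL \<in> carrier (GL 5)"
      unfolding GL_simps Units_def ring_mat_simps using c SL_TL_relations(1,2)
      by (auto intro!: bexI[of _ "SL * SL"])
    have "TL * TL * TL * TL = 1\<^sub>m 5" using SL_TL_relations(4) .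
    moreover have "TL * (TL * TL * TL) = 1\<^sub>m 5"
      using SL_TL_relations(3) c by (simp add: assoc_mult_mat[of _ 5 5 _ 5 _ 5])
    ultimately show "TL \<in> carrier (GL 5)"
      unfolding GL_simps Units_def ring_mat_simps using c
      by (auto intro!: bexI[of _ "TL * TL * TL"])
  qed
  moreover have four: "(4::nat) = Suc (Suc (Suc (Suc 0)))" by simp
  have "SL [^]\<^bsub>GL 5\<^esub> (3::nat) = \<one>\<^bsub>GL 5\<^esub>" "TL [^]\<^bsub>GL 5\<^esub> (4::nat) = \<one>\<^bsub>GL 5\<^esub>"
    unfolding numeral_3_eq_3 four nat_pow_Suc nat_pow_0 GL_simps
      left_mult_one_mat[OF c(1)] left_mult_one_mat[OF c(2)] by (rule SL_TL_relations)+
  moreover have "TL \<otimes>\<^bsub>GL 5\<^esub> SL = SL \<otimes>\<^bsub>GL 5\<^esub> SL \<otimes>\<^bsub>GL 5\<^esub> TL"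
    unfolding GL_simps by (rule SL_TL_relations)
  ultimately show ?thesis
    unfolding rep_def
    by (rule C3_C4_hom)
qed

lemma proj_rep_action_rep:
  assumes "in_dim 5 q"
  shows "proj_rep_action rep (a, b) q = (mact SL ^^ nat a) ((mact TL ^^ nat b) q)"
proof -
  note c = SL_TL_carrier
  note p = mact_pow[OF c(2) assms, of "nat b"]
  have d: "in_dim 5 (mact (TL [^]\<^bsub>GL 5\<^esub> nat b) q)" using mact_in_dim p by blast
  have "proj_rep_action rep (a, b) q = mact (SL [^]\<^bsub>GL 5\<^esub> nat a * TL [^]\<^bsub>GL 5\<^esub> nat b) q"
    by (simp add: proj_rep_action_def mact_def rep_def GL_simps)
  also have "\<dots> = (mact SL ^^ nat a) ((mact TL ^^ nat b) q)"
    using mact_mult[OF _ _ assms] mact_pow[OF c(1) d, of "nat a"] p by simp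
  finally show ?thesis .
qed

lemma map_TL_vec:
  assumes "v \<in> carrier_vec 5" "i < 5" shows "(map_mat to_ac TL *\<^sub>v v) $ i = v $ shift i"
  using monom_mat_vec[OF assms(1,2), of shift to_ac] shift_less[OF assms(2)] by (simp add: TL_def)

lemma map_SL_vec:
  assumes "v \<in> carrier_vec 5" "i < 5" shows "(map_mat to_ac SL *\<^sub>v v) $ i = to_ac (weight i) * v $ i"
  using monom_mat_vec[OF assms(1,2), of "\<lambda>i. i" to_ac] assms(2) by (simp add: SL_def)

subsection \<open>Generic freeness\<close>

lemma surf_times_Nil: "surf_times [] = dP4 z"
proof -
  have "p \<in> dP4 z \<Longrightarrow> \<exists>q. p = [q]" for p by (elim dP4E) auto
  then show ?thesis by (force simp: surf_times_def multiproj_def)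
qed

lemma lin_words:
  "lin cs ((lin_sigma z ^^ a) v) = lin cs v" "lin (cb 0) ((lin_sigma z ^^ a) v) = zc ^ a * lin (cb 0) v"
  "lin cs ((lin_tau ^^ b) v) = lin cs v"
  by (induction a) (simp_all add: lin_sigma_coords, induction b, simp_all add: lin_tau_coords)

lemma lin_tau_word:
  assumes "b < 4" shows "lin (cb 0) ((lin_tau ^^ b) v) = lin (cb b) v"
proof -
  have "(lin_tau ^^ 2) v = lin_tau (lin_tau v)" "(lin_tau ^^ 3) v = lin_tau (lin_tau (lin_tau v))"
    by (simp_all add: numeral_2_eq_2 numeral_3_eq_3)
  moreover have "b = 0 \<or> b = Suc 0 \<or> b = 2 \<or> b = 3" using assms by auto
  ultimately show ?thesis by (auto simp: lin_tau_coords)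
qed

lemma meval_diff: "meval (f - g) x = meval f x - meval g x"
  using meval_add[of f "- g" x] by (simp add: meval_uminus)

text \<open>The coordinate \<open>s\<close> is invariant, so an element fixing a point with
  \<open>s \<noteq> 0\<close> fixes the ratios \<open>b_j / s\<close>. The word for
  \<open>(a, b)\<close> turns \<open>b0\<close> into \<open>zeta^a * b_b\<close>. Hence
  \<open>b_b\<close> and \<open>b0\<close> have equal cubes, which forces \<open>b = 0\<close>; then
  \<open>b0 \<noteq> 0\<close> forces \<open>a = 0\<close>.\<close>

lemma generically_free_dP4: "generically_free C3_C4 [4] (dP4 z) (dP4_action z)"
proof -
  let ?d = "\<lambda>j. if j = (0::nat) then 1 else 0 :: nat"
  let ?L = "\<lambda>j. lform (cb j)"
  define D where "D j = ?L 0 ^ 3 + - (?L j ^ 3)" for j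
  define H where "H = lform cs * (?L 0 * (D 1 * (D 2 * D 3)))"
  have mD: "multihom [4] (\<lambda>j. 3 * ?d j) (D j)" for j
    unfolding D_def by (intro multihom_add multihom_uminus multihom_power multihom_lform)
  have "\<exists>d. multihom [4] d H"
    unfolding H_def using multihom_mult multihom_lform[of "[]"] mD by metis
  then obtain d where d: "multihom [4] d H" ..
  have mH: "meval H x = lin cs (x 0) * (lin (cb 0) (x 0) * (((lin (cb 0) (x 0))^3 - (lin (cb 1) (x 0))^3) *
      (((lin (cb 0) (x 0))^3 - (lin (cb 2) (x 0))^3) * ((lin (cb 0) (x 0))^3 - (lin (cb 3) (x 0))^3))))" for x
    by (simp add: H_def D_def meval_mult meval_diff meval_power meval_lform)
  define U where "U = {p \<in> dP4 z. \<not> vanishes_at H p}"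
  have U: "open_in [4] (dP4 z) U"
    unfolding U_def by (rule open_in_nonvanishing[OF open_in_self dP4_subset d]) (rule dP4_subset)
  \<comment> \<open>A rational point: \<open>1 * 5 = 2 + 3\<close> and \<open>2 * 3 = 1 + 5\<close>,
    with pairwise distinct cubes.\<close>
  define v where "v = vecof 1 1 2 5 3"
  have v: "v \<in> carrier_vec 5" by (simp add: v_def)
  have lv: "lin cs v = 1" "lin (cb 0) v = 1" "lin (cb (Suc 0)) v = 2" "lin (cb 2) v = 5" "lin (cb 3) v = 3"
    by (simp_all add: v_def lin_vecof)
  have v0: "v \<noteq> 0\<^sub>v 5" using lv(1) lin_zero[of cs] by force
  have pv: "[proj_point v] \<in> dP4 z"
    unfolding proj_point_in_dP4[OF v v0] by (simp add: on_surface_def lv)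
  have xv: "(\<lambda>_. v) \<in> coords [proj_point v]" by (simp add: coords_def proj_point_self)
  have "\<not> vanishes_at H [proj_point v]"
    using vanishes_at_iff[OF _ xv d] pv dP4_subset by (auto simp: mH lv)
  then have "[proj_point v] \<in> U" using pv by (simp add: U_def)
  then have "dense_open [4] (dP4 z) U"
    using dense_open_surf_times[of "[]" U "[proj_point v]" "\<lambda>_. v"] U xv
    by (simp add: surf_times_Nil in_chart_def lv)
  moreover have "stabilizer C3_C4 (dP4_action z) p = {\<one>\<^bsub>C3_C4\<^esub>}" if p: "p \<in> U" for p
  proof -
    interpret group_action C3_C4 "dP4 z" "dP4_action z" by (rule group_action_dP4)
    have pd: "p \<in> dP4 z" using p by (simp add: U_def)
    obtain w where w: "w \<in> carrier_vec 5" "p = [proj_point w]" using dP4E[OF pd] by metis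
    have xw: "(\<lambda>_. w) \<in> coords p" by (simp add: w coords_def proj_point_self)
    have "meval H (\<lambda>_. w) \<noteq> 0"
      using p vanishes_at_iff[OF _ xw d] dP4_subset by (auto simp: U_def)
    then have nz: "lin cs w \<noteq> 0" "lin (cb 0) w \<noteq> 0" "\<And>j. j = 1 \<or> j = 2 \<or> j = 3 \<Longrightarrow> (lin (cb j) w)^3 \<noteq> (lin (cb 0) w)^3"
      by (auto simp: mH)
    have "a = 0 \<and> b = 0" if ab: "(a, b) \<in> carrier C3_C4" "dP4_action z (a, b) p = p" for a b
    proof -
      let ?f = "(lin_sigma z ^^ nat a) \<circ> (lin_tau ^^ nat b)"
      have "proj_point w = ?f ` proj_point w" using ab(2) pd by (simp add: dP4_action_def w)
      then have "?f w \<in> proj_point w" using proj_point_self[of w] by blast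
      then obtain c where "?f w = c \<cdot>\<^sub>v w" by (auto simp: proj_point_def)
      then have f: "lin e (?f w) = c * lin e w" for e by (simp add: lin_smult[OF w(1)])
      have "c = 1" using f[of cs] nz(1) by (simp add: lin_words)
      have b4: "nat b < 4" and a3: "nat a < 3" "0 \<le> a" "0 \<le> b" using ab(1) by (auto simp: carrier_C3_C4)
      have e: "zc ^ nat a * lin (cb (nat b)) w = lin (cb 0) w"
        using f[of "cb 0"] \<open>c = 1\<close> by (simp add: lin_words lin_tau_word[OF b4])
      have "(zc ^ nat a)^3 = 1" using K.z3 by (metis power_commutes power_mult power_one mult.commute)
      then have "(lin (cb (nat b)) w)^3 = (lin (cb 0) w)^3"
        using e by (metis power_mult_distrib mult_1_left)
      moreover have "nat b = 0 \<or> nat b = 1 \<or> nat b = 2 \<or> nat b = 3" using b4 by linarith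
      ultimately have b0: "nat b = 0" using nz(3)[of "nat b"] by blast
      then have "zc ^ nat a = 1" using e nz(2) by simp
      moreover have "nat a = 0 \<or> nat a = 1 \<or> nat a = 2" using a3 by auto
      ultimately have "nat a = 0" using K.z_neq by auto
      then show ?thesis using a3 b0 by simp
    qed
    moreover have "dP4_action z (0, 0) p = p" using pd by (simp add: dP4_action_eq)
    ultimately show ?thesis
      by (auto simp: stabilizer_def one_C3_C4 carrier_C3_C4)
  qed
  ultimately show ?thesis unfolding generically_free_def by blast
qed

end

subsection \<open>The birational map\<close>

lemma regular_fun_divide_const:
  assumes "regular_fun ns U f" shows "regular_fun ns U (\<lambda>p. f p / to_ac c)"
  using regular_fun_mult[OF assms regular_fun_const[of ns U "inverse c"]] by (simp add: divide_inverse)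

text \<open>Cramer's rule for the substitution \<open>r1 = g1 * t0 + g2 * t1^2\<close>,
  \<open>r2 = g1 * t1 + g2 * t0^2\<close>, read in both directions.\<close>

lemma triangular_solve:
  fixes t0 t1 :: "'a::field"
  assumes "t0^3 - t1^3 \<noteq> 0"
  shows "((g1 * t0 + g2 * t1^2) * t0^2 - (g1 * t1 + g2 * t0^2) * t1^2) / (t0^3 - t1^3) = g1"
    "(t0 * (g1 * t1 + g2 * t0^2) - t1 * (g1 * t0 + g2 * t1^2)) / (t0^3 - t1^3) = g2"
    "(r1 * t0^2 - r2 * t1^2) / (t0^3 - t1^3) * t0 + (t0 * r2 - t1 * r1) / (t0^3 - t1^3) * t1^2 = r1"
    "(r1 * t0^2 - r2 * t1^2) / (t0^3 - t1^3) * t1 + (t0 * r2 - t1 * r1) / (t0^3 - t1^3) * t0^2 = r2"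
proof -
  define d where "d = t0^3 - t1^3"
  have d: "d \<noteq> 0" using assms by (simp add: d_def)
  have "(g1 * t0 + g2 * t1^2) * t0^2 - (g1 * t1 + g2 * t0^2) * t1^2 = g1 * d"
    "t0 * (g1 * t1 + g2 * t0^2) - t1 * (g1 * t0 + g2 * t1^2) = g2 * d"
    "(r1 * t0^2 - r2 * t1^2) * t0 + (t0 * r2 - t1 * r1) * t1^2 = r1 * d"
    "(r1 * t0^2 - r2 * t1^2) * t1 + (t0 * r2 - t1 * r1) * t0^2 = r2 * d"
    unfolding d_def by (simp_all add: algebra_simps power2_eq_square power3_eq_cube)
  then show "((g1 * t0 + g2 * t1^2) * t0^2 - (g1 * t1 + g2 * t0^2) * t1^2) / (t0^3 - t1^3) = g1"
    "(t0 * (g1 * t1 + g2 * t0^2) - t1 * (g1 * t0 + g2 * t1^2)) / (t0^3 - t1^3) = g2"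
    "(r1 * t0^2 - r2 * t1^2) / (t0^3 - t1^3) * t0 + (t0 * r2 - t1 * r1) / (t0^3 - t1^3) * t1^2 = r1"
    "(r1 * t0^2 - r2 * t1^2) / (t0^3 - t1^3) * t1 + (t0 * r2 - t1 * r1) / (t0^3 - t1^3) * t0^2 = r2"
    unfolding d_def[symmetric] times_divide_eq_left add_divide_distrib[symmetric] using d by simp_all
qed

context dp4
begin

abbreviation bc :: "nat \<Rightarrow> 'k mpoint \<Rightarrow> 'k alg_closure" where
  "bc j \<equiv> form_quot (lform (cb j)) (lform cs)"
abbreviation gc :: "nat \<Rightarrow> 'k mpoint \<Rightarrow> 'k alg_closure" where
  "gc i \<equiv> form_quot (mvar 1 i) (mvar 1 0)"
abbreviation uc :: "nat \<Rightarrow> 'k mpoint \<Rightarrow> 'k alg_closure" where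
  "uc i \<equiv> form_quot (mvar 0 (Suc i)) (mvar 0 0)"

text \<open>
  The twisting by \<open>t\<^sub>0 = b\<^sub>0 + b\<^sub>2\<close> and \<open>t\<^sub>1 = b\<^sub>1 + b\<^sub>3\<close> turns the coordinates of \<open>P\<^sup>2\<close>, on which the group
  acts trivially, into functions that \<open>\<sigma>\<close> scales by \<open>\<zeta>\<close> and \<open>\<zeta>\<^sup>2\<close> and \<open>\<tau>\<close> swaps.
\<close>

definition r1c :: "'k mpoint \<Rightarrow> 'k alg_closure" where
  "r1c p = gc 1 p * (bc 0 p + bc 2 p) + gc 2 p * (bc (Suc 0) p + bc 3 p)^2"
definition r2c :: "'k mpoint \<Rightarrow> 'k alg_closure" where
  "r2c p = gc 1 p * (bc (Suc 0) p + bc 3 p) + gc 2 p * (bc 0 p + bc 2 p)^2"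

definition chartS :: "'k mpoint set" where
  "chartS = {p \<in> {p \<in> surf_times [2]. \<not> vanishes_at (lform cs) p}. \<not> vanishes_at (mvar 1 0) p}"

definition domS :: "'k mpoint set" where
  "domS = {p \<in> chartS. K.dom_surf (bc 0 p) (bc (Suc 0) p) (bc 2 p) (bc 3 p) (r1c p) (r2c p)}"

definition f0 :: "'k mpoint \<Rightarrow> 'k alg_closure" where
  "f0 p = K.fib_coord (bc 0 p) (bc (Suc 0) p) (bc 2 p) (bc 3 p) (r1c p) (r2c p)"
definition f1 :: "'k mpoint \<Rightarrow> 'k alg_closure" where
  "f1 p = K.fib_coord (bc (Suc 0) p) (bc 2 p) (bc 3 p) (bc 0 p) (r2c p) (r1c p)"
definition f2 :: "'k mpoint \<Rightarrow> 'k alg_closure" where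
  "f2 p = K.fib_coord (bc 2 p) (bc 3 p) (bc 0 p) (bc (Suc 0) p) (r1c p) (r2c p)"
definition f3 :: "'k mpoint \<Rightarrow> 'k alg_closure" where
  "f3 p = K.fib_coord (bc 3 p) (bc 0 p) (bc (Suc 0) p) (bc 2 p) (r2c p) (r1c p)"

definition vec5 :: "'k alg_closure list \<Rightarrow> 'k alg_closure vec" where "vec5 xs = vec 5 (\<lambda>i. xs ! i)"
definition vec3 :: "'k alg_closure list \<Rightarrow> 'k alg_closure vec" where "vec3 xs = vec 3 (\<lambda>i. xs ! i)"

definition phi :: "'k mpoint \<Rightarrow> 'k mpoint" where
  "phi p = [proj_point (vec5 [1, f0 p, f1 p, f2 p, f3 p])]"

definition chartL :: "'k mpoint set" where
  "chartL = {q \<in> multiproj [4]. \<not> vanishes_at (mvar 0 0) q}"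

definition domL :: "'k mpoint set" where
  "domL = {q \<in> chartL. K.dom_lin (uc 0 q) (uc (Suc 0) q) (uc 2 q) (uc 3 q)}"

definition s0 :: "'k mpoint \<Rightarrow> 'k alg_closure" where "s0 q = K.surf_coord (uc 0 q) (uc (Suc 0) q) (uc 2 q) (uc 3 q)"
definition s1 :: "'k mpoint \<Rightarrow> 'k alg_closure" where "s1 q = K.surf_coord (uc (Suc 0) q) (uc 2 q) (uc 3 q) (uc 0 q)"
definition s2 :: "'k mpoint \<Rightarrow> 'k alg_closure" where "s2 q = K.surf_coord (uc 2 q) (uc 3 q) (uc 0 q) (uc (Suc 0) q)"
definition s3 :: "'k mpoint \<Rightarrow> 'k alg_closure" where "s3 q = K.surf_coord (uc 3 q) (uc 0 q) (uc (Suc 0) q) (uc 2 q)"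
definition yq :: "'k mpoint \<Rightarrow> 'k alg_closure \<Rightarrow> 'k alg_closure" where
  "yq q = K.lin_quot (uc 0 q) (uc (Suc 0) q) (uc 2 q) (uc 3 q)"

definition g1 :: "'k mpoint \<Rightarrow> 'k alg_closure" where
  "g1 q = (K.rho1 (yq q) * (s0 q + s2 q)^2 - K.rho2 (yq q) * (s1 q + s3 q)^2) / ((s0 q + s2 q)^3 - (s1 q + s3 q)^3)"
definition g2 :: "'k mpoint \<Rightarrow> 'k alg_closure" where
  "g2 q = ((s0 q + s2 q) * K.rho2 (yq q) - (s1 q + s3 q) * K.rho1 (yq q)) / ((s0 q + s2 q)^3 - (s1 q + s3 q)^3)"

definition psi :: "'k mpoint \<Rightarrow> 'k mpoint" where
  "psi q = [proj_point (vecof 1 (s0 q) (s1 q) (s2 q) (s3 q)), proj_point (vec3 [1, g1 q, g2 q])]"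

lemma times_proj_dP4: "times_proj (dP4 z) 2 = surf_times [2]"
proof -
  have "\<exists>q. p = [q]" if "p \<in> dP4 z" for p using dP4E[OF that] by metis
  then show ?thesis
    by (force simp: times_proj_def surf_times_def multiproj_def list_all2_Cons2)
qed

lemma chartS_point:
  fixes v y :: "'k alg_closure vec"
  assumes "v \<in> carrier_vec 5" "on_surface v" "lin cs v \<noteq> 0" "y \<in> carrier_vec 3" "y $ 0 \<noteq> 0"
  defines "p \<equiv> [proj_point v, proj_point y]"
  shows "p \<in> chartS" "bc j p = lin (cb j) v / lin cs v" "i \<le> 2 \<Longrightarrow> gc i p = y $ i / y $ 0"
proof -
  have v0: "v \<noteq> 0\<^sub>v 5" using assms(3) lin_zero by force
  have y0: "y \<noteq> 0\<^sub>v 3" using assms(5) by force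
  have pm: "p \<in> multiproj [4, 2]"
    unfolding p_def multiproj_def using assms(1,4) v0 y0 proj_point_in_space[of v 4] proj_point_in_space[of y 2]
    by (simp add: numeral_3_eq_3 numeral_2_eq_2)
  define x where "x = (\<lambda>j::nat. if j = 0 then v else y)"
  have x: "x \<in> coords p" by (auto simp: coords_def p_def x_def nth_Cons proj_point_self split: nat.splits)
  have m: "multihom [4, 2] (\<lambda>j. if j = 1 then 1 else 0) (mvar 1 i :: 'k mpol)" if "i \<le> 2" for i
    using that by (intro multihom_mvar) auto
  show "bc j p = lin (cb j) v / lin cs v"
    using form_quot_eq[OF pm x multihom_lform[of "[2]"] multihom_lform[of "[2]"]] by (simp add: meval_lform x_def)
  show "i \<le> 2 \<Longrightarrow> gc i p = y $ i / y $ 0"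
    using form_quot_eq[OF pm x m m] by (simp add: x_def)
  show "p \<in> chartS"
    unfolding chartS_def using surf_times_iff[OF pm x] assms(2,3,5)
      vanishes_at_iff[OF pm x multihom_lform[of "[2]"]] vanishes_at_iff[OF pm x m]
    by (simp add: meval_lform x_def)
qed

lemma chartSE:
  assumes "p \<in> chartS"
  obtains v y :: "'k alg_closure vec" where "v \<in> carrier_vec 5" "on_surface v" "lin cs v \<noteq> 0" "y \<in> carrier_vec 3" "y $ 0 \<noteq> 0"
    "p = [proj_point v, proj_point y]"
proof -
  have p: "p \<in> surf_times [2]" "\<not> vanishes_at (lform cs) p" "\<not> vanishes_at (mvar 1 0) p"
    using assms by (auto simp: chartS_def)
  have pm: "p \<in> multiproj [4, 2]" using p(1) surf_times_subset by blast
  obtain x where x: "x \<in> coords p" by (rule coords_nonempty[OF pm])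
  have l: "length p = 2" using multiproj_nth(1)[OF pm] by simp
  have "p = [p ! 0, p ! 1]" using l by (auto intro!: nth_equalityI simp: nth_Cons less_Suc_eq numeral_2_eq_2 split: nat.splits)
  moreover have "x 0 \<in> carrier_vec 5" "p ! 0 = proj_point (x 0)" "x 1 \<in> carrier_vec 3" "p ! 1 = proj_point (x 1)"
    using coords_rep[OF pm x, of 0] coords_rep[OF pm x, of 1] by (simp_all add: eval_nat_numeral)
  moreover have "on_surface (x 0)" using surf_times_iff[OF pm x] p(1) by simp
  moreover have "lin cs (x 0) \<noteq> 0" using not_vanishes_atD[OF pm x multihom_lform p(2)] by (simp add: meval_lform)
  moreover have "x 1 $ 0 \<noteq> 0"
    using not_vanishes_atD[OF pm x multihom_mvar[of 1 "[4, 2]" 0] p(3)] by simp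
  ultimately show thesis using that by metis
qed

lemma chartL_point:
  fixes v :: "'k alg_closure vec"
  assumes "v \<in> carrier_vec 5" "v $ 0 \<noteq> 0"
  shows "[proj_point v] \<in> chartL" "i \<le> 3 \<Longrightarrow> uc i [proj_point v] = v $ Suc i / v $ 0"
proof -
  let ?p = "[proj_point v]"
  have v0: "v \<noteq> 0\<^sub>v 5" using assms(2) by force
  have pm: "?p \<in> multiproj [4]"
    unfolding multiproj_def using assms(1) v0 proj_point_in_space[of v 4] by simp
  have x: "(\<lambda>_. v) \<in> coords ?p" by (auto simp: coords_def proj_point_self)
  have m: "multihom [4] (\<lambda>j. if j = 0 then 1 else 0) (mvar 0 i :: 'k mpol)" if "i \<le> 4" for i
    using that by (intro multihom_mvar) auto
  show "?p \<in> chartL" unfolding chartL_def using pm vanishes_at_iff[OF pm x m] assms(2) by simp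
  show "i \<le> 3 \<Longrightarrow> uc i ?p = v $ Suc i / v $ 0" using form_quot_eq[OF pm x m m] by simp
qed

lemma chartLE:
  assumes "q \<in> chartL"
  obtains v :: "'k alg_closure vec" where "v \<in> carrier_vec 5" "v $ 0 \<noteq> 0" "q = [proj_point v]"
proof -
  have q: "q \<in> multiproj [4]" "\<not> vanishes_at (mvar 0 0) q" using assms by (auto simp: chartL_def)
  obtain v :: "'k alg_closure vec" where v: "v \<in> carrier_vec (Suc 4)" "q = [proj_point v]" using multiproj4E[OF q(1)] by metis
  have x: "(\<lambda>_. v) \<in> coords q" by (auto simp: coords_def proj_point_self v)
  show thesis
    using that[of v] v not_vanishes_atD[OF q(1) x multihom_mvar[of 0 "[4]" 0] q(2)] by simp
qed

lemma vec5_index: "vec5 [a, b, c, d, e] $ 0 = a" "vec5 [a, b, c, d, e] $ Suc 0 = b"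
  "vec5 [a, b, c, d, e] $ 2 = c" "vec5 [a, b, c, d, e] $ 3 = d" "vec5 [a, b, c, d, e] $ 4 = e"
  "vec5 xs \<in> carrier_vec 5"
  by (simp_all add: vec5_def)

lemma vec3_index: "vec3 [a, b, c] $ 0 = a" "vec3 [a, b, c] $ Suc 0 = b" "vec3 [a, b, c] $ 2 = c"
  "vec3 xs \<in> carrier_vec 3"
  by (simp_all add: vec3_def)

lemma uc_phi:
  "uc 0 (phi p) = f0 p" "uc (Suc 0) (phi p) = f1 p" "uc 2 (phi p) = f2 p" "uc 3 (phi p) = f3 p"
  "phi p \<in> chartL"
proof -
  let ?v = "vec5 [1, f0 p, f1 p, f2 p, f3 p]"
  have v: "?v \<in> carrier_vec 5" "?v $ 0 \<noteq> 0" by (simp_all add: vec5_index)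
  show "uc 0 (phi p) = f0 p" "uc (Suc 0) (phi p) = f1 p" "uc 2 (phi p) = f2 p" "uc 3 (phi p) = f3 p"
    "phi p \<in> chartL"
    unfolding phi_def using chartL_point(1)[OF v] chartL_point(2)[OF v, of 0] chartL_point(2)[OF v, of "Suc 0"]
      chartL_point(2)[OF v, of 2] chartL_point(2)[OF v, of 3]
    by (simp_all add: vec5_def)
qed

lemma bc_psi:
  assumes "s0 q * s2 q = s1 q + s3 q" "s1 q * s3 q = s0 q + s2 q"
  shows "bc 0 (psi q) = s0 q" "bc (Suc 0) (psi q) = s1 q" "bc 2 (psi q) = s2 q" "bc 3 (psi q) = s3 q"
    "gc 1 (psi q) = g1 q" "gc 2 (psi q) = g2 q" "psi q \<in> chartS"
proof -
  let ?v = "vecof 1 (s0 q) (s1 q) (s2 q) (s3 q)" and ?y = "vec3 [1, g1 q, g2 q]"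
  have o: "on_surface ?v" using assms by (simp add: on_surface_def lin_vecof)
  have y: "?y \<in> carrier_vec 3" "?y $ 0 \<noteq> 0" by (simp_all add: vec3_index)
  have l: "lin cs ?v \<noteq> 0" by (simp add: lin_vecof)
  note c = chartS_point[OF vecof_carrier o l y]
  show "bc 0 (psi q) = s0 q" "bc (Suc 0) (psi q) = s1 q" "bc 2 (psi q) = s2 q" "bc 3 (psi q) = s3 q"
    "gc 1 (psi q) = g1 q" "gc 2 (psi q) = g2 q" "psi q \<in> chartS"
    unfolding psi_def using c(1) c(2) c(3)[of 1] c(3)[of 2] by (simp_all add: lin_vecof vec3_index)
qed

lemma phi_domL:
  assumes "p \<in> domS" shows "phi p \<in> domL" "psi (phi p) = p"
proof -
  have p: "p \<in> chartS" "K.dom_surf (bc 0 p) (bc (Suc 0) p) (bc 2 p) (bc 3 p) (r1c p) (r2c p)"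
    using assms by (auto simp: domS_def)
  note l = K.lin_of_surf[OF p(2), folded f0_def f1_def f2_def f3_def]
  show "phi p \<in> domL" using l(1) uc_phi(5)[of p] unfolding domL_def mem_Collect_eq uc_phi by blast
  have s: "s0 (phi p) = bc 0 p" "s1 (phi p) = bc (Suc 0) p" "s2 (phi p) = bc 2 p" "s3 (phi p) = bc 3 p"
    "K.rho1 (yq (phi p)) = r1c p" "K.rho2 (yq (phi p)) = r2c p"
    unfolding s0_def s1_def s2_def s3_def yq_def uc_phi using l by auto
  have t: "(bc 0 p + bc 2 p)^3 - (bc (Suc 0) p + bc 3 p)^3 \<noteq> 0" using p(2) by (simp add: K.dom_surf_def)
  have g: "g1 (phi p) = gc 1 p" "g2 (phi p) = gc 2 p"
    unfolding g1_def g2_def s r1c_def r2c_def by (rule triangular_solve[OF t])+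
  obtain v y :: "'k alg_closure vec" where vy: "v \<in> carrier_vec 5" "on_surface v" "lin cs v \<noteq> 0" "y \<in> carrier_vec 3" "y $ 0 \<noteq> 0"
    "p = [proj_point v, proj_point y]" using chartSE[OF p(1)] by metis
  note c = chartS_point[OF vy(1-5), folded vy(6)]
  \<comment> \<open>Scaled to \<open>s = 1\<close>, the vector has exactly the functions
    \<open>bc j\<close> as its other coordinates.\<close>
  have "lin cs v \<cdot>\<^sub>v vecof 1 (bc 0 p) (bc (Suc 0) p) (bc 2 p) (bc 3 p) = v"
  proof -
    let ?w = "(1 / lin cs v) \<cdot>\<^sub>v v"
    have "?w = vecof (lin cs ?w) (lin (cb 0) ?w) (lin (cb (Suc 0)) ?w) (lin (cb 2) ?w) (lin (cb 3) ?w)"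
      using vecof_lin[of ?w] vy(1) by simp
    also have "\<dots> = vecof 1 (bc 0 p) (bc (Suc 0) p) (bc 2 p) (bc 3 p)"
      using c(2) vy(3) by (simp add: lin_smult[OF vy(1)])
    finally show ?thesis using vy(1,3) by (metis nonzero_eq_divide_eq one_smult_vec smult_smult_assoc mult.commute)
  qed
  moreover have "y $ 0 \<cdot>\<^sub>v vec3 [1, gc 1 p, gc 2 p] = y"
    using vy(4,5) c(3)[of 1] c(3)[of 2]
    by (intro eq_vecI) (auto simp: vec3_def less_Suc_eq numeral_3_eq_3 numeral_2_eq_2)
  ultimately show "psi (phi p) = p"
    unfolding psi_def s g using vy(3,5,6) proj_point_smult by metis
qed

lemma psi_domS:
  assumes "q \<in> domL" shows "psi q \<in> domS" "phi (psi q) = q"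
proof -
  have q: "q \<in> chartL" "K.dom_lin (uc 0 q) (uc (Suc 0) q) (uc 2 q) (uc 3 q)"
    using assms by (auto simp: domL_def)
  note l = K.surf_of_lin[OF q(2), folded s0_def s1_def s2_def s3_def yq_def]
  have rel: "s0 q * s2 q = s1 q + s3 q" "s1 q * s3 q = s0 q + s2 q"
    and t: "(s0 q + s2 q)^3 - (s1 q + s3 q)^3 \<noteq> 0" using l(1) by (auto simp: K.dom_surf_def)
  note b = bc_psi[OF rel]
  have r: "r1c (psi q) = K.rho1 (yq q)" "r2c (psi q) = K.rho2 (yq q)"
    unfolding r1c_def r2c_def b g1_def g2_def by (rule triangular_solve[OF t])+
  show "psi q \<in> domS" using b l(1) by (simp add: domS_def r)
  have f: "f0 (psi q) = uc 0 q" "f1 (psi q) = uc (Suc 0) q" "f2 (psi q) = uc 2 q" "f3 (psi q) = uc 3 q"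
    unfolding f0_def f1_def f2_def f3_def b r using l by auto
  obtain v :: "'k alg_closure vec" where v: "v \<in> carrier_vec 5" "v $ 0 \<noteq> 0" "q = [proj_point v]" using chartLE[OF q(1)] by metis
  note c = chartL_point(2)[OF v(1,2), folded v(3)]
  have "v $ 0 \<cdot>\<^sub>v vec5 [1, uc 0 q, uc (Suc 0) q, uc 2 q, uc 3 q] = v"
    using v(2) c[of 0] c[of "Suc 0"] c[of 2] c[of 3]
    by (intro vec5_eqI) (simp_all add: vec5_index v(1) carrier_vecD[OF vec5_index(6)] numeral_2_eq_2[symmetric])
  then show "phi (psi q) = q"
    unfolding phi_def f using v(2,3) proj_point_smult by metis
qed


text \<open>The three cube roots lie in the ground field, so taking coefficients preserves
  regularity over it.\<close>

lemma regular_coef: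
  assumes "\<And>w. w \<in> {1, zc, zc^2} \<Longrightarrow> regular_fun ns U (\<lambda>p. h p w)"
  shows "regular_fun ns U (\<lambda>p. coef zc m (h p))"
proof -
  have d: "regular_fun ns U (\<lambda>p. f p / 3)" if "regular_fun ns U f" for f
    using regular_fun_divide_const[OF that, of 3] by simp
  show ?thesis unfolding coef_def by (intro d regular_fun_intros assms) auto
qed

lemma regular_base_sect:
  assumes "regular_fun ns U b0" "regular_fun ns U b1" "regular_fun ns U b2" "regular_fun ns U b3"
    "w \<in> {1, zc, zc^2}"
  shows "regular_fun ns U (\<lambda>p. base_sect zc (b0 p) (b1 p) (b2 p) (b3 p) w)"
proof -
  have "regular_fun ns U (\<lambda>_. w)" using assms(5) by (auto intro!: regular_fun_intros)
  then show ?thesis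
    unfolding base_sect_def norm_factor_def by (intro regular_fun_intros assms)
qed

lemma regular_coef_sect:
  assumes "regular_fun ns U b0" "regular_fun ns U b1" "regular_fun ns U b2" "regular_fun ns U b3"
    "regular_fun ns U r1" "regular_fun ns U r2"
  shows "regular_fun ns U (\<lambda>p. coef zc m (sect zc (b0 p) (b1 p) (b2 p) (b3 p) (r1 p) (r2 p)))"
proof (rule regular_coef)
  fix w assume w: "w \<in> {1, zc, zc^2}"
  then have "regular_fun ns U (\<lambda>_. w)" by (auto intro!: regular_fun_intros)
  then show "regular_fun ns U (\<lambda>p. sect zc (b0 p) (b1 p) (b2 p) (b3 p) (r1 p) (r2 p) w)"
    unfolding sect_def by (intro regular_fun_intros regular_base_sect assms w)
qed

lemma regular_kappa:
  assumes "regular_fun ns U t0" "regular_fun ns U t1" "regular_fun ns U r1" "regular_fun ns U r2"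
  shows "regular_fun ns U (\<lambda>p. kappa zc (t0 p) (t1 p) (r1 p) (r2 p))"
  unfolding kappa_def norm_factor_def by (intro regular_fun_intros assms)

lemma chartS_open: "open_in [4, 2] (surf_times [2]) chartS" "chartS \<subseteq> multiproj [4, 2]"
proof -
  have m: "multihom [4, 2] (\<lambda>j. if j = 1 then 1 else 0) (mvar 1 0 :: 'k mpol)"
    by (intro multihom_mvar) auto
  show "open_in [4, 2] (surf_times [2]) chartS"
    unfolding chartS_def using surf_times_subset[of "[2]"]
    by (intro open_in_nonvanishing[OF _ _ m] open_in_nonvanishing[OF _ _ multihom_lform] open_in_self) auto
  show "chartS \<subseteq> multiproj [4, 2]" using surf_times_subset[of "[2]"] by (auto simp: chartS_def)
qed

lemma regular_bc: "regular_fun [4, 2] chartS (bc j)"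
  and regular_gc: "i \<le> 2 \<Longrightarrow> regular_fun [4, 2] chartS (gc i)"
proof -
  have m: "multihom [4, 2] (\<lambda>j. if j = 1 then 1 else 0) (mvar 1 i :: 'k mpol)" if "i \<le> 2" for i
    using that by (intro multihom_mvar) auto
  show "regular_fun [4, 2] chartS (bc j)"
    by (rule regular_fun_form_quot[OF chartS_open(2) multihom_lform multihom_lform]) (simp add: chartS_def)
  show "regular_fun [4, 2] chartS (gc i)" if "i \<le> 2"
    by (rule regular_fun_form_quot[OF chartS_open(2) m[OF that] m]) (simp_all add: chartS_def)
qed

lemma regular_rc: "regular_fun [4, 2] chartS r1c" "regular_fun [4, 2] chartS r2c"
  unfolding r1c_def[abs_def] r2c_def[abs_def]
  by (intro regular_fun_intros regular_bc regular_gc; simp)+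

lemma chartS_relations:
  assumes "p \<in> chartS"
  shows "bc 0 p * bc 2 p = bc (Suc 0) p + bc 3 p" "bc (Suc 0) p * bc 3 p = bc 0 p + bc 2 p"
proof -
  obtain v y :: "'k alg_closure vec" where vy: "v \<in> carrier_vec 5" "on_surface v" "lin cs v \<noteq> 0"
    "y \<in> carrier_vec 3" "y $ 0 \<noteq> 0" "p = [proj_point v, proj_point y]" using chartSE[OF assms] by metis
  note c = chartS_point(2)[OF vy(1-5), folded vy(6)]
  show "bc 0 p * bc 2 p = bc (Suc 0) p + bc 3 p" "bc (Suc 0) p * bc 3 p = bc 0 p + bc 2 p"
    unfolding c using vy(2,3) by (auto simp: on_surface_def field_simps)
qed

text \<open>All inequations but the last concern functions regular on \<open>chartS\<close> and are
  gathered in \<open>h\<close>. The last one involves the quotients \<open>f0\<close> to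
  \<open>f3\<close>, which become regular only on \<open>U\<close>.\<close>

lemma domS_regular:
  "open_in [4, 2] (surf_times [2]) domS"
  "regular_fun [4, 2] domS f0" "regular_fun [4, 2] domS f1" "regular_fun [4, 2] domS f2" "regular_fun [4, 2] domS f3"
proof -
  let ?reg = "regular_fun [4, 2]"
  define a0 where "a0 m p = coef zc m (sect zc (bc 0 p) (bc (Suc 0) p) (bc 2 p) (bc 3 p) (r1c p) (r2c p))" for m p
  define a1 where "a1 m p = coef zc m (sect zc (bc (Suc 0) p) (bc 2 p) (bc 3 p) (bc 0 p) (r2c p) (r1c p))" for m p
  define a2 where "a2 m p = coef zc m (sect zc (bc 2 p) (bc 3 p) (bc 0 p) (bc (Suc 0) p) (r1c p) (r2c p))" for m p
  define a3 where "a3 m p = coef zc m (sect zc (bc 3 p) (bc 0 p) (bc (Suc 0) p) (bc 2 p) (r2c p) (r1c p))" for m p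
  note ad = a0_def[abs_def] a1_def[abs_def] a2_def[abs_def] a3_def[abs_def]
  have a: "?reg chartS (a0 m)" "?reg chartS (a1 m)" "?reg chartS (a2 m)" "?reg chartS (a3 m)" for m
    unfolding ad by (intro regular_coef_sect regular_bc regular_rc)+
  define d where "d p = (bc 0 p + bc 2 p)^3 - (bc (Suc 0) p + bc 3 p)^3" for p
  define k where "k p = kappa zc (bc 0 p + bc 2 p) (bc (Suc 0) p + bc 3 p) (r1c p) (r2c p)" for p
  define h where "h p = d p * k p * (1 - r1c p * r2c p) * (a0 0 p * a1 0 p * (a2 0 p * a3 0 p))" for p
  have "?reg chartS h"
    unfolding h_def[abs_def] d_def k_def
    by (intro regular_fun_intros regular_kappa regular_bc regular_rc a)
  define U where "U = {p \<in> chartS. h p \<noteq> 0}"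
  have U: "open_in [4, 2] (surf_times [2]) U"
    unfolding U_def using surf_times_subset[of "[2]"] \<open>?reg chartS h\<close> chartS_open(1)
    by (intro open_in_regular_fun) auto
  have Us: "U \<subseteq> chartS" by (auto simp: U_def)
  have nz: "a0 0 p \<noteq> 0" "a1 0 p \<noteq> 0" "a2 0 p \<noteq> 0" "a3 0 p \<noteq> 0" "p \<in> multiproj [4, 2]" if "p \<in> U" for p
    using that chartS_open(2) by (auto simp: U_def h_def)
  note aU = a[THEN regular_fun_subset[OF _ Us]]
  have f: "f0 = (\<lambda>p. a0 1 p / a0 0 p)" "f1 = (\<lambda>p. a1 1 p / a1 0 p)"
    "f2 = (\<lambda>p. a2 1 p / a2 0 p)" "f3 = (\<lambda>p. a3 1 p / a3 0 p)"
    unfolding f0_def[abs_def] f1_def[abs_def] f2_def[abs_def] f3_def[abs_def] K.fib_coord_def ad by (rule refl)+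
  have fU: "?reg U f0" "?reg U f1" "?reg U f2" "?reg U f3"
    unfolding f by (intro regular_fun_divide aU; use nz in blast)+
  have D: "domS = {p \<in> U. 1 - f0 p * f1 p * f2 p * f3 p \<noteq> 0}"
  proof (rule Set.set_eqI)
    fix p
    show "p \<in> domS \<longleftrightarrow> p \<in> {p \<in> U. 1 - f0 p * f1 p * f2 p * f3 p \<noteq> 0}"
    proof (cases "p \<in> chartS")
      case True
      show ?thesis
        using chartS_relations[OF True] True
        unfolding domS_def U_def mem_Collect_eq K.dom_surf_def h_def mult_eq_0_iff de_Morgan_disj
          f0_def[symmetric] f1_def[symmetric] f2_def[symmetric] f3_def[symmetric]
          d_def[symmetric] k_def[symmetric] a0_def[symmetric] a1_def[symmetric] a2_def[symmetric] a3_def[symmetric]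
        by blast
    qed (simp add: domS_def U_def)
  qed
  show "open_in [4, 2] (surf_times [2]) domS"
    unfolding D using surf_times_subset[of "[2]"] U
    by (intro open_in_regular_fun regular_fun_intros fU) auto
  have "domS \<subseteq> U" unfolding D by blast
  then show "?reg domS f0" "?reg domS f1" "?reg domS f2" "?reg domS f3"
    using fU regular_fun_subset by blast+
qed

lemma regular_phi: "regular_map [4, 2] domS [4] domL phi"
proof (rule regular_mapI[where f = "\<lambda>j i p. [1, f0 p, f1 p, f2 p, f3 p] ! i"])
  show "phi \<in> domS \<rightarrow> domL" using phi_domL by blast
  show "domS \<subseteq> multiproj [4, 2]" using chartS_open(2) by (auto simp: domS_def)
  show "regular_fun [4, 2] domS (\<lambda>p. [1, f0 p, f1 p, f2 p, f3 p] ! i)" if "j < length [4]" "i \<le> [4] ! j" for i j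
  proof -
    have "i = 0 \<or> i = Suc 0 \<or> i = 2 \<or> i = 3 \<or> i = (4::nat)" using that by auto
    then show ?thesis using domS_regular regular_fun_1 by (auto simp: eval_nat_numeral)
  qed
qed (auto simp: phi_def vec5_def intro!: exI[of _ 0])

lemma regular_solve_r:
  assumes "regular_fun ns U u0" "regular_fun ns U u1" "regular_fun ns U u2" "regular_fun ns U u3"
    "U \<subseteq> multiproj ns" "\<And>p. p \<in> U \<Longrightarrow> 1 - u0 p * u1 p * u2 p * u3 p \<noteq> 0"
  shows "regular_fun ns U (\<lambda>p. solve_r (u0 p) (u1 p) (u2 p) (u3 p))"
  unfolding solve_r_def using assms(5,6)
  by (intro regular_fun_divide regular_fun_intros assms(1-4)) auto

lemma chartL_open: "open_in [4] (multiproj [4]) chartL" "chartL \<subseteq> multiproj [4]"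
  and regular_uc: "i \<le> 3 \<Longrightarrow> regular_fun [4] chartL (uc i)"
proof -
  have m: "multihom [4] (\<lambda>j. if j = 0 then 1 else 0) (mvar 0 i :: 'k mpol)" if "i \<le> 4" for i
    using that by (intro multihom_mvar) auto
  show "open_in [4] (multiproj [4]) chartL"
    unfolding chartL_def by (intro open_in_nonvanishing[OF _ _ m] open_in_self) auto
  show s: "chartL \<subseteq> multiproj [4]" by (auto simp: chartL_def)
  show "i \<le> 3 \<Longrightarrow> regular_fun [4] chartL (uc i)"
    by (rule regular_fun_form_quot[OF s m m]) (simp_all add: chartL_def)
qed

lemma yq_eq: "yq q w = (1 + w * uc 0 q + w^2 * solve_r (uc 0 q) (uc (Suc 0) q) (uc 2 q) (uc 3 q)) /
    base_sect zc (s0 q) (s1 q) (s2 q) (s3 q) w"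
  unfolding yq_def K.lin_quot_def K.fib_quot_def s0_def s1_def s2_def s3_def by (rule refl)

text \<open>The conditions have to be imposed in stages, since a function is regular only where all
  earlier denominators are nonzero: \<open>W1\<close> admits \<open>solve_r\<close>,
  \<open>W2\<close> the surface coordinates, \<open>W3\<close> the quotient \<open>yq\<close>,
  \<open>W4\<close> the functions \<open>rho1\<close> and \<open>rho2\<close>, and \<open>W5\<close>
  completes the domain.\<close>

lemma domL_regular:
  "open_in [4] (multiproj [4]) domL"
  "regular_fun [4] domL s0" "regular_fun [4] domL s1" "regular_fun [4] domL s2" "regular_fun [4] domL s3"
  "regular_fun [4] domL g1" "regular_fun [4] domL g2"
proof -
  let ?reg = "regular_fun [4]"
  have step: "open_in [4] (multiproj [4]) {q \<in> V. h q \<noteq> 0}" if "open_in [4] (multiproj [4]) V" "?reg V h" for V h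
    using that by (intro open_in_regular_fun) auto
  have u: "?reg chartL (uc 0)" "?reg chartL (uc (Suc 0))" "?reg chartL (uc 2)" "?reg chartL (uc 3)"
    by (rule regular_uc, simp)+
  define e where "e q = 1 - uc 0 q * uc (Suc 0) q * uc 2 q * uc 3 q" for q
  define W1 where "W1 = {q \<in> chartL. e q \<noteq> 0}"
  have o1: "open_in [4] (multiproj [4]) W1" unfolding W1_def e_def
    by (intro step chartL_open regular_fun_intros u)
  have W1: "W1 \<subseteq> chartL" by (auto simp: W1_def)
  note u1 = u[THEN regular_fun_subset[OF _ W1]]
  have m1: "W1 \<subseteq> multiproj [4]" using W1 chartL_open(2) by blast
  have e1: "1 - uc 0 q * uc (Suc 0) q * uc 2 q * uc 3 q \<noteq> 0" "1 - uc (Suc 0) q * uc 2 q * uc 3 q * uc 0 q \<noteq> 0"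
    "1 - uc 2 q * uc 3 q * uc 0 q * uc (Suc 0) q \<noteq> 0" "1 - uc 3 q * uc 0 q * uc (Suc 0) q * uc 2 q \<noteq> 0"
    if "q \<in> W1" for q
    using that unfolding W1_def e_def mem_Collect_eq by (simp_all only: mult_ac simp_thms)
  define R0 where "R0 q = solve_r (uc 0 q) (uc (Suc 0) q) (uc 2 q) (uc 3 q)" for q
  define R1 where "R1 q = solve_r (uc (Suc 0) q) (uc 2 q) (uc 3 q) (uc 0 q)" for q
  define R2 where "R2 q = solve_r (uc 2 q) (uc 3 q) (uc 0 q) (uc (Suc 0) q)" for q
  define R3 where "R3 q = solve_r (uc 3 q) (uc 0 q) (uc (Suc 0) q) (uc 2 q)" for q
  note Rs = R0_def[symmetric] R1_def[symmetric] R2_def[symmetric] R3_def[symmetric]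
  have R: "?reg W1 R0" "?reg W1 R1" "?reg W1 R2" "?reg W1 R3"
    unfolding R0_def[abs_def] R1_def[abs_def] R2_def[abs_def] R3_def[abs_def]
    by (intro regular_solve_r u1 m1; use e1 in blast)+
  define n0 where "n0 q = K.pair_norm (uc 0 q) (uc (Suc 0) q) (uc 2 q) (uc 3 q)" for q
  define n1 where "n1 q = K.pair_norm (uc (Suc 0) q) (uc 2 q) (uc 3 q) (uc 0 q)" for q
  define n2 where "n2 q = K.pair_norm (uc 2 q) (uc 3 q) (uc 0 q) (uc (Suc 0) q)" for q
  define n3 where "n3 q = K.pair_norm (uc 3 q) (uc 0 q) (uc (Suc 0) q) (uc 2 q)" for q
  note ns = n0_def[symmetric] n1_def[symmetric] n2_def[symmetric] n3_def[symmetric]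
  have n: "?reg W1 n0" "?reg W1 n1" "?reg W1 n2" "?reg W1 n3"
    unfolding n0_def[abs_def] n1_def[abs_def] n2_def[abs_def] n3_def[abs_def] K.pair_norm_def Rs
    by (intro regular_fun_intros u1 R)+
  define W2 where "W2 = {q \<in> W1. n0 q * n1 q * (n2 q * n3 q) \<noteq> 0}"
  have o2: "open_in [4] (multiproj [4]) W2" unfolding W2_def by (intro step o1 regular_fun_intros n)
  have W2: "W2 \<subseteq> W1" by (auto simp: W2_def)
  note u2 = u1[THEN regular_fun_subset[OF _ W2]] and R2 = R[THEN regular_fun_subset[OF _ W2]]
    and n2 = n[THEN regular_fun_subset[OF _ W2]]
  have nz2: "n0 q \<noteq> 0" "n1 q \<noteq> 0" "n2 q \<noteq> 0" "n3 q \<noteq> 0" "q \<in> multiproj [4]" if "q \<in> W2" for q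
    using that m1 by (auto simp: W2_def)
  have s: "?reg W2 s0" "?reg W2 s1" "?reg W2 s2" "?reg W2 s3"
    unfolding s0_def[abs_def] s1_def[abs_def] s2_def[abs_def] s3_def[abs_def] K.surf_coord_def Rs ns
    by (intro regular_fun_divide regular_fun_intros u2 R2 n2; use nz2 in blast)+
  define d where "d q = (s0 q + s2 q)^3 - (s1 q + s3 q)^3" for q
  define c where "c w q = base_sect zc (s0 q) (s1 q) (s2 q) (s3 q) w" for w q
  have d: "?reg W2 d" unfolding d_def[abs_def] by (intro regular_fun_intros s)
  have c: "?reg W2 (c w)" if "w \<in> {1, zc, zc^2}" for w
    unfolding c_def[abs_def] by (intro regular_base_sect s that)
  define W3 where "W3 = {q \<in> W2. d q * (c 1 q * (c zc q * c (zc^2) q)) \<noteq> 0}"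
  have o3: "open_in [4] (multiproj [4]) W3" unfolding W3_def
    by (intro step o2 regular_fun_mult d c) auto
  have W3: "W3 \<subseteq> W2" by (auto simp: W3_def)
  have m3: "q \<in> multiproj [4]" if "q \<in> W3" for q using that W3 nz2(5) by blast
  have nz3: "c w q \<noteq> 0" if "q \<in> W3" "w \<in> {1, zc, zc^2}" for q w using that by (auto simp: W3_def)
  note u3 = u2[THEN regular_fun_subset[OF _ W3]] and R3 = R2[THEN regular_fun_subset[OF _ W3]]
  have y: "?reg W3 (\<lambda>q. coef zc m (yq q))" for m
  proof (rule regular_coef)
    fix w assume w: "w \<in> {1, zc, zc^2}"
    then have "?reg W3 (\<lambda>_. w)" by (auto intro!: regular_fun_intros)
    then show "?reg W3 (\<lambda>q. yq q w)"
      unfolding yq_eq Rs c_def[symmetric]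
      by (intro regular_fun_divide regular_fun_intros u3 R3 regular_fun_subset[OF c[OF w] W3])
        (use m3 nz3 w in blast)+
  qed
  define y0 where "y0 q = coef zc 0 (yq q)" for q
  define y1 where "y1 q = coef zc 1 (yq q)" for q
  define y2 where "y2 q = coef zc 2 (yq q)" for q
  note ys = y0_def[symmetric] y1_def[symmetric] y2_def[symmetric]
  have y: "?reg W3 y0" "?reg W3 y1" "?reg W3 y2"
    unfolding y0_def[abs_def] y1_def[abs_def] y2_def[abs_def] by (rule y)+
  define n where "n q = (y0 q)^2 - y1 q * y2 q" for q
  have n3: "?reg W3 n" unfolding n_def[abs_def] by (intro regular_fun_intros y)
  define W4 where "W4 = {q \<in> W3. y0 q * n q \<noteq> 0}"
  have o4: "open_in [4] (multiproj [4]) W4" unfolding W4_def by (intro step o3 regular_fun_mult y n3)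
  have W4: "W4 \<subseteq> W3" by (auto simp: W4_def)
  have nz4: "y0 q \<noteq> 0" "n q \<noteq> 0" "q \<in> multiproj [4]" if "q \<in> W4" for q using that m3 by (auto simp: W4_def)
  define p1 where "p1 q = K.rho1 (yq q)" for q
  define p2 where "p2 q = K.rho2 (yq q)" for q
  note y4 = y[THEN regular_fun_subset[OF _ W4]] n3[THEN regular_fun_subset[OF _ W4]]
  have p: "?reg W4 p1" "?reg W4 p2"
    unfolding p1_def[abs_def] p2_def[abs_def] K.rho1_def K.rho2_def ys n_def[symmetric]
    by (intro regular_fun_divide regular_fun_intros y4; use nz4 in blast)+
  have W42: "W4 \<subseteq> W2" using W4 W3 by blast
  note s4 = s[THEN regular_fun_subset[OF _ W42]]
  define k where "k q = kappa zc (s0 q + s2 q) (s1 q + s3 q) (p1 q) (p2 q)" for q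
  define W5 where "W5 = {q \<in> W4. k q * (1 - p1 q * p2 q) \<noteq> 0}"
  have o5: "open_in [4] (multiproj [4]) W5"
    unfolding W5_def k_def by (intro step o4 regular_fun_intros regular_kappa s4 p)
  have D: "domL = W5"
    unfolding domL_def W5_def W4_def W3_def W2_def W1_def K.dom_lin_def Let_def
      mem_Collect_eq mult_eq_0_iff de_Morgan_disj e_def ns
      s0_def[symmetric] s1_def[symmetric] s2_def[symmetric] s3_def[symmetric] yq_def[symmetric]
      ys n_def[symmetric] p1_def[symmetric] p2_def[symmetric] k_def[symmetric] d_def[symmetric] c_def[symmetric]
    by blast
  show "open_in [4] (multiproj [4]) domL" unfolding D by (rule o5)
  have W5: "W5 \<subseteq> W4" "W5 \<subseteq> W2" using W42 by (auto simp: W5_def)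
  note s5 = s[THEN regular_fun_subset[OF _ W5(2)]] and p5 = p[THEN regular_fun_subset[OF _ W5(1)]]
  show "?reg domL s0" "?reg domL s1" "?reg domL s2" "?reg domL s3" unfolding D by (rule s5)+
  have nz5: "d q \<noteq> 0" "q \<in> multiproj [4]" if "q \<in> W5" for q
    using that W5 W4 m3 by (auto simp: W3_def)
  note d5 = d[THEN regular_fun_subset[OF _ W5(2)]]
  show "?reg domL g1" "?reg domL g2"
    unfolding D g1_def[abs_def] g2_def[abs_def] d_def[symmetric] p1_def[symmetric] p2_def[symmetric]
    by (intro regular_fun_divide regular_fun_intros s5 p5 d5; use nz5 in blast)+
qed

lemma regular_vecof:
  assumes "regular_fun ns U b0" "regular_fun ns U b1" "regular_fun ns U b2" "regular_fun ns U b3" "i < 5"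
  shows "regular_fun ns U (\<lambda>q. vecof 1 (b0 q) (b1 q) (b2 q) (b3 q) $ i)"
proof -
  have c: "2 * th = to_ac (2 * (z - z^2))" by simp
  have d: "regular_fun ns U (\<lambda>q. f q / 2)" "regular_fun ns U (\<lambda>q. f q / 3)" "regular_fun ns U (\<lambda>q. f q / (2 * th))"
    if f: "regular_fun ns U f" for f
    unfolding c using regular_fun_divide_const[OF f, of 2] regular_fun_divide_const[OF f, of 3]
      regular_fun_divide_const[OF f, of "2 * (z - z^2)"] by simp_all
  have "i = 0 \<or> i = Suc 0 \<or> i = 2 \<or> i = 3 \<or> i = 4" using assms(5) by auto
  then show ?thesis
    by (elim disjE; simp only: vecof_index; intro d regular_fun_intros assms)
qed

lemma regular_psi: "regular_map [4] domL [4, 2] domS psi"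
proof (rule regular_mapI[where f = "\<lambda>j i q. if j = 0 then vecof 1 (s0 q) (s1 q) (s2 q) (s3 q) $ i
    else [1, g1 q, g2 q] ! i"])
  show "psi \<in> domL \<rightarrow> domS" using psi_domS by blast
  show "domL \<subseteq> multiproj [4]" using chartL_open(2) by (auto simp: domL_def)
  fix j i :: nat assume ji: "j < length [4, 2 :: nat]" "i \<le> [4, 2] ! j"
  show "regular_fun [4] domL (\<lambda>q. if j = 0 then vecof 1 (s0 q) (s1 q) (s2 q) (s3 q) $ i else [1, g1 q, g2 q] ! i)"
  proof (cases "j = 0")
    case True
    then have "i < 5" using ji by simp
    then show ?thesis using regular_vecof[OF domL_regular(2-5)] True by simp
  next
    case False
    then have "i = 0 \<or> i = Suc 0 \<or> i = 2" using ji by (auto simp: less_Suc_eq)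
    then show ?thesis using False domL_regular(6,7) regular_fun_1 by (auto simp: eval_nat_numeral)
  qed
next
  fix q j assume q: "q \<in> domL" and j: "j < length [4, 2 :: nat]"
  have v: "vec 5 (\<lambda>i. v $ i) = v" if "v \<in> carrier_vec 5" for v :: "'k alg_closure vec" using that by auto
  show "psi q ! j = proj_point (vec (Suc ([4, 2] ! j))
      (\<lambda>i. if j = 0 then vecof 1 (s0 q) (s1 q) (s2 q) (s3 q) $ i else [1, g1 q, g2 q] ! i))"
    using j v[OF vecof_carrier] by (cases "j = 0") (simp_all add: psi_def vec3_def)
  show "\<exists>i\<le>[4, 2] ! j. (if j = 0 then vecof 1 (s0 q) (s1 q) (s2 q) (s3 q) $ i else [1, g1 q, g2 q] ! i) \<noteq> 0"
  proof (cases "j = 0")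
    case True
    have "\<exists>i<5. vecof 1 (s0 q) (s1 q) (s2 q) (s3 q) $ i \<noteq> 0"
    proof (rule ccontr)
      assume "\<not> ?thesis"
      then have "vecof 1 (s0 q) (s1 q) (s2 q) (s3 q) = 0\<^sub>v 5"
        using carrier_vecD[OF vecof_carrier] by (intro eq_vecI) auto
      then show False using lin_vecof(1)[of 1 "s0 q" "s1 q" "s2 q" "s3 q"] lin_zero by simp
    qed
    then obtain i where "i < 5" "vecof 1 (s0 q) (s1 q) (s2 q) (s3 q) $ i \<noteq> 0" by blast
    then show ?thesis using True by (intro exI[of _ i]) auto
  qed (auto intro!: exI[of _ 0])
qed

lemma domS_witness:
  obtains p x where "p \<in> domS" "x \<in> coords p" "in_chart (x 0)"
proof -
  define e where "e = 1 + 2 * zc"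
  let ?v = "vecof 1 0 e 3 (- e)" and ?y = "vec3 [1, 0, 0]"
  let ?p = "[proj_point ?v, proj_point ?y]"
  have w: "K.dom_surf 0 e 3 (- e) 0 0" using K.dom_surf_witness unfolding e_def .
  then have "0 * 3 = e + - e" "e * (- e) = 0 + 3" by (auto simp: K.dom_surf_def)
  then have o: "on_surface ?v" by (simp add: on_surface_def lin_vecof)
  have l: "lin cs ?v \<noteq> 0" by (simp add: lin_vecof)
  have y: "?y \<in> carrier_vec 3" "?y $ 0 \<noteq> 0" by (simp_all add: vec3_index)
  note c = chartS_point[OF vecof_carrier o l y]
  have b: "bc 0 ?p = 0" "bc (Suc 0) ?p = e" "bc 2 ?p = 3" "bc 3 ?p = - e" "gc 1 ?p = 0" "gc 2 ?p = 0"
    using c(2) c(3)[of 1] c(3)[of 2] by (simp_all add: lin_vecof vec3_index)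
  have "?p \<in> domS" using c(1) w b by (simp add: domS_def r1c_def r2c_def)
  moreover have "(\<lambda>j. if j = 0 then ?v else ?y) \<in> coords ?p"
    by (auto simp: coords_def nth_Cons proj_point_self split: nat.splits)
  moreover have "in_chart ?v" by (simp add: in_chart_def lin_vecof)
  ultimately show thesis using that[of ?p "\<lambda>j. if j = 0 then ?v else ?y"] by simp
qed

text \<open>One point of \<open>domS\<close> settles both claims, because its image under
  \<open>phi\<close> lies in \<open>domL\<close>.\<close>

lemma dense_open_domS: "dense_open [4, 2] (surf_times [2]) domS"
  and dense_open_domL: "dense_open [4] (multiproj [4]) domL"
proof -
  obtain p x where p: "p \<in> domS" "x \<in> coords p" "in_chart (x 0)" by (rule domS_witness)
  show "dense_open [4, 2] (surf_times [2]) domS" by (rule dense_open_surf_times[OF domS_regular(1) p])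
  show "dense_open [4] (multiproj [4]) domL"
    by (rule dense_open_projective_space[OF domL_regular(1) phi_domL(1)[OF p(1)]])
qed

definition s2P :: "'k mpoint \<Rightarrow> 'k mpoint" where "s2P p = sP (butlast p) @ [last p]"
definition t2P :: "'k mpoint \<Rightarrow> 'k mpoint" where "t2P p = tP (butlast p) @ [last p]"

lemma mact_phi:
  assumes "M \<in> carrier_mat 5 5"
  shows "mact M (phi p) = [proj_point (map_mat to_ac M *\<^sub>v vec5 [1, f0 p, f1 p, f2 p, f3 p])]"
  unfolding mact_def phi_def using assms
  by (simp, intro image_proj_point mult_mat_vec[of _ 5 5]) (simp_all add: vec5_index)

lemma phi_sigma:
  assumes "p \<in> domS" shows "s2P p \<in> domS \<and> phi (s2P p) = mact SL (phi p)"
proof -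
  have p: "p \<in> chartS" "K.dom_surf (bc 0 p) (bc (Suc 0) p) (bc 2 p) (bc 3 p) (r1c p) (r2c p)"
    using assms by (auto simp: domS_def)
  obtain v y :: "'k alg_closure vec" where vy: "v \<in> carrier_vec 5" "on_surface v" "lin cs v \<noteq> 0"
    "y \<in> carrier_vec 3" "y $ 0 \<noteq> 0" "p = [proj_point v, proj_point y]" using chartSE[OF p(1)] by metis
  note c = chartS_point[OF vy(1-5), folded vy(6)]
  have l: "lin cs (lin_sigma z v) \<noteq> 0" using vy(3) by (simp add: lin_sigma_coords)
  have e: "s2P p = [proj_point (lin_sigma z v), proj_point y]"
    using sP_proj_point[OF vy(1)] by (simp add: s2P_def vy(6))
  note c' = chartS_point[OF sigma_carrier on_surface_sigma[OF vy(2)] l vy(4,5), folded e]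
  have b: "bc 0 (s2P p) = zc * bc 0 p" "bc (Suc 0) (s2P p) = zc^2 * bc (Suc 0) p"
    "bc 2 (s2P p) = zc * bc 2 p" "bc 3 (s2P p) = zc^2 * bc 3 p"
    "gc 1 (s2P p) = gc 1 p" "gc 2 (s2P p) = gc 2 p"
    unfolding c'(2) c(2) using c(3)[of 1] c'(3)[of 1] c(3)[of 2] c'(3)[of 2]
    by (simp_all add: lin_sigma_coords)
  \<comment> \<open>The square of \<open>b1 + b3\<close> is scaled by \<open>zc^4 = zc\<close>, like
    \<open>b0 + b2\<close>; the exponents in the twist are chosen for this.\<close>
  have "r1c (s2P p) = zc * r1c p"
    unfolding r1c_def b using K.z3 by Groebner_Basis.algebra
  moreover have "r2c (s2P p) = zc^2 * r2c p"
    unfolding r2c_def b by (simp add: algebra_simps power2_eq_square)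
  ultimately have r: "r1c (s2P p) = zc * r1c p" "r2c (s2P p) = zc^2 * r2c p" by blast+
  have "K.dom_surf (zc * bc 0 p) (zc^2 * bc (Suc 0) p) (zc * bc 2 p) (zc^2 * bc 3 p) (zc * r1c p) (zc^2 * r2c p)"
    by (rule K.dom_surf_rotate[OF p(2)])
  then have d: "s2P p \<in> domS" using c'(1) unfolding domS_def mem_Collect_eq b r by blast
  have f: "f0 (s2P p) = zc * f0 p" "f1 (s2P p) = zc^2 * f1 p" "f2 (s2P p) = zc * f2 p" "f3 (s2P p) = zc^2 * f3 p"
    unfolding f0_def f1_def f2_def f3_def b r by (rule K.fib_coord_rotate)+
  have "vec5 [1, zc * f0 p, zc^2 * f1 p, zc * f2 p, zc^2 * f3 p] =
      map_mat to_ac SL *\<^sub>v vec5 [1, f0 p, f1 p, f2 p, f3 p]"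
    using SL_TL_carrier
    by (intro vec5_eqI)
      (simp_all add: map_SL_vec vec5_index weight_def mult_mat_vec_carrier[of _ 5 5] del: index_mult_mat_vec)
  then have "phi (s2P p) = mact SL (phi p)"
    unfolding mact_phi[OF SL_TL_carrier(1)] by (simp add: phi_def f)
  with d show ?thesis by blast
qed

lemma phi_tau:
  assumes "p \<in> domS" shows "t2P p \<in> domS \<and> phi (t2P p) = mact TL (phi p)"
proof -
  have p: "p \<in> chartS" "K.dom_surf (bc 0 p) (bc (Suc 0) p) (bc 2 p) (bc 3 p) (r1c p) (r2c p)"
    using assms by (auto simp: domS_def)
  obtain v y :: "'k alg_closure vec" where vy: "v \<in> carrier_vec 5" "on_surface v" "lin cs v \<noteq> 0"
    "y \<in> carrier_vec 3" "y $ 0 \<noteq> 0" "p = [proj_point v, proj_point y]" using chartSE[OF p(1)] by metis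
  note c = chartS_point[OF vy(1-5), folded vy(6)]
  have l: "lin cs (lin_tau v) \<noteq> 0" using vy(3) by (simp add: lin_tau_coords)
  have e: "t2P p = [proj_point (lin_tau v), proj_point y]"
    using tP_proj_point[OF vy(1)] by (simp add: t2P_def vy(6))
  note c' = chartS_point[OF tau_carrier on_surface_tau[OF vy(2)] l vy(4,5), folded e]
  have b: "bc 0 (t2P p) = bc (Suc 0) p" "bc (Suc 0) (t2P p) = bc 2 p"
    "bc 2 (t2P p) = bc 3 p" "bc 3 (t2P p) = bc 0 p"
    "gc 1 (t2P p) = gc 1 p" "gc 2 (t2P p) = gc 2 p"
    unfolding c'(2) c(2) using c(3)[of 1] c'(3)[of 1] c(3)[of 2] c'(3)[of 2]
    by (simp_all add: lin_tau_coords)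
  have r: "r1c (t2P p) = r2c p" "r2c (t2P p) = r1c p"
    unfolding r1c_def r2c_def b by (simp_all only: add.commute)
  have d: "t2P p \<in> domS" using c'(1) K.dom_surf_shift[OF p(2)] unfolding domS_def mem_Collect_eq b r by blast
  have f: "f0 (t2P p) = f1 p" "f1 (t2P p) = f2 p" "f2 (t2P p) = f3 p" "f3 (t2P p) = f0 p"
    unfolding f0_def f1_def f2_def f3_def b r by (rule refl)+
  have "vec5 [1, f1 p, f2 p, f3 p, f0 p] = map_mat to_ac TL *\<^sub>v vec5 [1, f0 p, f1 p, f2 p, f3 p]"
    using SL_TL_carrier
    by (intro vec5_eqI)
      (simp_all add: map_TL_vec vec5_index shift_def mult_mat_vec_carrier[of _ 5 5] del: index_mult_mat_vec)
  then have "phi (t2P p) = mact TL (phi p)"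
    unfolding mact_phi[OF SL_TL_carrier(2)] by (simp add: phi_def f)
  with d show ?thesis by blast
qed

lemma phi_sigma_pow:
  assumes "p \<in> domS" shows "(s2P ^^ n) p \<in> domS \<and> phi ((s2P ^^ n) p) = (mact SL ^^ n) (phi p)"
  by (induction n) (use assms phi_sigma in auto)

lemma phi_tau_pow:
  assumes "p \<in> domS" shows "(t2P ^^ n) p \<in> domS \<and> phi ((t2P ^^ n) p) = (mact TL ^^ n) (phi p)"
  by (induction n) (use assms phi_tau in auto)

lemma times_proj_action_word:
  assumes "p \<in> surf_times [2]"
  shows "times_proj_action (dP4_action z) (a, b) p = (s2P ^^ nat a) ((t2P ^^ nat b) p)"
proof -
  have "p \<in> times_proj (dP4 z) 2" using assms by (simp add: times_proj_dP4)
  then obtain q y where p: "p = q @ [y]" "q \<in> dP4 z" by (auto simp: times_proj_def)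
  have "(t2P ^^ n) (q @ [y]) = (tP ^^ n) q @ [y]" "(s2P ^^ n) (q @ [y]) = (sP ^^ n) q @ [y]" for n and q :: "'k mpoint"
    by (induction n) (simp_all add: s2P_def t2P_def)
  then show ?thesis using p by (simp add: times_proj_action_def dP4_action_eq)
qed

lemma phi_equivariant:
  assumes "p \<in> domS"
  shows "phi (times_proj_action (dP4_action z) g p) = proj_rep_action rep g (phi p)"
proof -
  obtain a b where g: "g = (a, b)" by (cases g)
  have p: "p \<in> surf_times [2]" using assms by (auto simp: domS_def chartS_def)
  have "in_dim 5 (phi p)" by (auto simp: in_dim_def phi_def proj_point_def vec5_index)
  then show ?thesis
    unfolding g times_proj_action_word[OF p] using proj_rep_action_rep phi_tau_pow[OF assms, of "nat b"] phi_sigma_pow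
    by metis
qed

theorem stably_linearizable_dP4: "stably_linearizable C3_C4 [4] (dP4 z) (dP4_action z)"
proof -
  have "equivariantly_birational C3_C4 ([4] @ [2]) (times_proj (dP4 z) 2) (times_proj_action (dP4_action z))
      [4] (multiproj [4]) (proj_rep_action rep)"
    unfolding equivariantly_birational_def times_proj_dP4
    by (intro exI[of _ domS] exI[of _ domL] exI[of _ phi] exI[of _ psi])
      (simp add: dense_open_domS dense_open_domL regular_phi regular_psi phi_domL psi_domS phi_equivariant)
  moreover have "rep \<in> hom C3_C4 (GL (Suc 4))" using rep_hom by simp
  ultimately show ?thesis
    unfolding stably_linearizable_def using regular_action_dP4 generically_free_dP4
    by (intro conjI exI[of _ 2] exI[of _ 4] bexI[of _ rep]) (simp_all add: carrier_C3_C4)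
qed

end

theorem theorem1p4:
  fixes z :: "'k::field_char_0"
  assumes "z ^ 3 = 1" and "\<And>m::nat. 0 < m \<Longrightarrow> m < 3 \<Longrightarrow> z ^ m \<noteq> 1"
  shows "stably_linearizable C3_C4 [4] (dP4 z) (dP4_action z)"
proof -
  have "z \<noteq> 1" using assms(2)[of 1] by simp
  moreover have "(z - 1) * (z^2 + z + 1) = z^3 - 1" by (simp add: algebra_simps eval_nat_numeral)
  ultimately interpret dp4 z using assms(1) by unfold_locales auto
  show ?thesis by (rule stably_linearizable_dP4)
qed

end
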